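(* Let $X$ be a closed oriented surface of genus $\geq 2$, let $\star\in X$, and let $\Gamma=\mathrm{Mod}(X')$, where $X'=X\setminus\{\star\}$. Then no homological representation of $\Gamma$ is faithful.
   Context: $\Gamma=\mathrm{Mod}(X')$ is the group of orientation-preserving diffeomorphisms $X\to X$ fixing the point $\star$, modulo isotopies fixing $\star$. It acts on $\pi=\pi_1(X,\star)$, giving a natural map $\Gamma\to\mathrm{Aut}(\pi)$. Homological representations: let $f:Y\to X$ be a finite characteristic cover, i.e. the cover corresponding to a finite-index characteristic subgroup $K\leq\pi$. Since $K$ is characteristic, restriction gives a homomorphism $\Gamma\to\mathrm{Aut}(\pi)\to\mathrm{Aut}(K)$, which induces $\rho=\rho_f:\Gamma\to\mathrm{Aut}(H_1(K,\mathbb{Z}))\cong\mathrm{GL}(H_1(Y,\mathbb{Z}))$. The homological representations of $\Gamma$ are the representations $\rho_f$ arising in this way. *)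

theory Defs
  imports "HOL-Analysis.Analysis" "HOL-Homology.Homology" "HOL-Algebra.Generated_Groups" "HOL-Algebra.Bij"
begin

section \<open>Smooth maps between open subsets of Euclidean spaces\<close>

text \<open>These predicates are meant for open \<open>U\<close> only.  The quantifier over all directions \<open>v\<close>
  expresses that all partial derivatives are again of class \<open>C\<close> to the \<open>k\<close>.\<close>

primrec Ck_on :: "nat \<Rightarrow> 'a set \<Rightarrow> ('a::euclidean_space \<Rightarrow> 'b::euclidean_space) \<Rightarrow> bool" where
  "Ck_on 0 U f \<longleftrightarrow> continuous_on U f"
| "Ck_on (Suc k) U f \<longleftrightarrow>
     (\<forall>x\<in>U. f differentiable (at x)) \<and> (\<forall>v. Ck_on k U (\<lambda>x. frechet_derivative f (at x) v))"

definition smooth_on :: "'a set \<Rightarrow> ('a::euclidean_space \<Rightarrow> 'b::euclidean_space) \<Rightarrow> bool" where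
  "smooth_on U f \<longleftrightarrow> (\<forall>k. Ck_on k U f)"

definition positive_jacobian_on :: "(real^2) set \<Rightarrow> (real^2 \<Rightarrow> real^2) \<Rightarrow> bool" where
  "positive_jacobian_on U f \<longleftrightarrow> (\<forall>x\<in>U. 0 < det (matrix (frechet_derivative f (at x))))"

section \<open>Closed oriented smooth surfaces\<close>

text \<open>A surface is a subspace \<open>X\<close> of a topological space together with an atlas; a chart is a
  pair of its domain and its coordinate map (whose values outside the domain are irrelevant).\<close>

type_synonym 'a chart = "'a set \<times> ('a \<Rightarrow> real^2)"

definition is_chart :: "'a::topological_space set \<Rightarrow> 'a chart \<Rightarrow> bool" where
  "is_chart X c \<longleftrightarrow> (case c of (U, \<phi>) \<Rightarrow>
     openin (top_of_set X) U \<and> open (\<phi> ` U) \<and> homeomorphism U (\<phi> ` U) \<phi> (inv_into U \<phi>))"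

definition oriented_atlas :: "'a::topological_space set \<Rightarrow> 'a chart set \<Rightarrow> bool" where
  "oriented_atlas X A \<longleftrightarrow>
     (\<forall>c\<in>A. is_chart X c) \<and> \<Union> (fst ` A) = X \<and>
     (\<forall>(U, \<phi>)\<in>A. \<forall>(V, \<psi>)\<in>A.
        smooth_on (\<phi> ` (U \<inter> V)) (\<psi> \<circ> inv_into U \<phi>) \<and>
        positive_jacobian_on (\<phi> ` (U \<inter> V)) (\<psi> \<circ> inv_into U \<phi>))"

definition closed_oriented_surface :: "'a::topological_space set \<Rightarrow> 'a chart set \<Rightarrow> bool" where
  "closed_oriented_surface X A \<longleftrightarrow>
     X \<noteq> {} \<and> connected X \<and> compact X \<and> Hausdorff_space (top_of_set X) \<and> oriented_atlas X A"

text \<open>The genus is half the rank of the first integral homology group, which is free abelian for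
  a closed oriented surface.\<close>

definition has_genus :: "'a::topological_space set \<Rightarrow> nat \<Rightarrow> bool" where
  "has_genus X g \<longleftrightarrow> homology_group 1 (top_of_set X) \<cong> free_Abelian_group {..<2 * g}"

section \<open>Diffeomorphisms, isotopies and the mapping class group\<close>

definition smooth_map :: "'a::topological_space set \<Rightarrow> 'a chart set \<Rightarrow> ('a \<Rightarrow> 'a) \<Rightarrow> bool" where
  "smooth_map X A f \<longleftrightarrow>
     continuous_on X f \<and> f ` X \<subseteq> X \<and>
     (\<forall>(U, \<phi>)\<in>A. \<forall>(V, \<psi>)\<in>A. smooth_on (\<phi> ` (U \<inter> f -` V)) (\<psi> \<circ> f \<circ> inv_into U \<phi>))"

definition diffeomorphism :: "'a::topological_space set \<Rightarrow> 'a chart set \<Rightarrow> ('a \<Rightarrow> 'a) \<Rightarrow> bool" where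
  "diffeomorphism X A f \<longleftrightarrow>
     bij_betw f X X \<and> smooth_map X A f \<and> smooth_map X A (inv_into X f)"

definition orientation_preserving ::
    "'a::topological_space set \<Rightarrow> 'a chart set \<Rightarrow> ('a \<Rightarrow> 'a) \<Rightarrow> bool" where
  "orientation_preserving X A f \<longleftrightarrow>
     (\<forall>(U, \<phi>)\<in>A. \<forall>(V, \<psi>)\<in>A.
        positive_jacobian_on (\<phi> ` (U \<inter> f -` V)) (\<psi> \<circ> f \<circ> inv_into U \<phi>))"

text \<open>As in \<^const>\<open>Bij\<close>, self-maps of \<open>X\<close> are represented by functions that are undefined
  outside \<open>X\<close>.\<close>

definition diffeos :: "'a::topological_space set \<Rightarrow> 'a chart set \<Rightarrow> 'a \<Rightarrow> ('a \<Rightarrow> 'a) set" where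
  "diffeos X A p =
     {f \<in> Bij X. diffeomorphism X A f \<and> orientation_preserving X A f \<and> f p = p}"

text \<open>The time parameter ranges over all of the reals, to avoid manifolds with boundary; an
  isotopy over the unit interval can be reparametrised to be constant near its ends and then
  extended.\<close>

definition isotopic :: "'a::topological_space set \<Rightarrow> 'a chart set \<Rightarrow> 'a \<Rightarrow>
    ('a \<Rightarrow> 'a) \<Rightarrow> ('a \<Rightarrow> 'a) \<Rightarrow> bool" where
  "isotopic X A p f g \<longleftrightarrow>
     (\<exists>H :: real \<Rightarrow> 'a \<Rightarrow> 'a.
        H 0 = f \<and> H 1 = g \<and> (\<forall>t. H t \<in> diffeos X A p) \<and>
        continuous_on (UNIV \<times> X) (\<lambda>(t, x). H t x) \<and>
        (\<forall>(U, \<phi>)\<in>A. \<forall>(V, \<psi>)\<in>A.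
           smooth_on {(t, y). y \<in> \<phi> ` (U \<inter> H t -` V)}
             (\<lambda>(t, y). \<psi> (H t (inv_into U \<phi> y)))))"

definition diffeo_group ::
    "'a::topological_space set \<Rightarrow> 'a chart set \<Rightarrow> 'a \<Rightarrow> ('a \<Rightarrow> 'a) monoid" where
  "diffeo_group X A p = BijGroup X \<lparr>carrier := diffeos X A p\<rparr>"

text \<open>Two elements are isotopic iff they lie in the same coset of the diffeomorphisms isotopic to
  the identity, so this quotient is the group of isotopy classes.\<close>

definition mapping_class_group ::
    "'a::topological_space set \<Rightarrow> 'a chart set \<Rightarrow> 'a \<Rightarrow> ('a \<Rightarrow> 'a) set monoid" where
  "mapping_class_group X A p =
     diffeo_group X A p Mod {f \<in> diffeos X A p. isotopic X A p (\<lambda>x\<in>X. x) f}"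

section \<open>The fundamental group\<close>

definition loops_at :: "'a::topological_space set \<Rightarrow> 'a \<Rightarrow> (real \<Rightarrow> 'a) set" where
  "loops_at X p = {\<gamma>. path \<gamma> \<and> path_image \<gamma> \<subseteq> X \<and> pathstart \<gamma> = p \<and> pathfinish \<gamma> = p}"

definition path_class :: "'a::topological_space set \<Rightarrow> (real \<Rightarrow> 'a) \<Rightarrow> (real \<Rightarrow> 'a) set" where
  "path_class X \<gamma> = {\<delta>. homotopic_paths X \<gamma> \<delta>}"

definition fundamental_group ::
    "'a::topological_space set \<Rightarrow> 'a \<Rightarrow> (real \<Rightarrow> 'a) set monoid" where
  "fundamental_group X p =
     \<lparr>carrier = path_class X ` loops_at X p,
      mult = (\<lambda>a b. \<Union>\<gamma>\<in>a. \<Union>\<delta>\<in>b. path_class X (\<gamma> +++ \<delta>)),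
      one = path_class X (\<lambda>_. p)\<rparr>"

definition fundamental_group_map ::
    "'a::topological_space set \<Rightarrow> 'a \<Rightarrow> ('a \<Rightarrow> 'a) \<Rightarrow> (real \<Rightarrow> 'a) set \<Rightarrow> (real \<Rightarrow> 'a) set" where
  "fundamental_group_map X p f =
     (\<lambda>a\<in>carrier (fundamental_group X p). \<Union>\<gamma>\<in>a. path_class X (f \<circ> \<gamma>))"

section \<open>Homological representations\<close>

definition finite_index_characteristic :: "'g set \<Rightarrow> 'g monoid \<Rightarrow> bool" where
  "finite_index_characteristic K G \<longleftrightarrow>
     subgroup K G \<and> finite (rcosets\<^bsub>G\<^esub> K) \<and> (\<forall>\<alpha>\<in>auto G. \<alpha> ` K = K)"

text \<open>The group \<open>H\<^sub>1(G, \<int>)\<close>, i.e. the abelianization of \<open>G\<close>.\<close>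

definition H1 :: "'g monoid \<Rightarrow> 'g set monoid" where
  "H1 G = G Mod derived G (carrier G)"

definition H1_map :: "'g monoid \<Rightarrow> ('g \<Rightarrow> 'g) \<Rightarrow> 'g set \<Rightarrow> 'g set" where
  "H1_map G \<alpha> = (\<lambda>C\<in>carrier (H1 G). \<alpha> ` C)"

text \<open>A diffeomorphism acts on \<open>\<pi>\<^sub>1(X, p)\<close>, hence on the characteristic subgroup \<open>K\<close>, hence
  on \<open>H\<^sub>1(K, \<int>)\<close>.  This action depends only on the isotopy class, which is why
  \<^const>\<open>the_elem\<close> may be applied to the set of actions of the members of a mapping class.\<close>

definition homological_action :: "'a::topological_space set \<Rightarrow> 'a \<Rightarrow> (real \<Rightarrow> 'a) set set \<Rightarrow>
    ('a \<Rightarrow> 'a) \<Rightarrow> (real \<Rightarrow> 'a) set set \<Rightarrow> (real \<Rightarrow> 'a) set set" where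
  "homological_action X p K f =
     H1_map (fundamental_group X p \<lparr>carrier := K\<rparr>) (restrict (fundamental_group_map X p f) K)"

definition homological_representation ::
    "'a::topological_space set \<Rightarrow> 'a chart set \<Rightarrow> 'a \<Rightarrow> (real \<Rightarrow> 'a) set set \<Rightarrow>
     ('a \<Rightarrow> 'a) set \<Rightarrow> (real \<Rightarrow> 'a) set set \<Rightarrow> (real \<Rightarrow> 'a) set set" where
  "homological_representation X A p K =
     (\<lambda>c\<in>carrier (mapping_class_group X A p). the_elem (homological_action X p K ` c))"

definition homological_representations ::
    "'a::topological_space set \<Rightarrow> 'a chart set \<Rightarrow> 'a \<Rightarrow>
     (('a \<Rightarrow> 'a) set \<Rightarrow> (real \<Rightarrow> 'a) set set \<Rightarrow> (real \<Rightarrow> 'a) set set) set" where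
  "homological_representations X A p =
     homological_representation X A p ` {K. finite_index_characteristic K (fundamental_group X p)}"

section \<open>Well-definedness\<close>

text \<open>The fundamental group is a group, and \<^const>\<open>homological_representation\<close> sends the class of a
  diffeomorphism to its action on \<open>H\<^sub>1(K, \<int>)\<close>.\<close>

lemma Ck_on_cong:
  assumes "open U" "\<And>x. x \<in> U \<Longrightarrow> f x = g x" "Ck_on k U f"
  shows "Ck_on k U g"
  using assms
proof (induction k arbitrary: f g)
  case 0
  then show ?case by (auto cong: continuous_on_cong)
next
  case (Suc k)
  have D: "(g has_derivative frechet_derivative f (at x)) (at x)" if "x \<in> U" for x
  proof -
    have "(f has_derivative frechet_derivative f (at x)) (at x)"
      using Suc.prems(3) that by (simp flip: frechet_derivative_works)
    from has_derivative_transform_within_open[OF this \<open>open U\<close> that Suc.prems(2)]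
    show ?thesis by simp
  qed
  have E: "frechet_derivative g (at x) = frechet_derivative f (at x)" if "x \<in> U" for x
    using frechet_derivative_at[OF D[OF that]] by simp
  have "Ck_on k U (\<lambda>x. frechet_derivative g (at x) v)" for v
    by (rule Suc.IH[OF \<open>open U\<close>, of "\<lambda>x. frechet_derivative f (at x) v"])
      (use Suc.prems(3) E in auto)
  moreover have "g differentiable (at x)" if "x \<in> U" for x
    using D[OF that] by (auto simp: differentiable_def)
  ultimately show ?case by simp
qed

lemma Ck_on_snd:
  fixes F :: "real^2 \<Rightarrow> real^2"
  assumes "open U" "Ck_on k U F"
  shows "Ck_on k (UNIV \<times> U) (\<lambda>z::real \<times> (real^2). F (snd z))"
  using assms
proof (induction k arbitrary: F)
  case 0
  then show ?case
    by (auto intro!: continuous_on_compose2[of U F] continuous_intros)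
next
  case (Suc k)
  have D: "((\<lambda>z::real \<times> (real^2). F (snd z)) has_derivative (\<lambda>v. frechet_derivative F (at (snd z)) (snd v))) (at z)"
    if "z \<in> UNIV \<times> U" for z
  proof -
    have "(F has_derivative frechet_derivative F (at (snd z))) (at (snd z))"
      using Suc.prems that by (auto simp flip: frechet_derivative_works)
    then show ?thesis
      using has_derivative_compose[OF has_derivative_snd[OF has_derivative_ident], of F] by blast
  qed
  have E: "frechet_derivative (\<lambda>z. F (snd z)) (at z) v = frechet_derivative F (at (snd z)) (snd v)"
    if "z \<in> UNIV \<times> U" for z :: "real \<times> (real^2)" and v
    using frechet_derivative_at[OF D[OF that]] by metis
  have "Ck_on k (UNIV \<times> U) (\<lambda>z. frechet_derivative (\<lambda>z. F (snd z)) (at z) v)" for v :: "real \<times> (real^2)"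
    by (rule Ck_on_cong[OF _ _ Suc.IH[of "\<lambda>x. frechet_derivative F (at x) (snd v)"]])
      (use Suc.prems E in \<open>auto intro: open_Times\<close>)
  moreover have "(\<lambda>z. F (snd z)) differentiable (at z)" if "z \<in> UNIV \<times> U" for z :: "real \<times> (real^2)"
    using D[OF that] unfolding differentiable_def by blast
  ultimately show ?case by simp
qed

lemma chart_overlap_open:
  assumes "oriented_atlas X A" "(U, \<phi>) \<in> A" "(V, \<psi>) \<in> A"
  shows "open (\<phi> ` (U \<inter> V))"
proof -
  have c: "is_chart X (U, \<phi>)" "is_chart X (V, \<psi>)"
    using assms by (auto simp: oriented_atlas_def)
  have "openin (top_of_set U) (U \<inter> V)"
    using c openin_Int[of "top_of_set X" U V]
    by (auto simp: is_chart_def intro: openin_subset_trans dest: openin_imp_subset)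
  then have "openin (top_of_set (\<phi> ` U)) (\<phi> ` (U \<inter> V))"
    using c homeomorphism_imp_open_map[of U "\<phi> ` U" \<phi>] by (auto simp: is_chart_def)
  then show ?thesis
    using c openin_open_eq by (auto simp: is_chart_def)
qed

lemma inv_into_restrict_id: "x \<in> X \<Longrightarrow> inv_into X (\<lambda>x\<in>X. x) x = x"
  by (metis (mono_tags, lifting) f_inv_into_f imageI inv_into_into restrict_apply')

lemma smooth_map_eq_id:
  assumes A: "oriented_atlas X A" and f: "\<And>x. x \<in> X \<Longrightarrow> f x = x"
  shows "smooth_map X A f" "orientation_preserving X A f"
    "(U, \<phi>) \<in> A \<Longrightarrow> (V, \<psi>) \<in> A \<Longrightarrow> smooth_on (UNIV \<times> \<phi> ` (U \<inter> V))
             (\<lambda>(t::real, y). \<psi> (f (inv_into U \<phi> y)))"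
proof -
  have sub: "U \<subseteq> X" if "(U, \<phi>) \<in> A" for U \<phi>
    using A that by (force simp: oriented_atlas_def)
  have i: "inv_into U \<phi> y \<in> X" if "(U, \<phi>) \<in> A" "y \<in> \<phi> ` U" for U y and \<phi> :: "'a \<Rightarrow> real^2"
    using that sub inv_into_into by (metis subsetD)
  have s: "U \<inter> f -` V = U \<inter> V" if "(U, \<phi>) \<in> A" for U V \<phi>
    using sub[OF that] f by auto
  show "smooth_map X A f"
    unfolding smooth_map_def
  proof (intro conjI ballI, goal_cases)
    case 1 show ?case using f by (simp cong: continuous_on_cong)
  next
    case 2 show ?case using f by auto
  next
    case (3 c)
    obtain U \<phi> where c: "c = (U, \<phi>)" by fastforce
    show ?case unfolding c split
    proof (intro ballI, clarify)
      fix V \<psi> assume V: "(V, \<psi>) \<in> A"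
      have U: "(U, \<phi>) \<in> A" using 3 c by simp
      have "smooth_on (\<phi> ` (U \<inter> V)) (\<psi> \<circ> inv_into U \<phi>)"
        using A U V unfolding oriented_atlas_def by fast
      moreover have e: "(\<psi> \<circ> inv_into U \<phi>) x = (\<psi> \<circ> f \<circ> inv_into U \<phi>) x" if "x \<in> \<phi> ` (U \<inter> V)" for x
        using f[OF i[OF U, of x]] that by auto
      ultimately show "smooth_on (\<phi> ` (U \<inter> f -` V)) (\<psi> \<circ> f \<circ> inv_into U \<phi>)"
        unfolding s[OF U] smooth_on_def
        using Ck_on_cong[OF chart_overlap_open[OF A U V], of "\<psi> \<circ> inv_into U \<phi>" "\<psi> \<circ> f \<circ> inv_into U \<phi>"] e by blast
    qed
  qed
  show "orientation_preserving X A f"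
    unfolding orientation_preserving_def
  proof (clarify)
    fix U \<phi> V \<psi> assume U: "(U, \<phi>) \<in> A" and V: "(V, \<psi>) \<in> A"
    have 1: "smooth_on (\<phi> ` (U \<inter> V)) (\<psi> \<circ> inv_into U \<phi>)" 
      and 2: "positive_jacobian_on (\<phi> ` (U \<inter> V)) (\<psi> \<circ> inv_into U \<phi>)"
        using A U V unfolding oriented_atlas_def by fast+
    have "frechet_derivative (\<psi> \<circ> f \<circ> inv_into U \<phi>) (at x) = frechet_derivative (\<psi> \<circ> inv_into U \<phi>) (at x)"
      if x: "x \<in> \<phi> ` (U \<inter> V)" for x
    proof -
      have "(\<psi> \<circ> inv_into U \<phi>) differentiable (at x)"
        using 1[unfolded smooth_on_def, rule_format, of "Suc 0"] x by auto
      then have "((\<psi> \<circ> inv_into U \<phi>) has_derivative frechet_derivative (\<psi> \<circ> inv_into U \<phi>) (at x)) (at x)"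
        by (simp add: frechet_derivative_works)
      then have "((\<psi> \<circ> f \<circ> inv_into U \<phi>) has_derivative frechet_derivative (\<psi> \<circ> inv_into U \<phi>) (at x)) (at x)"
        by (rule has_derivative_transform_within_open[OF _ chart_overlap_open[OF A U V] x])
          (use f i[OF U] in auto)
      then show ?thesis by (metis frechet_derivative_at)
    qed
    then show "positive_jacobian_on (\<phi> ` (U \<inter> f -` V)) (\<psi> \<circ> f \<circ> inv_into U \<phi>)"
      using 2 unfolding s[OF U] positive_jacobian_on_def by simp
  qed
  show "smooth_on (UNIV \<times> \<phi> ` (U \<inter> V)) (\<lambda>(t::real, y). \<psi> (f (inv_into U \<phi> y)))"
    if U: "(U, \<phi>) \<in> A" and V: "(V, \<psi>) \<in> A"
  proof -
      have 1: "smooth_on (\<phi> ` (U \<inter> V)) (\<psi> \<circ> inv_into U \<phi>)"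
        using A U V unfolding oriented_atlas_def by fast
      show ?thesis
        unfolding smooth_on_def
        apply (rule allI)
        apply (rule Ck_on_cong[OF _ _ Ck_on_snd[OF chart_overlap_open[OF A U V] 1[unfolded smooth_on_def, rule_format]]])
        using f i[OF U] chart_overlap_open[OF A U V] by (auto intro: open_Times)
  qed
qed

lemma isotopic_id:
  assumes A: "oriented_atlas X A" and p: "p \<in> X"
  shows "isotopic X A p (\<lambda>x\<in>X. x) (\<lambda>x\<in>X. x)"
proof -
  let ?i = "\<lambda>x\<in>X. x"
  have "bij_betw ?i X X" using id_Bij[of X] by (simp add: Bij_def)
  then have d: "?i \<in> diffeos X A p"
    unfolding diffeos_def diffeomorphism_def
    using smooth_map_eq_id[OF A, of ?i] smooth_map_eq_id[OF A, of "inv_into X ?i"] p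
    by (auto simp: id_Bij inv_into_restrict_id)
  have s: "{(t::real, y). y \<in> \<phi> ` (U \<inter> ?i -` V)} = UNIV \<times> \<phi> ` (U \<inter> V)" if "(U, \<phi>) \<in> A" for U V and \<phi> :: "'a \<Rightarrow> real^2"
  proof -
    have "U \<subseteq> X" using A that by (force simp: oriented_atlas_def)
    then have "U \<inter> ?i -` V = U \<inter> V" by auto
    then show ?thesis by auto
  qed
  show ?thesis
    unfolding isotopic_def
  proof (intro exI[of _ "\<lambda>_. ?i"] conjI allI refl d, goal_cases)
    case 1
    have "continuous_on (UNIV \<times> X) (snd :: real \<times> _ \<Rightarrow> _)" by (intro continuous_intros)
    then show ?case by (rule continuous_on_eq) auto
  next
    case 2
    show ?case
      by (clarify, subst s, assumption, rule smooth_map_eq_id(3)[OF A]) auto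
  qed
qed

lemma isotopic_fundamental_group_map:
  assumes "isotopic X A p (\<lambda>x\<in>X. x) h" "f \<in> diffeos X A p"
  shows "fundamental_group_map X p (compose X h f) = fundamental_group_map X p f"
proof -
  obtain H :: "real \<Rightarrow> 'a \<Rightarrow> 'a" where H: "H 0 = (\<lambda>x\<in>X. x)" "H 1 = h" "\<And>t. H t \<in> diffeos X A p"
    "continuous_on (UNIV \<times> X) (\<lambda>(t, x). H t x)"
    using assms(1) unfolding isotopic_def by blast
  have HX: "H t x \<in> X" if "x \<in> X" for t x
    using H(3)[of t] that by (auto simp: diffeos_def Bij_def bij_betw_def)
  have f: "continuous_on X f" "\<And>x. x \<in> X \<Longrightarrow> f x \<in> X" "f p = p"
    using assms(2) by (auto simp: diffeos_def diffeomorphism_def smooth_map_def)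
  have "path_class X (compose X h f \<circ> \<gamma>) = path_class X (f \<circ> \<gamma>)" if "\<gamma> \<in> loops_at X p" for \<gamma>
  proof -
    have g: "path \<gamma>" "\<And>t. t \<in> {0..1} \<Longrightarrow> \<gamma> t \<in> X" "\<gamma> 0 = p" "\<gamma> 1 = p"
      using that by (auto simp: loops_at_def path_image_def pathstart_def pathfinish_def)
    have pX: "p \<in> X" using g(2)[of 0] g(3) by simp
    have cg: "continuous_on {0..1} (f \<circ> \<gamma>)"
      by (rule continuous_on_compose[OF g(1)[unfolded path_def]])
        (use f(1) g(2) in \<open>auto intro: continuous_on_subset\<close>)
    have Hp: "H t p = p" for t using H(3)[of t] by (simp add: diffeos_def)
    have "homotopic_paths X (f \<circ> \<gamma>) (compose X h f \<circ> \<gamma>)"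
      unfolding homotopic_paths
    proof (intro exI[of _ "\<lambda>z. H (fst z) ((f \<circ> \<gamma>) (snd z))"] conjI ballI, goal_cases)
      case 1
      have c: "continuous_on ({0..1} \<times> {0..1}) (\<lambda>z::real\<times>real. (fst z, (f \<circ> \<gamma>) (snd z)))"
        by (intro continuous_intros continuous_on_compose2[OF cg]) auto
      have "(\<lambda>z::real\<times>real. (fst z, (f \<circ> \<gamma>) (snd z))) ` ({0..1} \<times> {0..1}) \<subseteq> UNIV \<times> X"
        using f g by auto
      from continuous_on_compose2[OF H(4) c this] show ?case by (simp add: case_prod_beta)
    next
      case 2 show ?case using HX f g by auto
    next
      case (3 x) then show ?case using H f g by auto
    next
      case (4 x) then show ?case using H f g by (auto simp: compose_def)
    next
      case (5 t) show ?case using f g Hp by (auto simp: pathstart_def)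
    next
      case (6 t) show ?case using f g Hp by (auto simp: pathfinish_def)
    qed
    then show ?thesis
      unfolding path_class_def using homotopic_paths_trans homotopic_paths_sym by blast
  qed
  moreover have "\<gamma> \<in> loops_at X p" if "a \<in> carrier (fundamental_group X p)" "\<gamma> \<in> a" for a \<gamma>
    using that
    by (auto simp: fundamental_group_def path_class_def loops_at_def
        dest: homotopic_paths_imp_path homotopic_paths_imp_subset homotopic_paths_imp_pathstart homotopic_paths_imp_pathfinish)
  ultimately show ?thesis
    unfolding fundamental_group_map_def by (intro restrict_ext) auto
qed

lemma homological_representation_class:
  assumes A: "oriented_atlas X A" and p: "p \<in> X" and f: "f \<in> diffeos X A p"
  defines "N \<equiv> {f \<in> diffeos X A p. isotopic X A p (\<lambda>x\<in>X. x) f}"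
  shows "homological_representation X A p K (N #>\<^bsub>diffeo_group X A p\<^esub> f) = homological_action X p K f"
proof -
  let ?c = "N #>\<^bsub>diffeo_group X A p\<^esub> f"
  have "?c \<in> carrier (mapping_class_group X A p)"
    using f by (auto simp: mapping_class_group_def N_def FactGroup_def RCOSETS_def diffeo_group_def)
  moreover have "homological_action X p K ` ?c = {homological_action X p K f}"
  proof -
    have "?c = (\<lambda>h. compose X h f) ` N"
      using f by (auto simp: r_coset_def diffeo_group_def BijGroup_def N_def diffeos_def)
    moreover have "N \<noteq> {}"
      using isotopic_id[OF A p] by (auto simp: N_def isotopic_def)
    moreover have "homological_action X p K (compose X h f) = homological_action X p K f" if "h \<in> N" for h
      using isotopic_fundamental_group_map[OF _ f] that
      by (simp add: N_def homological_action_def)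
    ultimately show ?thesis by (simp add: image_image image_constant_conv)
  qed
  ultimately show ?thesis
    by (simp add: homological_representation_def)
qed

lemma path_class_eq: "homotopic_paths X a b \<Longrightarrow> path_class X a = path_class X b"
  unfolding path_class_def using homotopic_paths_trans homotopic_paths_sym by blast

lemma mult_class:
  assumes "a \<in> loops_at X p" "b \<in> loops_at X p"
  shows "path_class X a \<otimes>\<^bsub>fundamental_group X p\<^esub> path_class X b = path_class X (a +++ b)"
proof -
  have "path_class X (c +++ d) = path_class X (a +++ b)" if "c \<in> path_class X a" "d \<in> path_class X b" for c d
    using that assms
    by (intro path_class_eq[symmetric] homotopic_paths_join)
       (auto simp: path_class_def loops_at_def)
  moreover have "a \<in> path_class X a" "b \<in> path_class X b"
    using assms by (auto simp: path_class_def loops_at_def)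
  ultimately have "(\<Union>c\<in>path_class X a. \<Union>d\<in>path_class X b. path_class X (c +++ d)) = path_class X (a +++ b)"
    by blast
  then show ?thesis by (simp add: fundamental_group_def)
qed

lemma group_fundamental_group:
  assumes "p \<in> X" shows "group (fundamental_group X p)"
proof -
  have l1: "(\<lambda>_. p) \<in> loops_at X p"
    using assms by (auto simp: loops_at_def path_def path_image_def pathstart_def pathfinish_def)
  have lj: "a +++ b \<in> loops_at X p" if "a \<in> loops_at X p" "b \<in> loops_at X p" for a b
    using that by (auto simp: loops_at_def path_image_join)
  have lr: "reversepath a \<in> loops_at X p" if "a \<in> loops_at X p" for a
    using that by (auto simp: loops_at_def)
  have c: "carrier (fundamental_group X p) = path_class X ` loops_at X p" 
     "\<one>\<^bsub>fundamental_group X p\<^esub> = path_class X (\<lambda>_. p)" by (auto simp: fundamental_group_def)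
  show ?thesis
  proof (rule groupI, goal_cases)
    case (1 x y) then show ?case by (auto simp: c mult_class lj)
  next
    case 2 then show ?case by (auto simp: c l1)
  next
    case (3 x y z)
    then obtain a b d where e: "x = path_class X a" "a \<in> loops_at X p"
        "y = path_class X b" "b \<in> loops_at X p" "z = path_class X d" "d \<in> loops_at X p"
      by (auto simp: c)
    have "homotopic_paths X (a +++ (b +++ d)) ((a +++ b) +++ d)"
      using e by (intro homotopic_paths_assoc) (auto simp: loops_at_def)
    from path_class_eq[OF this] show ?case
      by (simp add: e mult_class lj)
  next
    case (4 x)
    then obtain a where a: "x = path_class X a" "a \<in> loops_at X p" by (auto simp: c)
    have "homotopic_paths X a ((\<lambda>_. p) +++ a)"
      by (rule homotopic_paths_reparametrize[where f = "\<lambda>t. max 0 (2 * t - 1)"])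
        (use a in \<open>auto simp: loops_at_def joinpaths_def pathstart_def intro!: continuous_intros\<close>)
    from path_class_eq[OF this] show ?case using mult_class[OF l1 a(2)] by (simp add: a(1) c(2))
  next
    case (5 x)
    then obtain a where a: "x = path_class X a" "a \<in> loops_at X p" by (auto simp: c)
    have ca: "continuous_on {0..1} a" "\<And>t. t \<in> {0..1} \<Longrightarrow> a t \<in> X" "a 0 = p" "a 1 = p"
      using a by (auto simp: loops_at_def path_def path_image_def pathstart_def pathfinish_def)
    have r: "0 \<le> s * (1 - \<bar>1 - 2 * t\<bar>) \<and> s * (1 - \<bar>1 - 2 * t\<bar>) \<le> 1" 
      if "0 \<le> s" "s \<le> 1" "0 \<le> t" "t \<le> 1" for s t :: real
      using that by (auto intro!: mult_nonneg_nonneg mult_le_one)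
    have "homotopic_paths X (\<lambda>_. p) (reversepath a +++ a)"
      unfolding homotopic_paths
    proof (intro exI[of _ "\<lambda>z. a (1 - fst z * (1 - \<bar>1 - 2 * snd z\<bar>))"] conjI ballI, goal_cases)
      case 1
      show ?case by (rule continuous_on_compose2[OF ca(1)]) (use r in \<open>auto intro!: continuous_intros\<close>)
    next
      case 2 show ?case using r by (auto intro!: ca(2))
    qed (use ca in \<open>auto simp: joinpaths_def reversepath_def pathstart_def pathfinish_def abs_if\<close>)
    from homotopic_paths_sym[OF this] have "homotopic_paths X (reversepath a +++ a) (\<lambda>_. p)" .
    from path_class_eq[OF this]
    have "path_class X (reversepath a) \<otimes>\<^bsub>fundamental_group X p\<^esub> x = \<one>\<^bsub>fundamental_group X p\<^esub>"
      by (simp add: a c mult_class lr)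
    then show ?case using lr[OF a(2)] by (auto simp: c)
  qed
qed

end

theory Submission
  imports Defs
begin

text \<open>Let \<open>K\<close> have finite index in \<open>\<pi> = \<pi>\<^sub>1(X, p)\<close>.  If \<open>k \<in> K\<close> is not central in \<open>\<pi>\<close>, then pushing \<open>p\<close> along
  a loop representing \<open>k\<close> is a diffeomorphism that acts on \<open>\<pi>\<close> as conjugation by \<open>k\<close>.  It is not isotopic
  to the identity, but it acts trivially on \<open>H\<^sub>1(K)\<close> because \<open>k \<in> K\<close>.  The push is composed of
  compactly supported perturbations of the identity in charts.

  To find \<open>k\<close>, take closed one-forms \<open>\<alpha>, \<beta>\<^sub>1, \<beta>\<^sub>2\<close> dual to three independent homology classes.
  Two-forms modulo exact forms are at most one-dimensional, so \<open>\<alpha> \<and> \<beta>\<close> is exact for some nonzero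
  combination \<open>\<beta>\<close> of \<open>\<beta>\<^sub>1, \<beta>\<^sub>2\<close>.  A primitive of \<open>\<alpha> \<and> \<beta>\<close> completes the periods of \<open>\<alpha>\<close> and \<open>\<beta>\<close> to a
  homomorphism from \<open>\<pi>\<close> to the real Heisenberg group, in which no positive power of a loop with periods
  \<open>(1, 0)\<close> commutes with a loop on which \<open>\<beta>\<close> does not vanish.  A power of the former lies in \<open>K\<close>.

  Closed forms are represented by the integration functionals on paths that they induce, which come
  from the first singular homology, and by local potentials over a finite cover by chart squares.\<close>

section \<open>Calculus of smooth maps\<close>

text \<open>Conjugation by an element of \<open>K\<close> is inner in \<open>K\<close>, so it is
  invisible on the abelianization; what is wanted is an element of \<open>K\<close> that is not
  central in the whole group. A loop none of whose positive powers is central provides one for every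
  finite-index \<open>K\<close> at once. The Heisenberg group is the target because a homomorphism
  to it amounts to two real classes with vanishing cup product and a primitive of the product, while
  its commutators are nonzero and grow linearly with powers. The second class is sought in a plane,
  since a linear map from a plane to a space of dimension at most one has a kernel; together with
  \<alpha> this asks for three independent classes, and 2g \<ge> 4 supplies them. On the torus there
  are only two, and the group is abelian. The obstacle is the gap between the data and the tools:
  the genus is read off singular homology, whereas products are controlled with smooth forms.
  Functionals on paths bridge it. The bound on two-forms comes from a Poincare lemma with compact
  support in one square, carried from square to square.\<close>

lemma Ck_on_subset: "Ck_on k V f \<Longrightarrow> U \<subseteq> V \<Longrightarrow> Ck_on k U f"
  by (induction k arbitrary: f) (auto intro: continuous_on_subset)

lemma Ck_on_SucD: "Ck_on (Suc k) U f \<Longrightarrow> Ck_on k U f"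
proof (induction k arbitrary: f)
  case 0
  then show ?case
    by (auto intro!: continuous_at_imp_continuous_on differentiable_imp_continuous_within)
next
  case (Suc k)
  then show ?case by simp
qed

lemma Ck_on_has_derivative:
  "Ck_on (Suc k) U f \<Longrightarrow> x \<in> U \<Longrightarrow> (f has_derivative frechet_derivative f (at x)) (at x)"
  by (simp flip: frechet_derivative_works)

text \<open>Inductions on smoothness supply an explicit derivative \<open>D\<close>; since
  derivatives are unique, \<open>frechet_derivative\<close> agrees with it on the open set, and the
  inductive hypothesis is applied to \<open>D\<close>.\<close>

lemma Ck_on_SucI:
  assumes "open U" "\<And>x. x \<in> U \<Longrightarrow> (f has_derivative D x) (at x)" "\<And>v. Ck_on k U (\<lambda>x. D x v)"
  shows "Ck_on (Suc k) U f"
proof -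
  have "frechet_derivative f (at x) = D x" if "x \<in> U" for x
    using frechet_derivative_at[OF assms(2)[OF that]] by simp
  then have "Ck_on k U (\<lambda>x. frechet_derivative f (at x) v)" for v
    using Ck_on_cong[OF assms(1) _ assms(3)[of v]] by simp
  then show ?thesis using assms(2) by (auto simp: differentiable_def)
qed

lemma Ck_on_local:
  assumes "\<And>x. x \<in> U \<Longrightarrow> \<exists>N. open N \<and> x \<in> N \<and> Ck_on k N f"
  shows "Ck_on k U f"
  using assms
proof (induction k arbitrary: f)
  case 0
  have "isCont f x" if "x \<in> U" for x
    using 0[OF that] by (auto simp: continuous_on_eq_continuous_at)
  then show ?case by (auto intro: continuous_at_imp_continuous_on)
next
  case (Suc k)
  have "Ck_on k U (\<lambda>x. frechet_derivative f (at x) v)" for v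
    by (rule Suc.IH) (use Suc.prems in fastforce)
  moreover have "f differentiable at x" if "x \<in> U" for x
    using Suc.prems[OF that] by auto
  ultimately show ?case by simp
qed

lemma Ck_on_const: "open U \<Longrightarrow> Ck_on k U (\<lambda>x. c)"
  by (induction k arbitrary: c) (auto intro: Ck_on_SucI[of _ _ "\<lambda>_ _. 0"])

lemma Ck_on_bounded_linear: "open U \<Longrightarrow> bounded_linear f \<Longrightarrow> Ck_on k U f"
proof (cases k)
  case 0
  then show "bounded_linear f \<Longrightarrow> ?thesis" by (simp add: linear_continuous_on)
next
  case (Suc n)
  then show "open U \<Longrightarrow> bounded_linear f \<Longrightarrow> ?thesis"
    by (simp only: Suc, intro Ck_on_SucI[of _ _ "\<lambda>_. f"] bounded_linear_imp_has_derivative Ck_on_const)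
qed

lemma Ck_on_add:
  assumes "open U" shows "Ck_on k U f \<Longrightarrow> Ck_on k U g \<Longrightarrow> Ck_on k U (\<lambda>x. f x + g x)"
proof (induction k arbitrary: f g)
  case 0
  then show ?case by (auto intro: continuous_intros)
next
  case (Suc k)
  show ?case
    by (rule Ck_on_SucI[OF assms has_derivative_add[OF Ck_on_has_derivative[OF Suc.prems(1)] Ck_on_has_derivative[OF Suc.prems(2)]]])
      (use Suc in auto)
qed

text \<open>The Leibniz rule expresses the derivative by two products of the same kind and of one
  order less, so one induction serves multiplication, scaling and inner products alike.\<close>

lemma Ck_on_bilinear:
  fixes prod :: "'a::euclidean_space \<Rightarrow> 'b::euclidean_space \<Rightarrow> 'c::euclidean_space"
  assumes "bounded_bilinear prod" "open U"
  shows "Ck_on k U f \<Longrightarrow> Ck_on k U g \<Longrightarrow> Ck_on k U (\<lambda>x. prod (f x) (g x))"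
proof (induction k arbitrary: f g)
  case 0
  then show ?case using assms by (auto intro: bounded_bilinear.continuous_on)
next
  case (Suc k)
  show ?case
    by (rule Ck_on_SucI[OF assms(2) bounded_bilinear.FDERIV[OF assms(1) Ck_on_has_derivative[OF Suc.prems(1)] Ck_on_has_derivative[OF Suc.prems(2)]]])
     (use Suc.prems Suc.IH Ck_on_SucD[OF Suc.prems(1)] Ck_on_SucD[OF Suc.prems(2)] in \<open>auto intro!: Ck_on_add assms\<close>)
qed

lemma Ck_on_sum:
  assumes "open U" "\<And>i. i \<in> I \<Longrightarrow> Ck_on k U (f i)"
  shows "Ck_on k U (\<lambda>x. \<Sum>i\<in>I. f i x)"
  using assms(2)
  by (induction I rule: infinite_finite_induct) (auto intro: Ck_on_const Ck_on_add assms)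

lemma Ck_on_compose:
  fixes f :: "'a::euclidean_space \<Rightarrow> 'b::euclidean_space" and g :: "'b \<Rightarrow> 'c::euclidean_space"
  assumes "open U"
  shows "Ck_on k V g \<Longrightarrow> Ck_on k U f \<Longrightarrow> f ` U \<subseteq> V \<Longrightarrow> Ck_on k U (\<lambda>x. g (f x))"
proof (induction k arbitrary: f g)
  case 0
  then show ?case by (auto intro: continuous_on_compose2)
next
  case (Suc k)
  have D: "((\<lambda>x. g (f x)) has_derivative (\<lambda>v. frechet_derivative g (at (f x)) (frechet_derivative f (at x) v))) (at x)"
    if "x \<in> U" for x
    using diff_chain_at[OF Ck_on_has_derivative[OF Suc.prems(2) that] Ck_on_has_derivative[OF Suc.prems(1)]] Suc.prems(3) that
    by (auto simp: o_def)
  \<comment> \<open>The direction \<open>frechet_derivative f (at x) v\<close> varies with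
    \<open>x\<close>, which the inductive hypothesis does not cover. Expanding it in the basis
    leaves fixed directions \<open>i\<close> with scalar coefficients of class
    \<open>k\<close>.\<close>
  have E: "(\<Sum>i\<in>Basis. (frechet_derivative f (at x) v \<bullet> i) *\<^sub>R frechet_derivative g (at (f x)) i)
    = frechet_derivative g (at (f x)) (frechet_derivative f (at x) v)" if "x \<in> U" for x v
  proof -
    have "linear (frechet_derivative g (at (f x)))"
      using Suc.prems(1,3) that by (auto intro: linear_frechet_derivative)
    then show ?thesis
      using linear_sum[of "frechet_derivative g (at (f x))" "\<lambda>i. (frechet_derivative f (at x) v \<bullet> i) *\<^sub>R i" Basis]
      by (simp add: euclidean_representation linear_cmul)
  qed
  have "Ck_on k U (\<lambda>x. \<Sum>i\<in>Basis. (frechet_derivative f (at x) v \<bullet> i) *\<^sub>R frechet_derivative g (at (f x)) i)" for v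
  proof (intro Ck_on_sum Ck_on_bilinear[OF bounded_bilinear_scaleR] assms)
    fix i :: 'b
    show "Ck_on k U (\<lambda>x. frechet_derivative f (at x) v \<bullet> i)"
      using Suc.prems(2) by (intro Ck_on_bilinear[OF bounded_bilinear_inner] Ck_on_const assms) auto
    show "Ck_on k U (\<lambda>x. frechet_derivative g (at (f x)) i)"
      using Suc.IH[of "\<lambda>x. frechet_derivative g (at x) i" f] Suc.prems(1,3) Ck_on_SucD[OF Suc.prems(2)]
      by auto
  qed
  then have "Ck_on k U (\<lambda>x. frechet_derivative g (at (f x)) (frechet_derivative f (at x) v))" for v
    by (rule Ck_on_cong[OF assms, rotated]) (rule E)
  then show ?case
    by (intro Ck_on_SucI[OF assms D])
qed

lemma smooth_on_subset: "smooth_on V f \<Longrightarrow> U \<subseteq> V \<Longrightarrow> smooth_on U f"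
  unfolding smooth_on_def using Ck_on_subset by blast

lemma smooth_on_cong: "open U \<Longrightarrow> (\<And>x. x \<in> U \<Longrightarrow> f x = g x) \<Longrightarrow> smooth_on U f \<Longrightarrow> smooth_on U g"
  unfolding smooth_on_def using Ck_on_cong by blast

lemma smooth_on_local:
  assumes "\<And>x. x \<in> U \<Longrightarrow> \<exists>N. open N \<and> x \<in> N \<and> smooth_on N f"
  shows "smooth_on U f"
  unfolding smooth_on_def
proof
  fix k show "Ck_on k U f"
    by (rule Ck_on_local) (use assms in \<open>auto simp: smooth_on_def\<close>)
qed

lemma smooth_on_has_derivative:
  "smooth_on U f \<Longrightarrow> x \<in> U \<Longrightarrow> (f has_derivative frechet_derivative f (at x)) (at x)"
  unfolding smooth_on_def using Ck_on_has_derivative by blast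

lemma smooth_on_differentiable: "smooth_on U f \<Longrightarrow> x \<in> U \<Longrightarrow> f differentiable (at x)"
  using smooth_on_has_derivative differentiable_def by blast

lemma smooth_on_continuous_on: "smooth_on U f \<Longrightarrow> continuous_on U f"
  unfolding smooth_on_def by (metis Ck_on.simps(1))

lemma smooth_on_derivative: "smooth_on U f \<Longrightarrow> smooth_on U (\<lambda>x. frechet_derivative f (at x) v)"
  unfolding smooth_on_def by (metis Ck_on.simps(2))

lemma smooth_on_SucI:
  assumes "open U" "\<And>x. x \<in> U \<Longrightarrow> (f has_derivative D x) (at x)" "\<And>v. smooth_on U (\<lambda>x. D x v)"
  shows "smooth_on U f"
  unfolding smooth_on_def
proof
  fix k have "Ck_on (Suc k) U f"
    by (rule Ck_on_SucI[OF assms(1,2)]) (use assms(3) in \<open>auto simp: smooth_on_def\<close>)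
  then show "Ck_on k U f" by (rule Ck_on_SucD)
qed

lemma smooth_on_const: "open U \<Longrightarrow> smooth_on U (\<lambda>x. c)"
  by (simp add: smooth_on_def Ck_on_const)

lemma smooth_on_bounded_linear: "bounded_linear f \<Longrightarrow> open U \<Longrightarrow> smooth_on U f"
  by (simp add: smooth_on_def Ck_on_bounded_linear)

lemma smooth_on_id: "open U \<Longrightarrow> smooth_on U (\<lambda>x. x)"
  by (simp add: smooth_on_bounded_linear bounded_linear_ident)

lemma smooth_on_nth: "open U \<Longrightarrow> smooth_on U (\<lambda>x::real^'n. x $ i)"
  by (rule smooth_on_bounded_linear) (rule bounded_linear_vec_nth)

lemma smooth_on_add: "smooth_on U f \<Longrightarrow> smooth_on U g \<Longrightarrow> open U \<Longrightarrow> smooth_on U (\<lambda>x. f x + g x)"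
  by (simp add: smooth_on_def Ck_on_add)

lemma smooth_on_bilinear:
  fixes prod :: "'a::euclidean_space \<Rightarrow> 'b::euclidean_space \<Rightarrow> 'c::euclidean_space"
  shows "bounded_bilinear prod \<Longrightarrow> smooth_on U f \<Longrightarrow> smooth_on U g \<Longrightarrow> open U \<Longrightarrow>
    smooth_on U (\<lambda>x. prod (f x) (g x))"
  by (simp add: smooth_on_def Ck_on_bilinear)

lemmas smooth_on_mult = smooth_on_bilinear[OF bounded_bilinear_mult[where 'a=real]]
lemmas smooth_on_scaleR = smooth_on_bilinear[OF bounded_bilinear_scaleR]
lemmas smooth_on_inner = smooth_on_bilinear[OF bounded_bilinear_inner]

lemma smooth_on_sum: "(\<And>i. i \<in> I \<Longrightarrow> smooth_on U (f i)) \<Longrightarrow> open U \<Longrightarrow> smooth_on U (\<lambda>x. \<Sum>i\<in>I. f i x)"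
  by (simp add: smooth_on_def Ck_on_sum)

lemma smooth_on_prod:
  fixes f :: "'i \<Rightarrow> 'a::euclidean_space \<Rightarrow> real"
  shows "(\<And>i. i \<in> I \<Longrightarrow> smooth_on U (f i)) \<Longrightarrow> open U \<Longrightarrow> smooth_on U (\<lambda>x. \<Prod>i\<in>I. f i x)"
  by (induction I rule: infinite_finite_induct) (auto intro: smooth_on_const smooth_on_mult)

lemma smooth_on_compose:
  "smooth_on V g \<Longrightarrow> smooth_on U f \<Longrightarrow> f ` U \<subseteq> V \<Longrightarrow> open U \<Longrightarrow> smooth_on U (\<lambda>x. g (f x))"
  unfolding smooth_on_def using Ck_on_compose by blast

lemma smooth_on_minus: "smooth_on U f \<Longrightarrow> open U \<Longrightarrow> smooth_on U (\<lambda>x. - f x)"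
  by (rule smooth_on_compose[of UNIV uminus])
    (auto intro: smooth_on_bounded_linear[OF bounded_linear_minus[OF bounded_linear_ident]])

lemma smooth_on_diff: "smooth_on U f \<Longrightarrow> smooth_on U g \<Longrightarrow> open U \<Longrightarrow> smooth_on U (\<lambda>x. f x - g x)"
  using smooth_on_add[OF _ smooth_on_minus, of U f g] by simp

text \<open>The derivative of inversion is minus the square of inversion itself, so class
  \<open>k\<close> gives class \<open>k + 1\<close>.\<close>

lemma smooth_on_inverse:
  fixes f :: "'a::euclidean_space \<Rightarrow> real"
  assumes "smooth_on U f" "open U" "\<And>x. x \<in> U \<Longrightarrow> f x \<noteq> 0"
  shows "smooth_on U (\<lambda>x. inverse (f x))"
proof -
  have "Ck_on k (- {0}) (inverse :: real \<Rightarrow> real)" for k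
  proof (induction k)
    case 0
    then show ?case by (auto intro!: continuous_intros)
  next
    case (Suc k)
    show ?case
    proof (rule Ck_on_SucI[where D = "\<lambda>x v. (inverse x * inverse x) * (- v)"])
      fix x :: real assume "x \<in> - {0}"
      then show "(inverse has_derivative (\<lambda>v. (inverse x * inverse x) * (- v))) (at x)"
        using has_derivative_inverse'[of x UNIV] by (simp add: mult_ac)
    next
      show "Ck_on k (- {0}) (\<lambda>x::real. (inverse x * inverse x) * (- v))" for v :: real
      proof -
        have o: "open (- {0::real})" by auto
        have "Ck_on k (- {0::real}) (\<lambda>x. inverse x * inverse x)"
          by (rule Ck_on_bilinear[OF bounded_bilinear_mult o Suc Suc])
        from Ck_on_bilinear[OF bounded_bilinear_mult o this Ck_on_const[OF o]] show ?thesis .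
      qed
    qed auto
  qed
  then show ?thesis
    by (intro smooth_on_compose[of "- {0}" inverse, OF _ assms(1)]) (use assms in \<open>auto simp: smooth_on_def\<close>)
qed

lemma smooth_on_divide:
  fixes f :: "'a::euclidean_space \<Rightarrow> real"
  assumes "smooth_on U f" "smooth_on U g" "open U" "\<And>x. x \<in> U \<Longrightarrow> g x \<noteq> 0"
  shows "smooth_on U (\<lambda>x. f x / g x)"
  unfolding divide_inverse by (intro smooth_on_mult smooth_on_inverse assms)

section \<open>Bump functions\<close>

text \<open>The derivative of a member of this family is a linear combination of members with larger
  exponents. This is why \<open>n\<close> is carried along, although the bump functions are built
  from \<open>n = 0\<close>.\<close>

definition flat :: "nat \<Rightarrow> real \<Rightarrow> real" where
  "flat n x = (if x > 0 then inverse x ^ n * exp (- inverse x) else 0)"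

lemma power_div_fact_le_exp:
  fixes y :: real
  assumes "y \<ge> 0" shows "y ^ m \<le> fact m * exp y"
proof -
  have "(\<Sum>n\<in>{m}. y ^ n /\<^sub>R fact n) \<le> suminf (\<lambda>n. y ^ n /\<^sub>R fact n)"
    by (rule sum_le_suminf) (use assms exp_converges[of y] in \<open>auto simp: sums_iff\<close>)
  then have "y ^ m / fact m \<le> exp y"
    using exp_converges[of y] by (simp add: sums_iff divide_inverse mult.commute)
  then show ?thesis by (simp add: field_simps)
qed

text \<open>The exponential beats the power \<open>n + 2\<close> of \<open>inverse x\<close>, two
  more than are present, so a factor \<open>x^2\<close> is left over. It makes the difference
  quotient at 0 tend to 0.\<close>

lemma flat_bound: "\<bar>flat n x\<bar> \<le> fact (n + 2) * x\<^sup>2"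
proof (cases "x > 0")
  case True
  have "inverse x ^ (n + 2) \<le> fact (n + 2) * exp (inverse x)"
    using True by (intro power_div_fact_le_exp) auto
  then have "inverse x ^ (n + 2) * exp (- inverse x) * x\<^sup>2 \<le> fact (n + 2) * exp (inverse x) * exp (- inverse x) * x\<^sup>2"
    by (intro mult_right_mono) auto
  moreover have "inverse x ^ (n + 2) * exp (- inverse x) * x\<^sup>2 = flat n x"
    using True by (simp add: flat_def field_simps power2_eq_square)
  moreover have "fact (n + 2) * exp (inverse x) * exp (- inverse x) * x\<^sup>2 = fact (n + 2) * x\<^sup>2"
    by (simp add: exp_minus)
  moreover have "flat n x \<ge> 0" using True by (simp add: flat_def)
  ultimately show ?thesis by linarith
qed (simp add: flat_def)

lemma flat_has_derivative:
  "(flat n has_derivative (\<lambda>v. (flat (n + 2) x - real n * flat (n + 1) x) * v)) (at x)"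
proof -
  consider "x > 0" | "x < 0" | "x = 0" by linarith
  then show ?thesis
  proof cases
    case 1
    have "((\<lambda>x. inverse x ^ n * exp (- inverse x)) has_field_derivative
        (flat (n + 2) x - real n * flat (n + 1) x)) (at x)"
      by (rule derivative_eq_intros | use 1 in \<open>force\<close>)+
        (use 1 in \<open>cases n; simp add: flat_def field_simps power2_eq_square\<close>)
    then have "((\<lambda>x. inverse x ^ n * exp (- inverse x)) has_derivative
        (\<lambda>v. (flat (n + 2) x - real n * flat (n + 1) x) * v)) (at x)"
      by (simp add: has_field_derivative_def)
    then show ?thesis
      by (rule has_derivative_transform_within_open[of _ _ _ _ "{0<..}"]) (use 1 in \<open>auto simp: flat_def\<close>)
  next
    case 2
    show ?thesis
      by (rule has_derivative_transform_within_open[of "\<lambda>_. 0" _ _ _ "{..<0}"])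
        (use 2 in \<open>auto simp: flat_def\<close>)
  next
    case 3
    have "(flat n has_derivative (\<lambda>v. 0)) (at 0)"
      unfolding has_derivative_at
    proof (intro conjI)
      show "(\<lambda>h. norm (flat n (0 + h) - flat n 0 - 0) / norm h) \<midarrow>0\<rightarrow> 0"
      proof (rule tendsto_sandwich[of "\<lambda>_. 0" _ _ "\<lambda>h. fact (n + 2) * \<bar>h\<bar>"])
        show "\<forall>\<^sub>F h in at 0. norm (flat n (0 + h) - flat n 0 - 0) / norm h \<le> fact (n + 2) * \<bar>h\<bar>"
        proof (rule eventually_at_filter[THEN iffD2], rule always_eventually, intro allI impI)
          fix h :: real assume h: "h \<noteq> 0"
          have "\<bar>flat n h\<bar> / \<bar>h\<bar> \<le> (fact (n + 2) * \<bar>h\<bar> * \<bar>h\<bar>) / \<bar>h\<bar>"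
            using flat_bound[of n h] by (intro divide_right_mono) (auto simp: power2_eq_square mult.assoc simp del: fact_Suc)
          then show "norm (flat n (0 + h) - flat n 0 - 0) / norm h \<le> fact (n + 2) * \<bar>h\<bar>"
            using h by (simp add: flat_def del: fact_Suc)
        qed
        show "((\<lambda>h. fact (n + 2) * \<bar>h\<bar>) \<longlongrightarrow> 0) (at (0::real))"
          using tendsto_mult[OF tendsto_const[of "fact (n + 2)"] tendsto_rabs[OF tendsto_ident_at, of 0 UNIV]] by simp
      qed auto
    qed auto
    then show ?thesis using 3 by (simp add: flat_def)
  qed
qed

lemma smooth_on_flat: "smooth_on UNIV (flat n)"
proof -
  have "Ck_on k UNIV (flat n)" for k
  proof (induction k arbitrary: n)
    case 0
    show ?case
      by (simp add: has_derivative_continuous_on[OF has_derivative_at_withinI[OF flat_has_derivative]])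
  next
    case (Suc k)
    have "Ck_on k UNIV (\<lambda>x. (flat (n + 2) x + (- real n) * flat (n + 1) x) * v)" for v
      by (intro Ck_on_bilinear[OF bounded_bilinear_mult] Ck_on_add Suc Ck_on_const) auto
    then show ?case
      by (intro Ck_on_SucI[OF _ flat_has_derivative]) simp_all
  qed
  then show ?thesis by (simp add: smooth_on_def)
qed

lemma smooth_on_flat': "smooth_on U f \<Longrightarrow> open U \<Longrightarrow> smooth_on U (\<lambda>x. flat n (f x))"
  by (rule smooth_on_compose[OF smooth_on_flat]) auto

lemma flat_pos_iff: "flat n x > 0 \<longleftrightarrow> x > 0"
  by (simp add: flat_def)

lemma flat_nonneg: "flat n x \<ge> 0"
  by (simp add: flat_def)

definition plateau :: "real \<Rightarrow> real" where
  "plateau x = flat 0 x / (flat 0 x + flat 0 (1 - x))"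

text \<open>At least one of \<open>x\<close> and \<open>1 - x\<close> is positive.\<close>

lemma plateau_denom: "flat 0 x + flat 0 (1 - x) > 0"
  using flat_pos_iff[of 0 x] flat_pos_iff[of 0 "1 - x"] flat_nonneg[of 0 x] flat_nonneg[of 0 "1 - x"] by argo

lemma plateau_simps: "x \<le> 0 \<Longrightarrow> plateau x = 0" "x \<ge> 1 \<Longrightarrow> plateau x = 1"
  by (auto simp: plateau_def flat_def)

lemma smooth_on_plateau: "smooth_on U f \<Longrightarrow> open U \<Longrightarrow> smooth_on U (\<lambda>x. plateau (f x))"
  unfolding plateau_def
  by (intro smooth_on_divide smooth_on_add smooth_on_flat' smooth_on_diff smooth_on_const)
    (use plateau_denom in \<open>auto simp: less_imp_neq[symmetric]\<close>)

section \<open>Parameter integrals and mixed derivatives\<close>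

lemma has_derivative_Blinfun:
  assumes "(f has_derivative D) F" shows "(f has_derivative blinfun_apply (Blinfun D)) F"
  using assms bounded_linear_Blinfun_apply[OF has_derivative_bounded_linear[OF assms]] by simp

text \<open>Differentiation under the integral sign. The integrand lives on an open \<open>W\<close>
  around the slab, where its full derivative makes sense; the direction \<open>(v, 0)\<close> leaves
  the integration variable fixed.\<close>

lemma parameter_integral_has_derivative:
  fixes f :: "'a::euclidean_space \<times> real \<Rightarrow> 'b::euclidean_space"
  assumes "convex U" "open U" "x0 \<in> U" "open W" "U \<times> {a..b} \<subseteq> W" "Ck_on (Suc 0) W f"
  shows "((\<lambda>x. integral {a..b} (\<lambda>t. f (x, t))) has_derivative
     (\<lambda>v. integral {a..b} (\<lambda>t. frechet_derivative f (at (x0, t)) (v, 0)))) (at x0)"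
proof -
  \<comment> \<open>The Leibniz rule asks for a derivative that is continuous as an operator; in
    finite dimension continuity in each basis direction is enough.\<close>
  define D where "D x t = Blinfun (\<lambda>v. frechet_derivative f (at (x, t)) (v, 0))" for x t
  have d: "((\<lambda>x. f (x, t)) has_derivative (\<lambda>v. frechet_derivative f (at (x, t)) (v, 0))) (at x)"
    if "x \<in> U" "t \<in> {a..b}" for x t
  proof -
    have "(f has_derivative frechet_derivative f (at (x, t))) (at (x, t))"
      using Ck_on_has_derivative assms that by blast
    moreover have "((\<lambda>x. (x, t)) has_derivative (\<lambda>v. (v, 0))) (at x)"
      by (intro derivative_eq_intros) auto
    ultimately show ?thesis using diff_chain_at[of "\<lambda>x. (x, t)"] by (simp add: o_def)
  qed
  have D: "D x t v = frechet_derivative f (at (x, t)) (v, 0)" if "x \<in> U" "t \<in> {a..b}" for x t v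
    unfolding D_def using bounded_linear_Blinfun_apply[OF has_derivative_bounded_linear[OF d[OF that]]] by simp
  have c: "continuous_on (U \<times> {a..b}) (\<lambda>z. frechet_derivative f (at z) w)" for w
    using assms(6) by (intro continuous_on_subset[OF _ assms(5)]) (cases w, simp)
  have cD: "continuous_on (U \<times> {a..b}) (\<lambda>(x, t). D x t)"
  proof (rule continuous_on_blinfun_componentwise)
    fix i :: 'a
    show "continuous_on (U \<times> {a..b}) (\<lambda>x. blinfun_apply (case x of (x, t) \<Rightarrow> D x t) i)"
      using c[of "(i, 0)"] by (rule continuous_on_eq) (auto simp: D)
  qed
  have cf: "continuous_on (U \<times> {a..b}) f"
    using Ck_on_SucD[OF assms(6)] assms(5) by (auto intro: continuous_on_subset)
  have ig: "(\<lambda>t. f (x, t)) integrable_on {a..b}" if "x \<in> U" for x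
    by (intro integrable_continuous_real continuous_on_compose2[OF cf]) (use that in \<open>auto intro!: continuous_intros\<close>)
  have "((\<lambda>x. integral (cbox a b) (\<lambda>t. f (x, t))) has_derivative blinfun_apply (integral (cbox a b) (D x0))) (at x0 within U)"
  proof (rule leibniz_rule[of U a b])
    show "((\<lambda>x. f (x, t)) has_derivative blinfun_apply (D x t)) (at x within U)" if "x \<in> U" "t \<in> cbox a b" for x t
      unfolding D_def using has_derivative_Blinfun[OF d[of x t]] that by (auto intro: has_derivative_at_withinI)
  qed (use assms ig cD in auto)
  moreover
  have "blinfun_apply (integral {a..b} (D x0)) v = integral {a..b} (\<lambda>t. frechet_derivative f (at (x0, t)) (v, 0))" for v
  proof -
    have "D x0 integrable_on {a..b}"
    proof (rule integrable_continuous_real)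
      have "continuous_on {a..b} (\<lambda>t. case (x0, t) of (x, t) \<Rightarrow> D x t)"
        by (rule continuous_on_compose2[OF cD]) (use assms(3) in \<open>auto intro!: continuous_intros\<close>)
      then show "continuous_on {a..b} (D x0)" by simp
    qed
    then have "blinfun_apply (integral {a..b} (D x0)) v = integral {a..b} (\<lambda>t. D x0 t v)"
      by (rule blinfun_apply_integral)
    also have "\<dots> = integral {a..b} (\<lambda>t. frechet_derivative f (at (x0, t)) (v, 0))"
      by (rule integral_cong) (simp add: D assms)
    finally show ?thesis .
  qed
  then have "blinfun_apply (integral {a..b} (D x0)) = (\<lambda>v. integral {a..b} (\<lambda>t. frechet_derivative f (at (x0, t)) (v, 0)))"
    by (rule ext)
  ultimately show ?thesis
    unfolding at_within_open[OF assms(3,2)] cbox_interval by (simp only:)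
qed

lemma smooth_on_parameter_integral:
  fixes f :: "'a::euclidean_space \<times> real \<Rightarrow> 'b::euclidean_space"
  assumes "smooth_on UNIV f"
  shows "smooth_on UNIV (\<lambda>x. integral {a..b} (\<lambda>t. f (x, t)))"
proof -
  have "Ck_on k UNIV (\<lambda>x. integral {a..b} (\<lambda>t. f (x, t)))" if "Ck_on k UNIV f" for k
    using that
  proof (induction k arbitrary: f)
    case 0
    have "continuous_on UNIV (\<lambda>x. integral (cbox a b) (\<lambda>t. f (x, t)))"
      by (rule integral_continuous_on_param) (use 0 in \<open>auto intro: continuous_on_subset\<close>)
    then show ?case by simp
  next
    case (Suc k)
    have 1: "Ck_on (Suc 0) UNIV f"
    proof -
      have "Ck_on n UNIV g \<Longrightarrow> Ck_on 0 UNIV g" for n and g :: "'a \<times> real \<Rightarrow> 'b"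
        by (induction n) (blast dest: Ck_on_SucD)+
      then show ?thesis using Suc.prems by (metis Ck_on.simps(2))
    qed
    show ?case
    proof (rule Ck_on_SucI[OF _ parameter_integral_has_derivative[of UNIV _ UNIV]])
      show "Ck_on k UNIV (\<lambda>x. integral {a..b} (\<lambda>t. frechet_derivative f (at (x, t)) (v, 0)))" for v
        using Suc.IH[of "\<lambda>z. frechet_derivative f (at z) (v, 0)"] Suc.prems by simp
    qed (use 1 in auto)
  qed
  then show ?thesis using assms by (simp add: smooth_on_def)
qed

text \<open>Integrating \<open>D\<^sub>w f\<close> along the direction \<open>w\<close> and differentiating under the integral along \<open>v\<close>
  reduces the symmetry of second derivatives to the fundamental theorem of calculus.\<close>

lemma smooth_on_mixed_derivatives:
  fixes f :: "'a::euclidean_space \<Rightarrow> real"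
  assumes f: "smooth_on U f" and U: "open U" "x \<in> U"
  shows "frechet_derivative (\<lambda>y. frechet_derivative f (at y) v) (at x) w =
    frechet_derivative (\<lambda>y. frechet_derivative f (at y) w) (at x) v"
proof -
  let ?D = "\<lambda>u y. frechet_derivative f (at y) u"
  let ?D2 = "\<lambda>u w y. frechet_derivative (?D u) (at y) w"
  obtain e where e: "e > 0" "ball x e \<subseteq> U" using U by (meson openE)
  \<comment> \<open>For |s| and |t| at most \<open>c\<close> the point x + s v + t w stays within
    e/2 of x; the summand 1 covers the case v = w = 0.\<close>
  define c where "c = e / (2 * (1 + norm v + norm w))"
  have c: "c > 0" unfolding c_def using e(1) by (simp add: add_pos_nonneg)
  have inU: "x + s *\<^sub>R v + t *\<^sub>R w \<in> U" if "\<bar>s\<bar> \<le> c" "\<bar>t\<bar> \<le> c" for s t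
  proof -
    have "norm (s *\<^sub>R v + t *\<^sub>R w) \<le> c * norm v + c * norm w"
      using that by (intro order_trans[OF norm_triangle_ineq] add_mono) (auto intro: mult_right_mono)
    also have "\<dots> < c * (1 + norm v + norm w)" using c by (simp add: algebra_simps)
    also have "\<dots> = e / 2" using e(1) by (simp add: c_def add_pos_nonneg field_simps add_nonneg_eq_0_iff)
    finally have "norm (s *\<^sub>R v + t *\<^sub>R w) < e" using e(1) by simp
    then show ?thesis
      using norm_minus_cancel[of "s *\<^sub>R v + t *\<^sub>R w"] by (intro subsetD[OF e(2)]) (simp add: dist_norm)
  qed
  have Dw: "smooth_on U (?D u)" for u using smooth_on_derivative[OF f] .
  have line: "((\<lambda>t. g (y + t *\<^sub>R u)) has_vector_derivative frechet_derivative g (at (y + t *\<^sub>R u)) u) (at t)"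
    if "smooth_on U g" "y + t *\<^sub>R u \<in> U" for g :: "'a \<Rightarrow> real" and y u t
  proof -
    have "((\<lambda>t. y + t *\<^sub>R u) has_derivative (\<lambda>h. h *\<^sub>R u)) (at t)"
      by (auto intro!: derivative_eq_intros)
    from diff_chain_at[OF this smooth_on_has_derivative[OF that]]
    show ?thesis
      using linear_cmul[OF linear_frechet_derivative[OF smooth_on_differentiable[OF that]]]
      by (simp add: has_vector_derivative_def o_def)
  qed
  have ftc: "((\<lambda>t. ?D w (y + t *\<^sub>R w)) has_integral (f (y + b *\<^sub>R w) - f y)) {0..b}"
    if "0 \<le> b" "\<And>t. 0 \<le> t \<Longrightarrow> t \<le> b \<Longrightarrow> y + t *\<^sub>R w \<in> U" for y b
    using fundamental_theorem_of_calculus[OF that(1), of "\<lambda>t. f (y + t *\<^sub>R w)" "\<lambda>t. ?D w (y + t *\<^sub>R w)"]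
      has_vector_derivative_at_within[OF line[OF f that(2)]] by simp
  \<comment> \<open>The increment of \<open>f\<close> along b w is an integral of
    \<open>?D w\<close>. Both are displaced by s v and differentiated in s at 0: the integral under
    its sign (\<open>der1\<close>), the increment directly (\<open>der2\<close>).\<close>
  have eq: "integral {0..b} (\<lambda>t. ?D2 w v (x + t *\<^sub>R w)) = ?D v (x + b *\<^sub>R w) - ?D v x" if b: "0 \<le> b" "b \<le> c" for b
  proof -
    define g where "g z = ?D w (x + fst z *\<^sub>R v + snd z *\<^sub>R w)" for z :: "real \<times> real"
    define W where "W = (\<lambda>z::real \<times> real. x + fst z *\<^sub>R v + snd z *\<^sub>R w) -` U"
    have W: "open W" unfolding W_def by (intro open_vimage U continuous_intros)
    have sm: "smooth_on W (\<lambda>z::real \<times> real. x + fst z *\<^sub>R v + snd z *\<^sub>R w)"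
      by (intro smooth_on_add smooth_on_scaleR smooth_on_const smooth_on_bounded_linear[OF bounded_linear_fst]
        smooth_on_bounded_linear[OF bounded_linear_snd] W)
    have gW: "smooth_on W g" unfolding g_def
      by (rule smooth_on_compose[OF Dw sm _ W]) (auto simp: W_def)
    have gd: "frechet_derivative g (at (0, t)) (1, 0) = ?D2 w v (x + t *\<^sub>R w)" if "\<bar>t\<bar> \<le> c" for t
    proof -
      have p: "(0, t) \<in> W" using inU[of 0 t] that c by (simp add: W_def)
      have "((\<lambda>s. g (s, t)) has_vector_derivative frechet_derivative g (at (0, t)) (1, 0)) (at 0)"
      proof -
        have "((\<lambda>s. (s, t)) has_derivative (\<lambda>h. (h, 0))) (at 0)" by (intro derivative_eq_intros) auto
        from diff_chain_at[OF this smooth_on_has_derivative[OF gW p]]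
        have "((\<lambda>s. g (s, t)) has_derivative (\<lambda>h. frechet_derivative g (at (0, t)) (h, 0))) (at 0)" by (simp add: o_def)
        moreover have "(\<lambda>h. frechet_derivative g (at (0, t)) (h, 0)) = (\<lambda>h. h *\<^sub>R frechet_derivative g (at (0, t)) (1, 0))"
        proof
          fix h :: real
          show "frechet_derivative g (at (0, t)) (h, 0) = h *\<^sub>R frechet_derivative g (at (0, t)) (1, 0)"
            using linear_cmul[OF linear_frechet_derivative[OF smooth_on_differentiable[OF gW p]], of h "(1, 0)"]
            unfolding scaleR_Pair by (metis mult_1_right mult_zero_right real_scaleR_def)
        qed
        ultimately show ?thesis unfolding has_vector_derivative_def by (simp only:)
      qed
      moreover have "((\<lambda>s. g (s, t)) has_vector_derivative ?D2 w v (x + t *\<^sub>R w)) (at 0)"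
        using line[OF Dw, of "x + t *\<^sub>R w" 0 v w] inU[of 0 t] that c by (simp add: g_def add_ac)
      ultimately show ?thesis by (rule vector_derivative_unique_at)
    qed
    have der1: "((\<lambda>s. integral {0..b} (\<lambda>t. g (s, t))) has_derivative
       (\<lambda>h. integral {0..b} (\<lambda>t. frechet_derivative g (at (0, t)) (h, 0)))) (at 0)"
      by (rule parameter_integral_has_derivative[of "ball 0 c" _ W])
        (use W gW c b inU in \<open>auto simp: smooth_on_def W_def simp del: Ck_on.simps\<close>)
    have "((\<lambda>s. f (x + b *\<^sub>R w + s *\<^sub>R v) - f (x + s *\<^sub>R v)) has_vector_derivative (?D v (x + b *\<^sub>R w) - ?D v x)) (at 0)"
      using has_vector_derivative_diff[OF line[OF f, of "x + b *\<^sub>R w" 0 v] line[OF f, of x 0 v]] inU[of 0 b] inU[of 0 0] b c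
      by simp
    then have "((\<lambda>s. f (x + b *\<^sub>R w + s *\<^sub>R v) - f (x + s *\<^sub>R v)) has_derivative (\<lambda>h. h *\<^sub>R (?D v (x + b *\<^sub>R w) - ?D v x))) (at 0)"
      by (simp add: has_vector_derivative_def)
    then have der2: "((\<lambda>s. integral {0..b} (\<lambda>t. g (s, t))) has_derivative (\<lambda>h. h *\<^sub>R (?D v (x + b *\<^sub>R w) - ?D v x))) (at 0)"
    proof (rule has_derivative_transform_within_open[of _ _ _ _ "ball 0 c"])
      fix s :: real assume "s \<in> ball 0 c"
      then have "((\<lambda>t. ?D w (x + s *\<^sub>R v + t *\<^sub>R w)) has_integral (f (x + s *\<^sub>R v + b *\<^sub>R w) - f (x + s *\<^sub>R v))) {0..b}"
        by (intro ftc b inU) (use b in auto)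
      then show "f (x + b *\<^sub>R w + s *\<^sub>R v) - f (x + s *\<^sub>R v) = integral {0..b} (\<lambda>t. g (s, t))"
        by (simp add: g_def integral_unique add_ac)
    qed (use c in auto)
    have "integral {0..b} (\<lambda>t. frechet_derivative g (at (0, t)) (1, 0)) = ?D v (x + b *\<^sub>R w) - ?D v x"
      using fun_cong[OF has_derivative_unique[OF der1 der2], of 1] by simp
    moreover have "integral {0..b} (\<lambda>t. frechet_derivative g (at (0, t)) (1, 0)) = integral {0..b} (\<lambda>t. ?D2 w v (x + t *\<^sub>R w))"
      by (rule integral_cong) (use gd b in auto)
    ultimately show ?thesis by simp
  qed
  have cont: "continuous_on {0..c} (\<lambda>t. ?D2 w v (x + t *\<^sub>R w))"
    by (rule continuous_on_compose2[OF smooth_on_continuous_on[OF smooth_on_derivative[OF Dw[of w], of v]]])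
      (use inU[of 0] c in \<open>auto intro!: continuous_intros\<close>)
  \<comment> \<open>Now b is the variable: both sides of \<open>eq\<close> are differentiated at b =
    0, from the right because \<open>eq\<close> is stated for b \<ge> 0.\<close>
  have "((\<lambda>b. integral {0..b} (\<lambda>t. ?D2 w v (x + t *\<^sub>R w))) has_vector_derivative ?D2 w v (x + 0 *\<^sub>R w)) (at 0 within {0..c})"
    using integral_has_vector_derivative[OF cont, of 0] c by simp
  then have "((\<lambda>b. ?D v (x + b *\<^sub>R w) - ?D v x) has_vector_derivative ?D2 w v x) (at 0 within {0..c})"
    unfolding scaleR_zero_left add_0_right
    by (rule has_vector_derivative_transform[rotated 2]) (use eq c in auto)
  moreover have "((\<lambda>b. ?D v (x + b *\<^sub>R w) - ?D v x) has_vector_derivative ?D2 v w x) (at 0 within {0..c})"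
    using has_vector_derivative_diff[OF line[OF Dw, of x 0 w v] has_vector_derivative_const[of "?D v x"]] U
    by (simp add: has_vector_derivative_at_within)
  moreover have "at (0::real) within {0..c} \<noteq> bot"
    using c by (simp add: at_within_Icc_at_right)
  ultimately show ?thesis
    by (metis vector_derivative_unique_within)
qed

section \<open>Pushing points in the plane\<close>

definition oriented_smooth_on :: "(real^2) set \<Rightarrow> (real^2 \<Rightarrow> real^2) \<Rightarrow> bool" where
  "oriented_smooth_on N h \<longleftrightarrow> smooth_on N h \<and> positive_jacobian_on N h"

lemma det_matrix_compose:
  fixes f g :: "real^2 \<Rightarrow> real^2"
  assumes "linear f" "linear g"
  shows "det (matrix (\<lambda>x. g (f x))) = det (matrix g) * det (matrix f)"
  unfolding matrix_compose[OF assms, unfolded o_def] by (rule det_mul)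

lemma oriented_smooth_on_compose:
  assumes "oriented_smooth_on V g" "oriented_smooth_on U f" "f ` U \<subseteq> V" "open U"
  shows "oriented_smooth_on U (\<lambda>x. g (f x))"
  unfolding oriented_smooth_on_def positive_jacobian_on_def
proof (intro conjI ballI)
  show "smooth_on U (\<lambda>x. g (f x))"
    using assms smooth_on_compose by (auto simp: oriented_smooth_on_def)
  fix x assume x: "x \<in> U"
  then have d: "f differentiable at x" "g differentiable at (f x)"
    using assms by (auto simp: oriented_smooth_on_def intro: smooth_on_differentiable)
  have "frechet_derivative (\<lambda>x. g (f x)) (at x) = (\<lambda>v. frechet_derivative g (at (f x)) (frechet_derivative f (at x) v))"
    using frechet_derivative_compose[OF d] by (simp add: o_def)
  then show "0 < det (matrix (frechet_derivative (\<lambda>x. g (f x)) (at x)))"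
    using det_matrix_compose[OF linear_frechet_derivative[OF d(1)] linear_frechet_derivative[OF d(2)]] assms x
    by (auto simp: oriented_smooth_on_def positive_jacobian_on_def)
qed

lemma oriented_smooth_on_cong:
  assumes "open U" "\<And>x. x \<in> U \<Longrightarrow> f x = g x" "oriented_smooth_on U f"
  shows "oriented_smooth_on U g"
  unfolding oriented_smooth_on_def positive_jacobian_on_def
proof (intro conjI ballI)
  show "smooth_on U g" using assms smooth_on_cong by (auto simp: oriented_smooth_on_def)
  fix x assume x: "x \<in> U"
  have "(f has_derivative frechet_derivative f (at x)) (at x)"
    using assms x smooth_on_has_derivative by (auto simp: oriented_smooth_on_def)
  then have "(g has_derivative frechet_derivative f (at x)) (at x)"
    by (rule has_derivative_transform_within_open[OF _ assms(1) x assms(2)])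
  then have "frechet_derivative g (at x) = frechet_derivative f (at x)"
    using frechet_derivative_at by metis
  then show "0 < det (matrix (frechet_derivative g (at x)))"
    using assms x by (auto simp: oriented_smooth_on_def positive_jacobian_on_def)
qed

lemma oriented_smooth_on_subset: "oriented_smooth_on V f \<Longrightarrow> U \<subseteq> V \<Longrightarrow> oriented_smooth_on U f"
  unfolding oriented_smooth_on_def positive_jacobian_on_def using smooth_on_subset by blast

lemma oriented_smooth_on_local:
  assumes "\<And>x. x \<in> U \<Longrightarrow> \<exists>N. open N \<and> x \<in> N \<and> oriented_smooth_on N f"
  shows "oriented_smooth_on U f"
  unfolding oriented_smooth_on_def
proof
  show "smooth_on U f" by (rule smooth_on_local) (use assms in \<open>auto simp: oriented_smooth_on_def\<close>)
  show "positive_jacobian_on U f" using assms by (auto simp: oriented_smooth_on_def positive_jacobian_on_def)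
qed

lemma oriented_smooth_on_id: "open U \<Longrightarrow> oriented_smooth_on U (\<lambda>x. x)"
  by (simp add: oriented_smooth_on_def positive_jacobian_on_def smooth_on_id matrix_id_mat_1[unfolded id_def])

lemma linear_real2:
  fixes f :: "real^2 \<Rightarrow> 'b::real_vector"
  assumes "linear f" shows "f v = v$1 *\<^sub>R f (axis 1 1) + v$2 *\<^sub>R f (axis 2 1)"
proof -
  have "v = v$1 *\<^sub>R axis 1 1 + v$2 *\<^sub>R axis 2 1"
    by (simp add: vec_eq_iff axis_def forall_2)
  then have "f v = f (v$1 *\<^sub>R axis 1 1 + v$2 *\<^sub>R axis 2 1)" by simp
  then show ?thesis by (simp add: linear_add[OF assms] linear_cmul[OF assms])
qed

lemma det_matrix_2:
  fixes f :: "real^2 \<Rightarrow> real^2"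
  shows "det (matrix f) = f (axis 1 1) $ 1 * f (axis 2 1) $ 2 - f (axis 2 1) $ 1 * f (axis 1 1) $ 2"
  by (simp add: det_2 matrix_def)

text \<open>The map \<open>y \<mapsto> y + b(y) v\<close> is a perturbation of the identity by a contraction, hence bijective,
  and its inverse is as smooth as \<open>b\<close> because the inverse of its derivative
  \<open>1 + v \<otimes> Db\<close> is \<open>1 - (v \<otimes> Db) / (1 + D\<^sub>v b)\<close>.\<close>

locale plane_push =
  fixes b :: "real^2 \<Rightarrow> real" and v :: "real^2"
  assumes smooth: "smooth_on UNIV b"
    and small: "\<And>y. \<bar>frechet_derivative b (at y) v\<bar> \<le> 1/2"
    and lip: "\<And>x y. \<bar>b x - b y\<bar> * norm v \<le> 1/2 * norm (x - y)"
begin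

definition h :: "real^2 \<Rightarrow> real^2" where "h y = y + b y *\<^sub>R v"

text \<open>By \<open>lip\<close> the added term changes a difference by at most half its length, so
  \<open>h\<close> shrinks distances at most by the factor 2. Injectivity and the Lipschitz bound
  for the inverse follow.\<close>

lemma h_expand: "norm (x - y) \<le> 2 * norm (h x - h y)"
proof -
  have "x - y = (h x - h y) - (b x - b y) *\<^sub>R v" by (simp add: h_def algebra_simps)
  then have "norm (x - y) \<le> norm (h x - h y) + \<bar>b x - b y\<bar> * norm v"
    by (metis norm_triangle_ineq4 norm_scaleR)
  then show ?thesis using lip[of x y] by simp
qed

lemma bij_h: "bij h"
  unfolding bij_def
proof
  show "inj h"
  proof (rule injI)
    fix x y assume "h x = h y" then show "x = y" using h_expand[of x y] by simp
  qed
  show "surj h"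
    unfolding surj_def
  proof
    fix w
    \<comment> \<open>A preimage of \<open>w\<close> is a fixed point of a contraction with constant
      1/2.\<close>
    have "\<exists>!y. w - b y *\<^sub>R v = y"
    proof (rule banach_fix_type[of "1/2"])
      show "\<forall>x y. dist (w - b x *\<^sub>R v) (w - b y *\<^sub>R v) \<le> 1/2 * dist x y"
      proof (intro allI)
        fix x y
        have "(w - b x *\<^sub>R v) - (w - b y *\<^sub>R v) = (b y - b x) *\<^sub>R v" by (simp add: algebra_simps)
        then have "dist (w - b x *\<^sub>R v) (w - b y *\<^sub>R v) = \<bar>b y - b x\<bar> * norm v"
          by (metis dist_norm norm_scaleR)
        also have "\<dots> = \<bar>b x - b y\<bar> * norm v" by (simp add: abs_minus_commute)
        finally show "dist (w - b x *\<^sub>R v) (w - b y *\<^sub>R v) \<le> 1/2 * dist x y"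
          using lip[of x y] by (simp add: dist_norm)
      qed
    qed auto
    then obtain y where "w - b y *\<^sub>R v = y" by blast
    then have "w = h y" unfolding h_def by (metis diff_add_cancel)
    then show "\<exists>y. w = h y" by blast
  qed
qed

lemma h_has_derivative: "(h has_derivative (\<lambda>w. w + frechet_derivative b (at y) w *\<^sub>R v)) (at y)"
  unfolding h_def by (auto intro!: derivative_eq_intros smooth_on_has_derivative[OF smooth])

lemma oriented_smooth_h: "oriented_smooth_on UNIV h"
  unfolding oriented_smooth_on_def positive_jacobian_on_def
proof (intro conjI ballI)
  show "smooth_on UNIV h"
    unfolding h_def by (intro smooth_on_add smooth_on_scaleR smooth_on_const smooth_on_id smooth) auto
  fix y
  have l: "frechet_derivative b (at y) v = v$1 * frechet_derivative b (at y) (axis 1 1) + v$2 * frechet_derivative b (at y) (axis 2 1)"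
    using linear_real2[OF linear_frechet_derivative[OF smooth_on_differentiable[OF smooth]], of y v] by simp
  \<comment> \<open>The determinant of a rank-one perturbation of the identity; by
    \<open>small\<close> it is at least 1/2.\<close>
  have "det (matrix (frechet_derivative h (at y))) = 1 + frechet_derivative b (at y) v"
    unfolding frechet_derivative_at[OF h_has_derivative, symmetric] det_matrix_2 l
    by (simp add: axis_def algebra_simps)
  then show "0 < det (matrix (frechet_derivative h (at y)))"
    using small[of y] by linarith
qed

lemma continuous_inv_h: "continuous_on UNIV (inv_into UNIV h)"
proof -
  have "norm (inv_into UNIV h x - inv_into UNIV h y) \<le> 2 * norm (x - y)" for x y
    using h_expand[of "inv_into UNIV h x" "inv_into UNIV h y"] bij_h by (simp add: bij_is_surj surj_f_inv_f)
  then have "lipschitz_on 2 UNIV (inv_into UNIV h)" by (auto simp: lipschitz_on_def dist_norm)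
  then show ?thesis by (rule lipschitz_on_continuous_on)
qed

lemma inv_h_has_derivative:
  "(inv_into UNIV h has_derivative (\<lambda>w. w - (frechet_derivative b (at (inv_into UNIV h y)) w / (1 + frechet_derivative b (at (inv_into UNIV h y)) v)) *\<^sub>R v)) (at y)"
  (is "(_ has_derivative ?g) _")
proof (rule has_derivative_inverse_basic[OF h_has_derivative, where T = UNIV])
  let ?D = "frechet_derivative b (at (inv_into UNIV h y))"
  have l: "linear ?D" by (rule linear_frechet_derivative[OF smooth_on_differentiable[OF smooth]]) simp
  show "bounded_linear ?g"
    using l by (intro linear_conv_bounded_linear[THEN iffD1] linearI) (auto simp: linear_add linear_cmul add_divide_distrib algebra_simps)
  have p: "1 + ?D v \<noteq> 0" using small[of "inv_into UNIV h y"] by linarith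
  have "?g (w + ?D w *\<^sub>R v) = w" for w
  proof -
    have "?D (w + ?D w *\<^sub>R v) = ?D w * (1 + ?D v)" by (simp add: linear_add[OF l] linear_cmul[OF l] algebra_simps)
    then show ?thesis using p by simp
  qed
  then show "?g \<circ> (\<lambda>w. w + ?D w *\<^sub>R v) = id" by auto
  show "continuous (at y) (inv_into UNIV h)" using continuous_inv_h by (simp add: continuous_on_eq_continuous_at)
  show "h (inv_into UNIV h z) = z" for z using bij_h by (simp add: bij_is_surj surj_f_inv_f)
qed auto

text \<open>Bootstrapping: the derivative of the inverse is a smooth expression evaluated at the
  inverse itself, so each order of differentiability yields the next.\<close>

lemma smooth_inv_h: "smooth_on UNIV (inv_into UNIV h)"
proof -
  have "Ck_on k UNIV (inv_into UNIV h)" for k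
  proof (induction k)
    case 0 then show ?case using continuous_inv_h by simp
  next
    case (Suc k)
    let ?q = "\<lambda>w y. frechet_derivative b (at y) w / (1 + frechet_derivative b (at y) v)"
    show ?case
    proof (rule Ck_on_SucI[OF _ inv_h_has_derivative])
      fix w
      have "1 + frechet_derivative b (at y) v \<noteq> 0" for y using small[of y] by linarith
      then have "smooth_on UNIV (?q w)"
        by (intro smooth_on_divide smooth_on_add smooth_on_const smooth_on_derivative smooth) auto
      then have "Ck_on k UNIV (?q w)" unfolding smooth_on_def by blast
      from Ck_on_compose[OF open_UNIV this Suc subset_UNIV]
      have q: "Ck_on k UNIV (\<lambda>y. ?q w (inv_into UNIV h y))" .
      have "Ck_on k UNIV (\<lambda>y. w + ?q w (inv_into UNIV h y) *\<^sub>R (- v))"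
        by (rule Ck_on_add[OF open_UNIV Ck_on_const Ck_on_bilinear[OF bounded_bilinear_scaleR open_UNIV q Ck_on_const]])
          auto
      then show "Ck_on k UNIV (\<lambda>y. w - ?q w (inv_into UNIV h y) *\<^sub>R v)" by simp
    qed auto
  qed
  then show ?thesis by (simp add: smooth_on_def)
qed

lemma oriented_smooth_inv_h: "oriented_smooth_on UNIV (inv_into UNIV h)"
  unfolding oriented_smooth_on_def positive_jacobian_on_def
proof (intro conjI ballI smooth_inv_h)
  fix y
  let ?k = "frechet_derivative (inv_into UNIV h) (at y)" and ?h = "frechet_derivative h (at (inv_into UNIV h y))"
  have d: "inv_into UNIV h differentiable at y" "h differentiable at (inv_into UNIV h y)"
    using smooth_on_differentiable[OF smooth_inv_h] oriented_smooth_h smooth_on_differentiable[of UNIV h]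
    by (auto simp: oriented_smooth_on_def)
  have "(\<lambda>x. h (inv_into UNIV h x)) = (\<lambda>x. x)" using bij_h by (simp add: bij_is_surj surj_f_inv_f)
  then have "?h \<circ> ?k = id"
    using frechet_derivative_compose[OF d] by (simp add: o_def id_def)
  then have "det (matrix ?h) * det (matrix ?k) = 1"
    using det_matrix_compose[OF linear_frechet_derivative[OF d(1)] linear_frechet_derivative[OF d(2)]]
    by (simp add: o_def id_def matrix_id_mat_1[unfolded id_def])
  moreover have "det (matrix ?h) > 0"
    using oriented_smooth_h by (simp add: oriented_smooth_on_def positive_jacobian_on_def)
  ultimately show "0 < det (matrix ?k)"
    by (metis zero_less_mult_pos zero_less_one)
qed

end

lemma frechet_derivative_outside_support:
  assumes "closed C" "\<And>y. y \<notin> C \<Longrightarrow> f y = 0" "x \<notin> C"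
  shows "frechet_derivative f (at x) = (\<lambda>_. 0)"
proof -
  have "(f has_derivative (\<lambda>_. 0)) (at x)"
    by (rule has_derivative_transform_within_open[of "\<lambda>_. 0" _ _ _ "- C"]) (use assms in auto)
  then show ?thesis using frechet_derivative_at by metis
qed

text \<open>With the vector t (q' - q) / b(q) the push sends \<open>q\<close> to q + t (q' - q), so
  \<open>q\<close> travels straight to \<open>q'\<close> as t runs from 0 to 1. The radius
  \<open>d\<close> is chosen so small that all these vectors meet the bounds of
  \<open>plane_push\<close>.\<close>

lemma plane_push_exists:
  fixes z :: "real^2"
  assumes "r > 0"
  obtains b d where "d > 0" "d < r" "\<And>y. y \<notin> cball z r \<Longrightarrow> b y = (0::real)"
    "\<And>q. q \<in> ball z d \<Longrightarrow> b q \<noteq> 0"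
    "\<And>q q' t. q \<in> ball z d \<Longrightarrow> q' \<in> ball z d \<Longrightarrow> 0 \<le> t \<Longrightarrow> t \<le> 1 \<Longrightarrow> plane_push b (t *\<^sub>R ((q' - q) /\<^sub>R b q))"
proof -
  define b where "b y = flat 0 (r\<^sup>2 - (y - z) \<bullet> (y - z))" for y
  have sb: "smooth_on UNIV b" unfolding b_def
    by (intro smooth_on_flat' smooth_on_diff smooth_on_const smooth_on_inner smooth_on_id) auto
  have b0: "b y = 0" if "y \<notin> cball z r" for y
  proof -
    have "r < norm (y - z)" using that by (simp add: dist_norm norm_minus_commute)
    then have "r\<^sup>2 < (norm (y - z))\<^sup>2" using assms by (intro power_strict_mono) auto
    then show ?thesis by (simp add: b_def flat_def power2_norm_eq_inner)
  qed
  \<comment> \<open>The basis derivatives are bounded by some \<open>B\<close> on the compact ball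
    and vanish off it; the two coordinates together give the bound 2 B for the full
    derivative.\<close>
  let ?S = "\<Union>i\<in>Basis. (\<lambda>y. frechet_derivative b (at y) i) ` cball z r"
  have "bounded ?S"
    by (intro bounded_UN ballI compact_imp_bounded compact_continuous_image compact_cball
       continuous_on_subset[OF smooth_on_continuous_on[OF smooth_on_derivative[OF sb]]]) auto
  then obtain B where B0: "B > 0" "\<forall>x\<in>?S. norm x \<le> B"
    unfolding bounded_pos by blast
  have B: "\<bar>frechet_derivative b (at y) i\<bar> \<le> B" "B > 0" if "y \<in> cball z r" "i \<in> Basis" for y i
  proof -
    have "frechet_derivative b (at y) i \<in> ?S" using that by blast
    then show "\<bar>frechet_derivative b (at y) i\<bar> \<le> B" using B0(2) by (metis real_norm_def)
  qed (rule B0)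
  have B': "\<bar>frechet_derivative b (at y) i\<bar> \<le> B" if "i \<in> Basis" for y i
    using B[OF _ that] B0(1) frechet_derivative_outside_support[of "cball z r" b y] b0
    by (cases "y \<in> cball z r") auto
  have Dv: "\<bar>frechet_derivative b (at y) v\<bar> \<le> 2 * B * norm v" for y v
  proof -
    have "frechet_derivative b (at y) v = v$1 * frechet_derivative b (at y) (axis 1 1) + v$2 * frechet_derivative b (at y) (axis 2 1)"
      using linear_real2[OF linear_frechet_derivative[OF smooth_on_differentiable[OF sb]], of y v] by simp
    also have "\<bar>\<dots>\<bar> \<le> norm v * B + norm v * B"
      by (intro order_trans[OF abs_triangle_ineq] add_mono) (auto simp: abs_mult axis_in_Basis_iff intro!: mult_mono B' component_le_norm_cart)
    finally show ?thesis by simp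
  qed
  have Lip: "\<bar>b x - b y\<bar> \<le> 2 * B * norm (x - y)" for x y
  proof -
    have "onorm (frechet_derivative b (at y)) \<le> 2 * B" for y
      by (rule onorm_le) (use Dv in simp)
    then show ?thesis
      using differentiable_bound[of UNIV b "\<lambda>y. frechet_derivative b (at y)" "2 * B" x y]
      by (auto simp: smooth_on_has_derivative[OF sb])
  qed
  define c where "c = b z / 2"
  have c: "c > 0" using assms by (simp add: c_def b_def flat_def)
  \<comment> \<open>The bound r/2 gives \<open>d < r\<close>; c / (2 B) keeps b \<ge> c on the ball,
    2 B being a Lipschitz constant of \<open>b\<close>; c / (16 B) makes the push vectors, of length
    at most 2 d / c, short enough.\<close>
  define d where "d = min (r/2) (min (c / (2 * B)) (c / (16 * B)))"
  have d: "d > 0" "d < r" "d * (2 * B) \<le> c" "d * (8 * B) \<le> c / 2"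
    using assms c B0(1) by (auto simp: d_def min_def field_simps)
  have bq: "b q \<ge> c" if "q \<in> ball z d" for q
  proof -
    have "\<bar>b q - b z\<bar> \<le> 2 * B * d"
      using Lip[of q z] that B0(1) by (intro order_trans[OF Lip] mult_left_mono) (auto simp: dist_norm norm_minus_commute)
    then show ?thesis using d(3) by (simp add: c_def algebra_simps)
  qed
  have "plane_push b (t *\<^sub>R ((q' - q) /\<^sub>R b q))" if q: "q \<in> ball z d" "q' \<in> ball z d" and t: "0 \<le> t" "t \<le> 1" for q q' t
  proof -
    let ?v = "t *\<^sub>R ((q' - q) /\<^sub>R b q)"
    have "norm (q' - q) \<le> 2 * d"
      using q norm_triangle_ineq[of "q' - z" "z - q"] by (simp add: dist_norm norm_minus_commute)
    moreover have "norm ?v \<le> norm (q' - q) / c"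
    proof -
      have "norm ?v = t * (norm (q' - q) / b q)"
        using t bq[OF q(1)] c by (simp add: divide_inverse mult_ac)
      also have "\<dots> \<le> 1 * (norm (q' - q) / c)"
        using t bq[OF q(1)] c by (intro mult_mono divide_left_mono) auto
      finally show ?thesis by simp
    qed
    ultimately have "norm ?v \<le> 2 * d / c" using c by (meson divide_right_mono less_imp_le order_trans)
    then have "norm ?v * (4 * B) \<le> (2 * d / c) * (4 * B)" using B0(1) by (intro mult_right_mono) auto
    also have "\<dots> \<le> 1" using d(4) c by (simp add: field_simps)
    finally have v: "2 * B * norm ?v \<le> 1/2" by (simp only: mult_ac)
    show ?thesis
    proof
      show "smooth_on UNIV b" by (rule sb)
      show "\<bar>frechet_derivative b (at y) ?v\<bar> \<le> 1/2" for y using Dv[of y ?v] v by linarith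
      show "\<bar>b x - b y\<bar> * norm ?v \<le> 1/2 * norm (x - y)" for x y
      proof -
        have "\<bar>b x - b y\<bar> * norm ?v \<le> (2 * B * norm (x - y)) * norm ?v"
          by (intro mult_right_mono Lip) auto
        also have "\<dots> = (2 * B * norm ?v) * norm (x - y)" by simp
        also have "\<dots> \<le> 1/2 * norm (x - y)" using v by (intro mult_right_mono) auto
        finally show ?thesis .
      qed
    qed
  qed
  moreover have "b q \<noteq> 0" if "q \<in> ball z d" for q using bq[OF that] c by linarith
  ultimately show ?thesis using that[of d b] d b0 by blast
qed

section \<open>Diffeomorphisms of a closed surface\<close>

lemma continuous_on_openin_local:
  assumes "\<And>x. x \<in> S \<Longrightarrow> \<exists>W. openin (top_of_set S) W \<and> x \<in> W \<and> continuous_on W f"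
  shows "continuous_on S f"
  unfolding continuous_on_def
proof
  fix x assume x: "x \<in> S"
  then obtain W where W: "openin (top_of_set S) W" "x \<in> W" "continuous_on W f" using assms by blast
  then obtain T where T: "open T" "W = S \<inter> T" by (auto simp: openin_open)
  have "at x within S = at x within W"
    by (rule at_within_nhd[of x T]) (use T W in auto)
  then show "(f \<longlongrightarrow> f x) (at x within S)"
    using W by (simp add: continuous_on_def)
qed

locale closed_surface =
  fixes X :: "'a::topological_space set" and A :: "'a chart set"
  assumes surface: "closed_oriented_surface X A"
begin

lemma atlas: "oriented_atlas X A"
  and connected_X: "connected X" and compact_X: "compact X" and Hausdorff_X: "Hausdorff_space (top_of_set X)"
  using surface by (auto simp: closed_oriented_surface_def)

lemma chart_openin: "(U, \<phi>) \<in> A \<Longrightarrow> openin (top_of_set X) U"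
  using atlas by (auto simp: oriented_atlas_def is_chart_def)

lemma chart_subset: "(U, \<phi>) \<in> A \<Longrightarrow> U \<subseteq> X"
  using chart_openin openin_imp_subset by blast

lemma chart_homeomorphism: "(U, \<phi>) \<in> A \<Longrightarrow> homeomorphism U (\<phi> ` U) \<phi> (inv_into U \<phi>)"
  using atlas by (auto simp: oriented_atlas_def is_chart_def)

lemma chart_inv: "(U, \<phi>) \<in> A \<Longrightarrow> x \<in> U \<Longrightarrow> inv_into U \<phi> (\<phi> x) = x"
  using chart_homeomorphism by (auto simp: homeomorphism_def)

lemma chart_continuous: "(U, \<phi>) \<in> A \<Longrightarrow> continuous_on U \<phi>" "(U, \<phi>) \<in> A \<Longrightarrow> continuous_on (\<phi> ` U) (inv_into U \<phi>)"
  using chart_homeomorphism by (auto simp: homeomorphism_def)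

lemma chart_ex: "x \<in> X \<Longrightarrow> \<exists>U \<phi>. (U, \<phi>) \<in> A \<and> x \<in> U"
  using atlas by (force simp: oriented_atlas_def)

lemma chart_open_image:
  assumes "(U, \<phi>) \<in> A" "openin (top_of_set X) W"
  shows "open (\<phi> ` (U \<inter> W))"
proof -
  have "openin (top_of_set U) (U \<inter> W)"
    by (rule openin_subset_trans[OF openin_Int[OF chart_openin[OF assms(1)] assms(2)] Int_lower1 chart_subset[OF assms(1)]])
  then have "openin (top_of_set (\<phi> ` U)) (\<phi> ` (U \<inter> W))"
    using homeomorphism_imp_open_map[OF chart_homeomorphism[OF assms(1)]] by blast
  moreover have "open (\<phi> ` U)" using atlas assms by (auto simp: oriented_atlas_def is_chart_def)
  ultimately show ?thesis using openin_open_eq by blast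
qed

lemma chart_open: "(U, \<phi>) \<in> A \<Longrightarrow> open (\<phi> ` U)"
  using chart_open_image[OF _ openin_subtopology_self, of U \<phi>] chart_subset
  by (metis Int_absorb2)

lemma transition_oriented_smooth:
  assumes "(U, \<phi>) \<in> A" "(V, \<psi>) \<in> A"
  shows "oriented_smooth_on (\<phi> ` (U \<inter> V)) (\<lambda>y. \<psi> (inv_into U \<phi> y))"
  using atlas assms unfolding oriented_atlas_def oriented_smooth_on_def o_def by fast

lemma openin_chart_preimage:
  assumes "(U, \<phi>) \<in> A" "open N" shows "openin (top_of_set X) (U \<inter> \<phi> -` N)"
  using continuous_openin_preimage_gen[OF chart_continuous(1)[OF assms(1)] assms(2)] chart_openin[OF assms(1)]
  by (rule openin_trans)

text \<open>One suitable pair of charts around each point is asked for, which is what constructions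
  provide; \<open>oriented_smooth_map_charts\<close> passes to all pairs of charts.\<close>

definition oriented_smooth_map :: "('a \<Rightarrow> 'a) \<Rightarrow> bool" where
  "oriented_smooth_map f \<longleftrightarrow> continuous_on X f \<and> f ` X \<subseteq> X \<and>
     (\<forall>x\<in>X. \<exists>U \<phi> V \<psi> N. (U, \<phi>) \<in> A \<and> (V, \<psi>) \<in> A \<and> x \<in> U \<and> f x \<in> V \<and> open N \<and> \<phi> x \<in> N \<and>
        N \<subseteq> \<phi> ` (U \<inter> f -` V) \<and> oriented_smooth_on N (\<lambda>y. \<psi> (f (inv_into U \<phi> y))))"

lemma open_chart_image_vimage:
  assumes "continuous_on X f" "f ` X \<subseteq> X" "(U, \<phi>) \<in> A" "openin (top_of_set X) V"
  shows "open (\<phi> ` (U \<inter> f -` V))"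
proof -
  have "openin (top_of_set X) (X \<inter> f -` V)"
    by (rule continuous_openin_preimage[OF assms(1) _ assms(4)]) (use assms(2) in blast)
  from chart_open_image[OF assms(3) this] show ?thesis
    using chart_subset[OF assms(3)] by (simp add: Int_assoc[symmetric] Int_absorb2)
qed

text \<open>Transition maps on both sides convert the good pair of charts into the given one. They
  are smooth with positive Jacobian, so both properties survive.\<close>

lemma oriented_smooth_map_charts:
  assumes f: "oriented_smooth_map f" and U: "(U, \<phi>) \<in> A" and V: "(V, \<psi>) \<in> A"
  shows "oriented_smooth_on (\<phi> ` (U \<inter> f -` V)) (\<lambda>y. \<psi> (f (inv_into U \<phi> y)))"
proof (rule oriented_smooth_on_local)
  have fc: "continuous_on X f" "f ` X \<subseteq> X" using f by (auto simp: oriented_smooth_map_def)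
  fix y assume "y \<in> \<phi> ` (U \<inter> f -` V)"
  then obtain x where x: "x \<in> U" "f x \<in> V" "y = \<phi> x" by auto
  then have xX: "x \<in> X" using chart_subset U by blast
  then obtain U' \<phi>' V' \<psi>' N where c: "(U', \<phi>') \<in> A" "(V', \<psi>') \<in> A" "x \<in> U'" "f x \<in> V'" "open N" "\<phi>' x \<in> N"
    "N \<subseteq> \<phi>' ` (U' \<inter> f -` V')" "oriented_smooth_on N (\<lambda>y. \<psi>' (f (inv_into U' \<phi>' y)))"
    using f unfolding oriented_smooth_map_def by metis
  define W where "W = (U' \<inter> \<phi>' -` N) \<inter> (X \<inter> f -` V)"
  have "openin (top_of_set X) W"
    unfolding W_def
    by (rule openin_Int[OF openin_chart_preimage[OF c(1,5)] continuous_openin_preimage[OF fc(1) _ chart_openin[OF V]]])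
      (use fc in auto)
  then have oW: "open (\<phi> ` (U \<inter> W))" by (rule chart_open_image[OF U])
  \<comment> \<open>The hypothesis places \<phi>' w in an image; injectivity of the chart \<phi>'
    turns this into a statement about \<open>w\<close> itself.\<close>
  have fW: "f w \<in> V'" if "w \<in> W" for w
  proof -
    have "\<phi>' w \<in> \<phi>' ` (U' \<inter> f -` V')" using that c(7) by (auto simp: W_def)
    then obtain w' where "w' \<in> U'" "f w' \<in> V'" "\<phi>' w = \<phi>' w'" by auto
    then show ?thesis using chart_inv[OF c(1)] that by (metis IntD1 W_def)
  qed
  have 1: "oriented_smooth_on (\<phi> ` (U \<inter> W)) (\<lambda>y. \<phi>' (inv_into U \<phi> y))"
    by (rule oriented_smooth_on_subset[OF transition_oriented_smooth[OF U c(1)]]) (auto simp: W_def)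
  have 2: "oriented_smooth_on (\<phi> ` (U \<inter> W)) (\<lambda>y. \<psi>' (f (inv_into U' \<phi>' (\<phi>' (inv_into U \<phi> y)))))"
    by (rule oriented_smooth_on_compose[OF c(8) 1 _ oW]) (use chart_inv[OF U] in \<open>auto simp: W_def\<close>)
  have 3: "oriented_smooth_on (\<phi> ` (U \<inter> W)) (\<lambda>y. \<psi> (inv_into V' \<psi>' (\<psi>' (f (inv_into U' \<phi>' (\<phi>' (inv_into U \<phi> y)))))))"
    by (rule oriented_smooth_on_compose[OF transition_oriented_smooth[OF c(2) V] 2 _ oW])
      (use chart_inv[OF U] chart_inv[OF c(1)] fW in \<open>auto simp: W_def\<close>)
  have "oriented_smooth_on (\<phi> ` (U \<inter> W)) (\<lambda>y. \<psi> (f (inv_into U \<phi> y)))"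
    by (rule oriented_smooth_on_cong[OF oW _ 3])
      (use chart_inv[OF U] chart_inv[OF c(1)] chart_inv[OF c(2)] fW in \<open>auto simp: W_def\<close>)
  moreover have "y \<in> \<phi> ` (U \<inter> W)" using x c xX by (auto simp: W_def)
  ultimately show "\<exists>N. open N \<and> y \<in> N \<and> oriented_smooth_on N (\<lambda>y. \<psi> (f (inv_into U \<phi> y)))"
    using oW by blast
qed

lemma oriented_smooth_mapD:
  assumes "oriented_smooth_map f"
  shows "smooth_map X A f" "orientation_preserving X A f"
  using assms oriented_smooth_map_charts[OF assms]
  unfolding smooth_map_def orientation_preserving_def oriented_smooth_map_def[of f] oriented_smooth_on_def o_def
  by auto

lemma oriented_smooth_map_cong:
  assumes "\<And>x. x \<in> X \<Longrightarrow> f x = g x" "oriented_smooth_map f"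
  shows "oriented_smooth_map g"
  unfolding oriented_smooth_map_def
proof (intro conjI ballI)
  show "continuous_on X g" "g ` X \<subseteq> X"
    using assms by (auto simp: oriented_smooth_map_def cong: continuous_on_cong)
  fix x assume x: "x \<in> X"
  then obtain U \<phi> V \<psi> N where c: "(U, \<phi>) \<in> A" "(V, \<psi>) \<in> A" "x \<in> U" "f x \<in> V" "open N" "\<phi> x \<in> N"
    "N \<subseteq> \<phi> ` (U \<inter> f -` V)" "oriented_smooth_on N (\<lambda>y. \<psi> (f (inv_into U \<phi> y)))"
    using assms(2) unfolding oriented_smooth_map_def by metis
  have fg: "f w = g w" if "w \<in> U" for w using that assms(1) chart_subset[OF c(1)] by blast
  have "oriented_smooth_on N (\<lambda>y. \<psi> (g (inv_into U \<phi> y)))"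
    by (rule oriented_smooth_on_cong[OF c(5) _ c(8)]) (use c(7) fg inv_into_into[of _ \<phi> U] in \<open>auto simp: chart_inv[OF c(1)]\<close>)
  moreover have "N \<subseteq> \<phi> ` (U \<inter> g -` V)" using c(7) fg by auto
  ultimately show "\<exists>U \<phi> V \<psi> N. (U, \<phi>) \<in> A \<and> (V, \<psi>) \<in> A \<and> x \<in> U \<and> g x \<in> V \<and> open N \<and> \<phi> x \<in> N \<and>
        N \<subseteq> \<phi> ` (U \<inter> g -` V) \<and> oriented_smooth_on N (\<lambda>y. \<psi> (g (inv_into U \<phi> y)))"
    using c fg by metis
qed

lemma oriented_smooth_map_compose:
  assumes f: "oriented_smooth_map f" and g: "oriented_smooth_map g"
  shows "oriented_smooth_map (\<lambda>x. g (f x))"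
  unfolding oriented_smooth_map_def
proof (intro conjI ballI)
  have fc: "continuous_on X f" "f ` X \<subseteq> X" "continuous_on X g" "g ` X \<subseteq> X"
    using f g by (auto simp: oriented_smooth_map_def)
  show gf: "continuous_on X (\<lambda>x. g (f x))" by (rule continuous_on_compose2[OF fc(3,1,2)])
  show gfX: "(\<lambda>x. g (f x)) ` X \<subseteq> X" using fc by auto
  fix x assume x: "x \<in> X"
  have fx: "f x \<in> X" "g (f x) \<in> X" using fc(2,4) x by auto
  obtain U \<phi> V \<psi> W \<theta> where c: "(U, \<phi>) \<in> A" "x \<in> U" "(V, \<psi>) \<in> A" "f x \<in> V" "(W, \<theta>) \<in> A" "g (f x) \<in> W"
    using chart_ex[OF x] chart_ex[OF fx(1)] chart_ex[OF fx(2)] by blast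
  let ?N = "\<phi> ` (U \<inter> f -` V) \<inter> \<phi> ` (U \<inter> (\<lambda>x. g (f x)) -` W)"
  have oN: "open ?N"
    by (intro open_Int open_chart_image_vimage fc gf gfX c chart_openin[OF c(3)] chart_openin[OF c(5)])
  have N: "\<exists>w. w \<in> U \<and> f w \<in> V \<and> g (f w) \<in> W \<and> y = \<phi> w" if y: "y \<in> ?N" for y
  proof -
    obtain w where w: "w \<in> U" "f w \<in> V" "y = \<phi> w" using y by auto
    moreover obtain w' where w': "w' \<in> U" "g (f w') \<in> W" "y = \<phi> w'" using y by auto
    moreover have "w = w'" using chart_inv[OF c(1) w(1)] chart_inv[OF c(1) w'(1)] w(3) w'(3) by simp
    ultimately show ?thesis by blast
  qed
  have 1: "oriented_smooth_on ?N (\<lambda>y. \<psi> (f (inv_into U \<phi> y)))"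
    by (rule oriented_smooth_on_subset[OF oriented_smooth_map_charts[OF f c(1,3)]]) auto
  have 2: "oriented_smooth_on ?N (\<lambda>y. \<theta> (g (inv_into V \<psi> (\<psi> (f (inv_into U \<phi> y))))))"
  proof (rule oriented_smooth_on_compose[OF oriented_smooth_map_charts[OF g c(3,5)] 1 _ oN], rule image_subsetI)
    fix y assume "y \<in> ?N"
    then obtain w where "w \<in> U" "f w \<in> V" "g (f w) \<in> W" "y = \<phi> w" using N by blast
    then show "\<psi> (f (inv_into U \<phi> y)) \<in> \<psi> ` (V \<inter> g -` W)" by (auto simp: chart_inv[OF c(1)])
  qed
  have 3: "oriented_smooth_on ?N (\<lambda>y. \<theta> (g (f (inv_into U \<phi> y))))"
  proof (rule oriented_smooth_on_cong[OF oN _ 2])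
    fix y assume "y \<in> ?N"
    then obtain w where "w \<in> U" "f w \<in> V" "g (f w) \<in> W" "y = \<phi> w" using N by blast
    then show "\<theta> (g (inv_into V \<psi> (\<psi> (f (inv_into U \<phi> y))))) = \<theta> (g (f (inv_into U \<phi> y)))"
      by (simp add: chart_inv[OF c(1)] chart_inv[OF c(3)])
  qed
  show "\<exists>U \<phi> V \<psi> N. (U, \<phi>) \<in> A \<and> (V, \<psi>) \<in> A \<and> x \<in> U \<and> g (f x) \<in> V \<and> open N \<and> \<phi> x \<in> N \<and>
        N \<subseteq> \<phi> ` (U \<inter> (\<lambda>x. g (f x)) -` V) \<and> oriented_smooth_on N (\<lambda>y. \<psi> (g (f (inv_into U \<phi> y))))"
    by (rule exI[of _ U], rule exI[of _ \<phi>], rule exI[of _ W], rule exI[of _ \<theta>], rule exI[of _ ?N])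
      (use c oN 3 in auto)
qed

text \<open>No fixed point is imposed: a push along a piece of a loop moves the base point, and only
  the composition over the whole loop brings it back.\<close>

definition oriented_diffeos :: "('a \<Rightarrow> 'a) set" where
  "oriented_diffeos = {f \<in> Bij X. oriented_smooth_map f \<and> oriented_smooth_map (inv_into X f)}"

lemma oriented_diffeos_bij: "f \<in> oriented_diffeos \<Longrightarrow> bij_betw f X X"
  by (simp add: oriented_diffeos_def Bij_def)

lemma oriented_diffeos_continuous: "f \<in> oriented_diffeos \<Longrightarrow> continuous_on X f \<and> f ` X \<subseteq> X"
  by (simp add: oriented_diffeos_def oriented_smooth_map_def)

lemma oriented_diffeos_compose:
  assumes "f \<in> oriented_diffeos" "g \<in> oriented_diffeos"
  shows "compose X g f \<in> oriented_diffeos"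
  unfolding oriented_diffeos_def mem_Collect_eq
proof (intro conjI)
  have b: "bij_betw f X X" "bij_betw g X X" using assms oriented_diffeos_bij by auto
  show B: "compose X g f \<in> Bij X"
    using assms compose_Bij by (auto simp: oriented_diffeos_def)
  show "oriented_smooth_map (compose X g f)"
    by (rule oriented_smooth_map_cong[OF _ oriented_smooth_map_compose[of f g]])
      (use assms in \<open>auto simp: oriented_diffeos_def compose_def\<close>)
  show "oriented_smooth_map (inv_into X (compose X g f))"
  proof (rule oriented_smooth_map_cong[OF _ oriented_smooth_map_compose[of "inv_into X g" "inv_into X f"]])
    fix x assume x: "x \<in> X"
    have i: "inv_into X g x \<in> X" "inv_into X f (inv_into X g x) \<in> X"
      using b x by (meson bij_betwE bij_betw_inv_into)+
    have "compose X g f (inv_into X f (inv_into X g x)) = x"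
      using b x i by (simp add: compose_def bij_betw_inv_into_right)
    moreover have "inj_on (compose X g f) X" using B by (simp add: Bij_def bij_betw_def)
    ultimately show "inv_into X f (inv_into X g x) = inv_into X (compose X g f) x"
      using i by (metis inv_into_f_f)
  qed (use assms in \<open>auto simp: oriented_diffeos_def\<close>)
qed

lemma oriented_diffeos_imp_diffeos: "f \<in> oriented_diffeos \<Longrightarrow> f p = p \<Longrightarrow> f \<in> diffeos X A p"
  using oriented_smooth_mapD
  by (auto simp: oriented_diffeos_def diffeos_def diffeomorphism_def Bij_def)

section \<open>Extending plane maps with support in a chart to the surface\<close>

definition extend_by_id :: "'a set \<Rightarrow> ('a \<Rightarrow> real^2) \<Rightarrow> (real^2 \<Rightarrow> real^2) \<Rightarrow> 'a \<Rightarrow> 'a" where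
  "extend_by_id U \<phi> h x = (if x \<in> U then inv_into U \<phi> (h (\<phi> x)) else x)"

lemma extend_by_id_outside:
  assumes "(U, \<phi>) \<in> A" "\<And>y. y \<notin> C \<Longrightarrow> h y = y" "x \<notin> inv_into U \<phi> ` C"
  shows "extend_by_id U \<phi> h x = x"
proof (cases "x \<in> U")
  case True
  then have "\<phi> x \<notin> C" using assms(3) chart_inv[OF assms(1)] by force
  then show ?thesis using True assms(2) chart_inv[OF assms(1)] by (simp add: extend_by_id_def)
qed (simp add: extend_by_id_def)

lemma chart_preimage_subset: "C \<subseteq> \<phi> ` U \<Longrightarrow> inv_into U \<phi> ` C \<subseteq> U"
  by (auto intro: inv_into_into)

lemma closedin_chart_preimage:
  assumes "(U, \<phi>) \<in> A" "compact C" "C \<subseteq> \<phi> ` U"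
  shows "closedin (top_of_set X) (inv_into U \<phi> ` C)"
proof -
  have "compact (inv_into U \<phi> ` C)"
    using continuous_on_subset[OF chart_continuous(2)[OF assms(1)] assms(3)] assms(2)
    by (rule compact_continuous_image)
  moreover have "inv_into U \<phi> ` C \<subseteq> X"
  proof (rule image_subsetI)
    fix y assume "y \<in> C"
    then show "inv_into U \<phi> y \<in> X"
      using inv_into_into[of y \<phi> U] assms(3) chart_subset[OF assms(1)] by blast
  qed
  ultimately show ?thesis
    using compactin_imp_closedin[OF Hausdorff_X] by (simp add: compactin_subtopology)
qed

text \<open>Locally the map is \<open>h\<close> read in the chart or the identity. The two open
  regions cover \<open>X\<close> because the compact set outside which nothing moves is closed in a
  Hausdorff space. The parameter set \<open>T\<close> serves single maps and isotopies
  alike.\<close>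

lemma extend_by_id_continuous:
  fixes h :: "'b::topological_space \<Rightarrow> real^2 \<Rightarrow> real^2"
  assumes U: "(U, \<phi>) \<in> A" and C: "compact C" "C \<subseteq> \<phi> ` U"
    and h: "continuous_on (T \<times> UNIV) (\<lambda>(t, y). h t y)" "\<And>t. t \<in> T \<Longrightarrow> h t ` \<phi> ` U \<subseteq> \<phi> ` U"
      "\<And>t y. t \<in> T \<Longrightarrow> y \<notin> C \<Longrightarrow> h t y = y"
  shows "continuous_on (T \<times> X) (\<lambda>(t, x). extend_by_id U \<phi> (h t) x)"
proof (rule continuous_on_openin_local)
  fix z assume "z \<in> T \<times> X"
  then obtain t x where z: "z = (t, x)" "t \<in> T" "x \<in> X" by auto
  let ?K = "inv_into U \<phi> ` C"
  show "\<exists>W. openin (top_of_set (T \<times> X)) W \<and> z \<in> W \<and> continuous_on W (\<lambda>(t, x). extend_by_id U \<phi> (h t) x)"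
  proof (cases "x \<in> U")
    case True
    have "continuous_on (T \<times> U) (\<lambda>w. (fst w, \<phi> (snd w)))"
      by (intro continuous_intros continuous_on_compose2[OF chart_continuous(1)[OF U]]) auto
    then have "continuous_on (T \<times> U) (\<lambda>w. h (fst w) (\<phi> (snd w)))"
      using continuous_on_compose2[OF h(1), of "T \<times> U" "\<lambda>w. (fst w, \<phi> (snd w))"]
      by (auto simp: image_subset_iff)
    then have "continuous_on (T \<times> U) (\<lambda>w. inv_into U \<phi> (h (fst w) (\<phi> (snd w))))"
      by (rule continuous_on_compose2[OF chart_continuous(2)[OF U]]) (use h(2) in fastforce)
    then have "continuous_on (T \<times> U) (\<lambda>(t, x). extend_by_id U \<phi> (h t) x)"
      by (rule continuous_on_eq) (auto simp: extend_by_id_def)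
    moreover have "openin (top_of_set (T \<times> X)) (T \<times> U)"
      by (intro openin_Times chart_openin[OF U]) auto
    ultimately show ?thesis using z True by blast
  next
    case False
    have "openin (top_of_set (T \<times> X)) (T \<times> (X - ?K))"
      by (intro openin_Times openin_diff closedin_chart_preimage U C) auto
    moreover have "continuous_on (T \<times> (X - ?K)) (\<lambda>(t, x). extend_by_id U \<phi> (h t) x)"
    proof (rule continuous_on_eq[of _ snd])
      show "snd w = (case w of (t, x) \<Rightarrow> extend_by_id U \<phi> (h t) x)" if "w \<in> T \<times> (X - ?K)" for w
        using that extend_by_id_outside[OF U, of C "h (fst w)" "snd w"] h(3) by (cases w) auto
    qed (intro continuous_intros)
    moreover have "x \<notin> ?K" using False chart_preimage_subset[OF C(2)] by blast
    ultimately show ?thesis using z by blast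
  qed
qed

lemma extend_by_id_oriented_smooth:
  assumes U: "(U, \<phi>) \<in> A" and C: "compact C" "C \<subseteq> \<phi> ` U"
    and h: "oriented_smooth_on UNIV h" "h ` \<phi> ` U \<subseteq> \<phi> ` U" "\<And>y. y \<notin> C \<Longrightarrow> h y = y"
  shows "oriented_smooth_map (extend_by_id U \<phi> h)"
  unfolding oriented_smooth_map_def
proof (intro conjI ballI)
  have hc: "continuous_on UNIV h"
    using h(1) smooth_on_continuous_on by (auto simp: oriented_smooth_on_def)
  \<comment> \<open>A family over a single parameter value reduces continuity to the version with
    parameters.\<close>
  have "continuous_on ({0::real} \<times> X) (\<lambda>(t, x). extend_by_id U \<phi> h x)"
    by (rule extend_by_id_continuous[OF U C]) (use h in \<open>auto intro!: continuous_on_compose2[OF hc] continuous_intros simp: case_prod_beta\<close>)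
  from continuous_on_compose2[OF this, of X "\<lambda>x. (0, x)"]
  show "continuous_on X (extend_by_id U \<phi> h)" by (simp add: continuous_on_Pair image_subset_iff)
  show "extend_by_id U \<phi> h ` X \<subseteq> X"
    using chart_subset[OF U] h(2) inv_into_into[of _ \<phi> U] by (force simp: extend_by_id_def)
  fix x assume x: "x \<in> X"
  let ?K = "inv_into U \<phi> ` C"
  show "\<exists>U' \<phi>' V \<psi> N. (U', \<phi>') \<in> A \<and> (V, \<psi>) \<in> A \<and> x \<in> U' \<and> extend_by_id U \<phi> h x \<in> V \<and> open N \<and> \<phi>' x \<in> N \<and>
        N \<subseteq> \<phi>' ` (U' \<inter> extend_by_id U \<phi> h -` V) \<and> oriented_smooth_on N (\<lambda>y. \<psi> (extend_by_id U \<phi> h (inv_into U' \<phi>' y)))"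
  proof (cases "x \<in> U")
    case True
    have i: "extend_by_id U \<phi> h w \<in> U" if "w \<in> U" for w
      using that h(2) by (auto simp: extend_by_id_def intro!: inv_into_into)
    have "oriented_smooth_on (\<phi> ` U) (\<lambda>y. \<phi> (extend_by_id U \<phi> h (inv_into U \<phi> y)))"
    proof (rule oriented_smooth_on_cong[OF chart_open[OF U] _ oriented_smooth_on_subset[OF h(1) subset_UNIV]])
      fix y assume "y \<in> \<phi> ` U"
      then obtain w where "w \<in> U" "y = \<phi> w" by auto
      moreover have "h (\<phi> w) \<in> \<phi> ` U" using h(2) \<open>w \<in> U\<close> by auto
      ultimately show "h y = \<phi> (extend_by_id U \<phi> h (inv_into U \<phi> y))"
        by (simp add: chart_inv[OF U] extend_by_id_def f_inv_into_f)
    qed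
    moreover have "\<phi> ` U \<subseteq> \<phi> ` (U \<inter> extend_by_id U \<phi> h -` U)" using i by auto
    ultimately show ?thesis using U True i chart_open[OF U] by blast
  next
    case False
    then have xK: "x \<notin> ?K" using chart_preimage_subset[OF C(2)] by blast
    obtain V \<psi> where V: "(V, \<psi>) \<in> A" "x \<in> V" using chart_ex x by blast
    let ?N = "\<psi> ` (V \<inter> (X - ?K))"
    have oN: "open ?N" by (intro chart_open_image V openin_diff closedin_chart_preimage U C) auto
    have e: "extend_by_id U \<phi> h w = w" if "w \<in> X - ?K" for w
      using that extend_by_id_outside[OF U h(3)] by blast
    have "oriented_smooth_on ?N (\<lambda>y. \<psi> (extend_by_id U \<phi> h (inv_into V \<psi> y)))"
      by (rule oriented_smooth_on_cong[OF oN _ oriented_smooth_on_id[OF oN]])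
        (use e chart_inv[OF V(1)] in auto)
    moreover have "?N \<subseteq> \<psi> ` (V \<inter> extend_by_id U \<phi> h -` V)" using e by auto
    moreover have "\<psi> x \<in> ?N" "extend_by_id U \<phi> h x \<in> V" using V x xK e[of x] by auto
    ultimately show ?thesis using V oN by blast
  qed
qed

end

section \<open>Point pushing\<close>

text \<open>Library facts about paths that use \<^const>\<open>linepath\<close> are only available in normed spaces; in
  the surface they are obtained by pushing forward homotopies of convex parameter spaces.\<close>

lemma homotopic_paths_push:
  fixes K :: "'b::real_normed_vector \<Rightarrow> 'a::topological_space"
  assumes "continuous_on S K" "K ` S \<subseteq> X" "convex S"
    and "path p" "path_image p \<subseteq> S" "path q" "path_image q \<subseteq> S"
    and "pathstart p = pathstart q" "pathfinish p = pathfinish q"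
  shows "homotopic_paths X (K \<circ> p) (K \<circ> q)"
proof (rule homotopic_paths_continuous_image)
  show "homotopic_paths S p q"
  proof (rule homotopic_paths_linear)
    fix t :: real assume "t \<in> {0..1}"
    then have "p t \<in> S" "q t \<in> S" using assms by (auto simp: path_image_def)
    then show "closed_segment (p t) (q t) \<subseteq> S" using assms(3) by (simp add: closed_segment_subset)
  qed (use assms in auto)
qed (use assms in auto)

text \<open>Both paths are images of edge paths with common ends in the convex unit square.\<close>

lemma homotopic_paths_square:
  fixes K :: "real \<times> real \<Rightarrow> 'a::topological_space"
  assumes "continuous_on ({0..1} \<times> {0..1}) K" "K ` ({0..1} \<times> {0..1}) \<subseteq> X"
  shows "homotopic_paths X ((\<lambda>s. K (0, s)) +++ (\<lambda>t. K (t, 1))) ((\<lambda>t. K (t, 0)) +++ (\<lambda>s. K (1, s)))"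
proof -
  have c: "convex ({0..1} \<times> {0..1} :: (real \<times> real) set)" by (intro convex_Times convex_real_interval)
  have "homotopic_paths X (K \<circ> (linepath (0, 0) (0, 1) +++ linepath (0, 1) (1, 1)))
     (K \<circ> (linepath (0, 0) (1, 0) +++ linepath (1, 0) (1, 1)))"
  proof (rule homotopic_paths_push[OF assms c])
    show "path_image (linepath (0, 0) (0, 1) +++ linepath (0, 1) (1, 1)) \<subseteq> {0..1::real} \<times> {0..1::real}"
      "path_image (linepath (0, 0) (1, 0) +++ linepath (1, 0) (1, 1)) \<subseteq> {0..1::real} \<times> {0..1::real}"
      by (intro subset_path_image_join; simp add: closed_segment_subset c)+
  qed auto
  then show ?thesis
    unfolding path_compose_join by (simp add: o_def linepath_def)
qed

definition piece :: "real \<Rightarrow> real \<Rightarrow> (real \<Rightarrow> 'a) \<Rightarrow> real \<Rightarrow> 'a" where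
  "piece a b \<gamma> = (\<lambda>t. \<gamma> ((1 - t) * a + t * b))"

lemma piece_linepath: "piece a b \<gamma> = \<gamma> \<circ> linepath a b"
  by (auto simp: piece_def linepath_def)

lemma piece_01: "piece 0 1 \<gamma> = \<gamma>"
  by (simp add: piece_def)

lemma piece_ends [simp]: "pathstart (piece a b \<gamma>) = \<gamma> a" "pathfinish (piece a b \<gamma>) = \<gamma> b"
  by (auto simp: piece_def pathstart_def pathfinish_def)

lemma path_piece:
  assumes "path \<gamma>" "a \<in> {0..1}" "b \<in> {0..1}"
  shows "path (piece a b \<gamma>)"
  unfolding piece_linepath
  by (rule path_continuous_image)
    (use assms in \<open>auto simp: path_def closed_segment_eq_real_ivl elim!: continuous_on_subset split: if_splits\<close>)

lemma path_image_piece: "a \<le> b \<Longrightarrow> path_image (piece a b \<gamma>) = \<gamma> ` {a..b}"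
  by (simp add: piece_linepath path_image_compose closed_segment_eq_real_ivl)

lemma homotopic_paths_join_pieces:
  assumes "path \<gamma>" "path_image \<gamma> \<subseteq> X" "a \<in> {0..1}" "b \<in> {0..1}" "c \<in> {0..1}"
  shows "homotopic_paths X (piece a b \<gamma> +++ piece b c \<gamma>) (piece a c \<gamma>)"
  unfolding piece_linepath path_compose_join[symmetric]
proof (rule homotopic_paths_push[of "{0..1}"])
  have "closed_segment x y \<subseteq> {0..1}" if "x \<in> {0..1}" "y \<in> {0..1}" for x y :: real
    using that by (intro closed_segment_subset) auto
  then show "path_image (linepath a c) \<subseteq> {0..1}" "path_image (linepath a b +++ linepath b c) \<subseteq> {0..1}"
    using assms by (simp_all add: path_image_join del: atLeastAtMost_iff)
qed (use assms in \<open>auto simp: path_def[of \<gamma>] path_image_def[of \<gamma>]\<close>)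

lemma loops_at_iff: "\<delta> \<in> loops_at X p \<longleftrightarrow> path \<delta> \<and> path_image \<delta> \<subseteq> X \<and> pathstart \<delta> = p \<and> pathfinish \<delta> = p"
  by (simp add: loops_at_def)

context closed_surface
begin

lemma loops_at_image:
  assumes "f \<in> oriented_diffeos" "\<delta> \<in> loops_at X q" shows "f \<circ> \<delta> \<in> loops_at X (f q)"
  using assms oriented_diffeos_continuous[OF assms(1)] unfolding loops_at_iff
  by (auto simp: path_image_compose pathstart_compose pathfinish_compose intro!: path_continuous_image
      intro: continuous_on_subset)

text \<open>In the fundamental groupoid, \<open>f\<close> sends the class of \<delta> to its
  conjugate by \<gamma>. Paths with distinct ends are allowed so that pushes along consecutive
  pieces can be composed, and the relation is written without inverses to avoid
  cancellations.\<close>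

definition pushes :: "(real \<Rightarrow> 'a) \<Rightarrow> ('a \<Rightarrow> 'a) \<Rightarrow> bool" where
  "pushes \<gamma> f \<longleftrightarrow> f \<in> oriented_diffeos \<and> f (pathstart \<gamma>) = pathfinish \<gamma> \<and>
     (\<forall>\<delta>\<in>loops_at X (pathstart \<gamma>). homotopic_paths X (\<delta> +++ \<gamma>) (\<gamma> +++ (f \<circ> \<delta>)))"

lemma pushes_homotopic:
  assumes "pushes \<gamma> f" "homotopic_paths X \<gamma> \<gamma>'" shows "pushes \<gamma>' f"
proof -
  have e: "pathstart \<gamma> = pathstart \<gamma>'" "pathfinish \<gamma> = pathfinish \<gamma>'"
    using assms(2) homotopic_paths_imp_pathstart homotopic_paths_imp_pathfinish by auto
  have "homotopic_paths X (\<delta> +++ \<gamma>') (\<gamma>' +++ (f \<circ> \<delta>))" if d: "\<delta> \<in> loops_at X (pathstart \<gamma>)" for \<delta>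
  proof -
    have "homotopic_paths X (\<delta> +++ \<gamma>') (\<delta> +++ \<gamma>)"
      using d assms(2) by (intro homotopic_paths_join) (auto simp: loops_at_iff homotopic_paths_sym e)
    moreover have "homotopic_paths X (\<delta> +++ \<gamma>) (\<gamma> +++ (f \<circ> \<delta>))"
      using assms(1) d by (simp add: pushes_def)
    moreover have "homotopic_paths X (\<gamma> +++ (f \<circ> \<delta>)) (\<gamma>' +++ (f \<circ> \<delta>))"
      using loops_at_image[of f \<delta> "pathstart \<gamma>"] d assms
      by (intro homotopic_paths_join) (auto simp: loops_at_iff pushes_def)
    ultimately show ?thesis using homotopic_paths_trans by blast
  qed
  then show ?thesis using assms(1) e by (simp add: pushes_def)
qed

text \<open>Two moves: \<delta> passes \<gamma> and becomes \<open>f \<circ> \<delta>\<close>, which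
  passes \<gamma>' and becomes \<open>g \<circ> (f \<circ> \<delta>)\<close>.\<close>

lemma pushes_join:
  assumes f: "pushes \<gamma> f" and g: "pushes \<gamma>' g" and e: "pathfinish \<gamma> = pathstart \<gamma>'"
    and P: "path \<gamma>" "path_image \<gamma> \<subseteq> X" "path \<gamma>'" "path_image \<gamma>' \<subseteq> X"
  shows "pushes (\<gamma> +++ \<gamma>') (compose X g f)"
  unfolding pushes_def
proof (intro conjI ballI)
  have D: "f \<in> oriented_diffeos" "g \<in> oriented_diffeos" using f g by (auto simp: pushes_def)
  then show "compose X g f \<in> oriented_diffeos" by (rule oriented_diffeos_compose)
  have "pathstart \<gamma> \<in> X" using P pathstart_in_path_image by blast
  then show "compose X g f (pathstart (\<gamma> +++ \<gamma>')) = pathfinish (\<gamma> +++ \<gamma>')"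
    using f g e by (simp add: pushes_def compose_def)
  fix \<delta> assume "\<delta> \<in> loops_at X (pathstart (\<gamma> +++ \<gamma>'))"
  then have d: "\<delta> \<in> loops_at X (pathstart \<gamma>)" by simp
  have fd: "f \<circ> \<delta> \<in> loops_at X (pathstart \<gamma>')" using loops_at_image[OF D(1) d] f e by (simp add: pushes_def)
  have gfd: "g \<circ> (f \<circ> \<delta>) \<in> loops_at X (pathfinish \<gamma>')" using loops_at_image[OF D(2) fd] g by (simp add: pushes_def)
  have "homotopic_paths X (\<delta> +++ (\<gamma> +++ \<gamma>')) ((\<delta> +++ \<gamma>) +++ \<gamma>')"
    using d P e by (intro homotopic_paths_assoc) (auto simp: loops_at_iff)
  moreover have "homotopic_paths X ((\<delta> +++ \<gamma>) +++ \<gamma>') ((\<gamma> +++ (f \<circ> \<delta>)) +++ \<gamma>')"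
    by (rule homotopic_paths_join) (use f d P e fd in \<open>auto simp: pushes_def loops_at_iff\<close>)
  moreover have "homotopic_paths X ((\<gamma> +++ (f \<circ> \<delta>)) +++ \<gamma>') (\<gamma> +++ ((f \<circ> \<delta>) +++ \<gamma>'))"
    using fd P e by (intro homotopic_paths_sym[OF homotopic_paths_assoc]) (auto simp: loops_at_iff)
  moreover have "homotopic_paths X (\<gamma> +++ ((f \<circ> \<delta>) +++ \<gamma>')) (\<gamma> +++ (\<gamma>' +++ (g \<circ> (f \<circ> \<delta>))))"
    by (rule homotopic_paths_join) (use g fd P e in \<open>auto simp: pushes_def loops_at_iff\<close>)
  moreover have "homotopic_paths X (\<gamma> +++ (\<gamma>' +++ (g \<circ> (f \<circ> \<delta>)))) ((\<gamma> +++ \<gamma>') +++ (g \<circ> (f \<circ> \<delta>)))"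
    using gfd P e by (intro homotopic_paths_assoc) (auto simp: loops_at_iff)
  ultimately have "homotopic_paths X (\<delta> +++ (\<gamma> +++ \<gamma>')) ((\<gamma> +++ \<gamma>') +++ (g \<circ> (f \<circ> \<delta>)))"
    using homotopic_paths_trans by blast
  moreover have "homotopic_paths X ((\<gamma> +++ \<gamma>') +++ (g \<circ> (f \<circ> \<delta>))) ((\<gamma> +++ \<gamma>') +++ (compose X g f \<circ> \<delta>))"
  proof (intro homotopic_paths_join homotopic_paths_eq)
    show "(g \<circ> (f \<circ> \<delta>)) t = (compose X g f \<circ> \<delta>) t" if "t \<in> {0..1}" for t
      using d that by (auto simp: compose_def loops_at_iff path_image_def image_subset_iff)
  qed (use P e gfd in \<open>auto simp: loops_at_iff intro: subset_path_image_join\<close>)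
  ultimately show "homotopic_paths X (\<delta> +++ (\<gamma> +++ \<gamma>')) ((\<gamma> +++ \<gamma>') +++ (compose X g f \<circ> \<delta>))"
    using homotopic_paths_trans by blast
qed

text \<open>An isotopy from the identity to \<open>f\<close> drags every loop along the track of its
  base point, which is the relation in \<open>pushes\<close> for that track. In a disc each path is
  homotopic to the straight track between its ends, so all paths in the disc are served.\<close>

lemma local_push:
  assumes x: "x \<in> X"
  shows "\<exists>W. openin (top_of_set X) W \<and> x \<in> W \<and>
    (\<forall>\<gamma>. path \<gamma> \<longrightarrow> path_image \<gamma> \<subseteq> W \<longrightarrow> (\<exists>f. pushes \<gamma> f))"
proof -
  obtain U \<phi> where U: "(U, \<phi>) \<in> A" "x \<in> U" using chart_ex x by blast
  define z where "z = \<phi> x"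
  obtain r where r: "r > 0" "cball z r \<subseteq> \<phi> ` U"
    using open_contains_cball[of "\<phi> ` U"] chart_open[OF U(1)] U(2) by (auto simp: z_def)
  obtain b d where bd: "d > 0" "d < r" "\<And>y. y \<notin> cball z r \<Longrightarrow> b y = (0::real)"
    "\<And>q. q \<in> ball z d \<Longrightarrow> b q \<noteq> 0"
    "\<And>q q' t. q \<in> ball z d \<Longrightarrow> q' \<in> ball z d \<Longrightarrow> 0 \<le> t \<Longrightarrow> t \<le> 1 \<Longrightarrow> plane_push b (t *\<^sub>R ((q' - q) /\<^sub>R b q))"
    using plane_push_exists[OF r(1), of z] by metis
  define W where "W = U \<inter> \<phi> -` ball z d"
  have "\<exists>f. pushes \<gamma> f" if \<gamma>: "path \<gamma>" "path_image \<gamma> \<subseteq> W" for \<gamma>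
  proof -
    define q q' where "q = \<phi> (pathstart \<gamma>)" and "q' = \<phi> (pathfinish \<gamma>)"
    have sW: "pathstart \<gamma> \<in> W" "pathfinish \<gamma> \<in> W" using \<gamma> by auto
    then have qq: "q \<in> ball z d" "q' \<in> ball z d" by (auto simp: W_def q_def q'_def)
    define v where "v t = t *\<^sub>R ((q' - q) /\<^sub>R b q)" for t :: real
    define h where "h t = plane_push.h b (v t)" for t
    have pp: "plane_push b (v t)" if "t \<in> {0..1}" for t using bd(5)[OF qq] that by (simp add: v_def)
    have h: "h t y = y + b y *\<^sub>R v t" if "t \<in> {0..1}" for t y
      using plane_push.h_def[OF pp[OF that]] by (simp add: h_def)
    have hC: "h t y = y" if "t \<in> {0..1}" "y \<notin> cball z r" for t y using h that bd(3) by simp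
    have bij: "bij (h t)" if "t \<in> {0..1}" for t unfolding h_def by (rule plane_push.bij_h[OF pp[OF that]])
    \<comment> \<open>The bijection \<open>h t\<close> fixes the complement of the chart image
      pointwise, hence it preserves the image.\<close>
    have hU: "h t ` \<phi> ` U = \<phi> ` U" if t: "t \<in> {0..1}" for t
    proof -
      have "h t y = y" if "y \<in> - (\<phi> ` U)" for y using hC[OF t, of y] r(2) that by blast
      then have "h t ` (- (\<phi> ` U)) = (\<lambda>y. y) ` (- (\<phi> ` U))" by (intro image_cong) auto
      then have "h t ` (- (\<phi> ` U)) = - (\<phi> ` U)" by simp
      then show ?thesis using bij_image_Compl_eq[OF bij[OF t], of "\<phi> ` U"] by (metis double_complement)
    qed
    define f where "f = restrict (extend_by_id U \<phi> (h 1)) X"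
    define k where "k = inv_into UNIV (h 1)"
    have kh: "k (h 1 y) = y" "h 1 (k y) = y" for y
      using bij[of 1] by (auto simp: k_def bij_is_surj surj_f_inv_f bij_is_inj)
    have kC: "k y = y" if "y \<notin> cball z r" for y using hC[of 1 y] that kh(1)[of y] by simp
    have kU: "k ` \<phi> ` U = \<phi> ` U"
    proof -
      have "k ` (h 1 ` \<phi> ` U) = \<phi> ` U" by (simp add: image_image kh(1))
      then show ?thesis by (simp add: hU)
    qed
    have e1: "extend_by_id U \<phi> k (extend_by_id U \<phi> (h 1) y) = y" "extend_by_id U \<phi> (h 1) (extend_by_id U \<phi> k y) = y"
      if "y \<in> X" for y
    proof -
      have "h 1 (\<phi> y) \<in> \<phi> ` U" "k (\<phi> y) \<in> \<phi> ` U" if "y \<in> U" using hU[of 1] kU that by auto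
      then show "extend_by_id U \<phi> k (extend_by_id U \<phi> (h 1) y) = y" "extend_by_id U \<phi> (h 1) (extend_by_id U \<phi> k y) = y"
        by (auto simp: extend_by_id_def f_inv_into_f inv_into_into kh chart_inv[OF U(1)])
    qed
    have "oriented_smooth_on UNIV (h 1)" "oriented_smooth_on UNIV k"
      using plane_push.oriented_smooth_h[OF pp[of 1]] plane_push.oriented_smooth_inv_h[OF pp[of 1]]
      by (simp_all add: h_def k_def)
    then have osm: "oriented_smooth_map (extend_by_id U \<phi> (h 1))" "oriented_smooth_map (extend_by_id U \<phi> k)"
      using extend_by_id_oriented_smooth[OF U(1) compact_cball r(2), of "h 1"]
        extend_by_id_oriented_smooth[OF U(1) compact_cball r(2), of k] hU[of 1] kU hC[of 1] kC by simp_all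
    then have im: "extend_by_id U \<phi> (h 1) ` X \<subseteq> X" "extend_by_id U \<phi> k ` X \<subseteq> X" by (auto simp: oriented_smooth_map_def)
    have bf: "bij_betw f X X"
      by (rule bij_betw_byWitness[where f' = "extend_by_id U \<phi> k"]) (use im e1 in \<open>auto simp: f_def\<close>)
    have inv: "inv_into X f y = extend_by_id U \<phi> k y" if "y \<in> X" for y
      by (rule inv_into_f_eq) (use bf that e1 im in \<open>auto simp: f_def bij_betw_def\<close>)
    have fD: "f \<in> oriented_diffeos"
      unfolding oriented_diffeos_def
      using bf oriented_smooth_map_cong[OF _ osm(1), of f] oriented_smooth_map_cong[OF _ osm(2), of "inv_into X f"] inv
      by (auto simp: Bij_def f_def)
    define H where "H = (\<lambda>(t, x). extend_by_id U \<phi> (h t) x)"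
    have cH: "continuous_on ({0..1} \<times> X) H"
      unfolding H_def
    proof (rule extend_by_id_continuous[OF U(1) compact_cball r(2)])
      have "smooth_on UNIV b" using pp[of 1] by (simp add: plane_push_def)
      then have cb: "continuous_on UNIV b" by (rule smooth_on_continuous_on)
      have "continuous_on ({0..1} \<times> UNIV) (\<lambda>w. snd w + b (snd w) *\<^sub>R v (fst w))"
        unfolding v_def by (intro continuous_intros continuous_on_compose2[OF cb]) auto
      then show "continuous_on ({0..1} \<times> UNIV) (\<lambda>(t, y). h t y)"
        by (rule continuous_on_eq) (auto simp: h)
    qed (use hU hC in auto)
    have HX: "H (t, y) \<in> X" if "t \<in> {0..1}" "y \<in> X" for t y
      using that hU[OF that(1)] chart_subset[OF U(1)] inv_into_into[of _ \<phi> U]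
      by (auto simp: H_def extend_by_id_def)
    have H0: "H (0, y) = y" for y using chart_inv[OF U(1)] by (simp add: H_def extend_by_id_def h v_def)
    have Hq: "H (t, pathstart \<gamma>) = inv_into U \<phi> (linepath q q' t)" if "t \<in> {0..1}" for t
    proof -
      have "h t q = linepath q q' t"
        using h[OF that, of q] bd(4)[OF qq(1)] by (simp add: v_def linepath_def algebra_simps)
      then show ?thesis using sW(1) by (simp add: H_def extend_by_id_def W_def q_def)
    qed
    have sqX: "pathstart \<gamma> \<in> X" using sW chart_subset[OF U(1)] by (auto simp: W_def)
    have "pushes (\<lambda>t. H (t, pathstart \<gamma>)) f"
      unfolding pushes_def
    proof (intro conjI ballI fD)
      have "q' = \<phi> (pathfinish \<gamma>)" by (simp add: q'_def)
      then show "f (pathstart (\<lambda>t. H (t, pathstart \<gamma>))) = pathfinish (\<lambda>t. H (t, pathstart \<gamma>))"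
        using sqX H0 by (simp add: pathstart_def pathfinish_def) (simp add: H_def f_def)
      fix \<delta> assume d: "\<delta> \<in> loops_at X (pathstart (\<lambda>t. H (t, pathstart \<gamma>)))"
      then have \<delta>: "path \<delta>" "path_image \<delta> \<subseteq> X" "\<delta> 0 = pathstart \<gamma>" "\<delta> 1 = pathstart \<gamma>"
        using H0 by (auto simp: loops_at_iff pathstart_def pathfinish_def)
      have dX: "\<delta> s \<in> X" if "s \<in> {0..1}" for s using \<delta>(2) that by (auto simp: path_image_def)
      \<comment> \<open>The square is H (t, \<delta> s): two of its sides are \<delta> and the image
        of \<delta> under \<open>f\<close>, the other two are the track of the base point.\<close>
      have "homotopic_paths X ((\<lambda>s. H (0, \<delta> s)) +++ (\<lambda>t. H (t, \<delta> 1))) ((\<lambda>t. H (t, \<delta> 0)) +++ (\<lambda>s. H (1, \<delta> s)))"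
      proof (rule homotopic_paths_square[of "\<lambda>z. H (fst z, \<delta> (snd z))", simplified])
        have cd: "continuous_on ({0..1} \<times> {0..1}) (\<lambda>z::real \<times> real. (fst z, \<delta> (snd z)))"
          by (intro continuous_on_Pair continuous_on_fst continuous_on_id
              continuous_on_compose2[OF \<delta>(1)[unfolded path_def] continuous_on_snd[OF continuous_on_id]]) auto
        show "continuous_on ({0..1} \<times> {0..1}) (\<lambda>z. H (fst z, \<delta> (snd z)))"
          by (rule continuous_on_compose2[OF cH cd]) (use dX in auto)
        show "(\<lambda>z. H (fst z, \<delta> (snd z))) ` ({0..1} \<times> {0..1}) \<subseteq> X" using HX dX by auto
      qed
      then have "homotopic_paths X (\<delta> +++ (\<lambda>t. H (t, pathstart \<gamma>))) ((\<lambda>t. H (t, pathstart \<gamma>)) +++ (\<lambda>s. H (1, \<delta> s)))"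
        using \<delta>(3,4) by (simp add: H0)
      moreover have "homotopic_paths X ((\<lambda>t. H (t, pathstart \<gamma>)) +++ (\<lambda>s. H (1, \<delta> s))) ((\<lambda>t. H (t, pathstart \<gamma>)) +++ (f \<circ> \<delta>))"
      proof (rule homotopic_paths_eq)
        show "path ((\<lambda>t. H (t, pathstart \<gamma>)) +++ (\<lambda>s. H (1, \<delta> s)))"
          "path_image ((\<lambda>t. H (t, pathstart \<gamma>)) +++ (\<lambda>s. H (1, \<delta> s))) \<subseteq> X"
          using calculation homotopic_paths_imp_path homotopic_paths_imp_subset by blast+
        show "((\<lambda>t. H (t, pathstart \<gamma>)) +++ (\<lambda>s. H (1, \<delta> s))) t = ((\<lambda>t. H (t, pathstart \<gamma>)) +++ (f \<circ> \<delta>)) t"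
          if "t \<in> {0..1}" for t
          using that dX[of "2 * t - 1"] by (auto simp: joinpaths_def f_def H_def)
      qed
      ultimately show "homotopic_paths X (\<delta> +++ (\<lambda>t. H (t, pathstart \<gamma>))) ((\<lambda>t. H (t, pathstart \<gamma>)) +++ (f \<circ> \<delta>))"
        using homotopic_paths_trans by blast
    qed
    moreover have "homotopic_paths X (\<lambda>t. H (t, pathstart \<gamma>)) \<gamma>"
    proof -
      have bU: "ball z d \<subseteq> \<phi> ` U" using bd(2) r(2) by (auto simp: subset_iff)
      have "homotopic_paths X (inv_into U \<phi> \<circ> linepath q q') (inv_into U \<phi> \<circ> (\<phi> \<circ> \<gamma>))"
      proof (rule homotopic_paths_push[of "ball z d"])
        show "continuous_on (ball z d) (inv_into U \<phi>)"
          by (rule continuous_on_subset[OF chart_continuous(2)[OF U(1)] bU])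
        show "inv_into U \<phi> ` ball z d \<subseteq> X"
          using bU chart_subset[OF U(1)] inv_into_into[of _ \<phi> U] by blast
        show "path (\<phi> \<circ> \<gamma>)"
          by (rule path_continuous_image[OF \<gamma>(1) continuous_on_subset[OF chart_continuous(1)[OF U(1)]]])
            (use \<gamma>(2) in \<open>auto simp: W_def\<close>)
        show "path_image (\<phi> \<circ> \<gamma>) \<subseteq> ball z d" using \<gamma>(2) by (auto simp: W_def path_image_compose)
        show "path_image (linepath q q') \<subseteq> ball z d" using qq by (simp add: closed_segment_subset)
      qed (auto simp: q_def q'_def pathstart_compose pathfinish_compose)
      then have hp: "homotopic_paths X (inv_into U \<phi> \<circ> linepath q q') (inv_into U \<phi> \<circ> (\<phi> \<circ> \<gamma>))" .
      have "homotopic_paths X (inv_into U \<phi> \<circ> linepath q q') (\<lambda>t. H (t, pathstart \<gamma>))"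
        by (rule homotopic_paths_eq)
          (use homotopic_paths_imp_path[OF hp] homotopic_paths_imp_subset[OF hp] Hq in auto)
      moreover have "homotopic_paths X (inv_into U \<phi> \<circ> (\<phi> \<circ> \<gamma>)) \<gamma>"
      proof (rule homotopic_paths_eq)
        show "(inv_into U \<phi> \<circ> (\<phi> \<circ> \<gamma>)) t = \<gamma> t" if "t \<in> {0..1}" for t
          using \<gamma>(2) that chart_inv[OF U(1), of "\<gamma> t"] by (auto simp: W_def path_image_def image_subset_iff)
      qed (use homotopic_paths_imp_path[OF hp] homotopic_paths_imp_subset[OF hp] in auto)
      ultimately show ?thesis using hp homotopic_paths_trans homotopic_paths_sym by blast
    qed
    ultimately show ?thesis using pushes_homotopic by blast
  qed
  moreover have "openin (top_of_set X) W" unfolding W_def by (rule openin_chart_preimage[OF U(1)]) simp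
  moreover have "x \<in> W" using U bd(1) by (simp add: W_def z_def)
  ultimately show ?thesis by blast
qed

text \<open>Bisection: the claim for subintervals is additive by \<open>pushes_join\<close> and
  holds on short ones by \<open>local_push\<close>, hence it holds on the unit interval.\<close>

lemma push_exists:
  assumes \<gamma>: "path \<gamma>" "path_image \<gamma> \<subseteq> X"
  shows "\<exists>f. pushes \<gamma> f"
proof -
  define P where "P a b \<longleftrightarrow> (0 \<le> a \<longrightarrow> b \<le> 1 \<longrightarrow> (\<exists>f. pushes (piece a b \<gamma>) f))" for a b
  have im: "path_image (piece a b \<gamma>) \<subseteq> X" if "0 \<le> a" "a \<le> b" "b \<le> 1" for a b
    unfolding path_image_piece[OF that(2)] using \<gamma>(2) that by (auto simp: path_image_def)
  have "(0::real) \<le> 1" by simp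
  then have "P 0 1"
  proof (induction rule: Bolzano)
    case (trans a b c)
    show ?case
      unfolding P_def
    proof (intro impI)
      assume ac: "0 \<le> a" "c \<le> 1"
      obtain f g where "pushes (piece a b \<gamma>) f" "pushes (piece b c \<gamma>) g"
        using trans ac unfolding P_def by (meson order_trans)
      then have "pushes (piece a b \<gamma> +++ piece b c \<gamma>) (compose X g f)"
        by (rule pushes_join) (use trans ac \<gamma> im in \<open>auto intro: path_piece\<close>)
      then have "pushes (piece a c \<gamma>) (compose X g f)"
        by (rule pushes_homotopic) (use trans ac \<gamma> in \<open>auto intro: homotopic_paths_join_pieces\<close>)
      then show "\<exists>f. pushes (piece a c \<gamma>) f" by blast
    qed
  next
    case (local t)
    then have "\<gamma> t \<in> X" using \<gamma>(2) by (auto simp: path_image_def)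
    then obtain W where W: "openin (top_of_set X) W" "\<gamma> t \<in> W"
       "\<And>\<gamma>. path \<gamma> \<Longrightarrow> path_image \<gamma> \<subseteq> W \<Longrightarrow> \<exists>f. pushes \<gamma> f"
      using local_push by metis
    have "openin (top_of_set {0..1}) ({0..1} \<inter> \<gamma> -` W)"
      by (rule continuous_openin_preimage[OF _ _ W(1)]) (use \<gamma> in \<open>auto simp: path_def path_image_def\<close>)
    moreover have "t \<in> {0..1} \<inter> \<gamma> -` W" using local W(2) by simp
    ultimately obtain d where d: "d > 0" "\<And>s. s \<in> {0..1} \<Longrightarrow> dist s t < d \<Longrightarrow> \<gamma> s \<in> W"
      unfolding openin_euclidean_subtopology_iff by blast
    have "P a b" if "a \<le> t \<and> t \<le> b \<and> b - a < d" for a b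
      unfolding P_def
    proof (intro impI)
      assume "0 \<le> a" "b \<le> 1"
      then have "path_image (piece a b \<gamma>) \<subseteq> W"
        using that d(2) by (auto simp: path_image_piece dist_real_def)
      then show "\<exists>f. pushes (piece a b \<gamma>) f"
        using W(3) path_piece[OF \<gamma>(1)] that \<open>0 \<le> a\<close> \<open>b \<le> 1\<close> by auto
    qed
    then show ?case using d(1) by blast
  qed
  then show ?thesis by (simp add: P_def piece_01)
qed

end

section \<open>Path functionals from the first homology group\<close>

text \<open>Homotopy invariance reduces this to the vanishing of the first homology of a
  point.\<close>

lemma contractible_cycle_boundary:
  assumes "contractible S" "singular_relcycle 1 (top_of_set S) {} c"
  shows "singular_relboundary 1 (top_of_set S) {} c"
\<comment> \<open>The empty set counts as contractible; there all chains vanish.\<close>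
proof (cases "S = {}")
  case True
  then have "singular_chain 1 (top_of_set S) c" using assms(2) by (simp add: singular_cycle)
  then have "c = 0" using True by (simp add: singular_chain_empty)
  then show ?thesis by simp
next
  case False
  then obtain a where a: "top_of_set S homotopy_equivalent_space subtopology (top_of_set S) {a}" "a \<in> S"
    using assms(1) contractible_eq_homotopy_equivalent_singleton_subtopology[of "top_of_set S"]
    by (metis (no_types, lifting) contractible_space_top_of_set null_topspace_iff_trivial topspace_euclidean_subtopology)
  have "trivial_group (homology_group 1 (subtopology (top_of_set S) {a}))"
    using a(2) by (intro homology_dimension_axiom[of _ a]) auto
  then have "trivial_group (homology_group 1 (top_of_set S))"
    using isomorphic_group_triviality[OF homotopy_equivalent_space_imp_isomorphic_homology_groups[OF a(1), of 1]] by simp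
  then have "carrier (homology_group (int 1) (top_of_set S)) = {singular_relboundary_set 1 (top_of_set S) {}}"
    unfolding trivial_group_def by (metis of_nat_1 one_relative_homology_group)
  moreover have "homologous_rel_set 1 (top_of_set S) {} c \<in> carrier (homology_group (int 1) (top_of_set S))"
    unfolding carrier_relative_homology_group using assms(2) by blast
  ultimately have "homologous_rel_set 1 (top_of_set S) {} c = singular_relboundary_set 1 (top_of_set S) {}"
    by (simp only: singleton_iff)
  then show ?thesis by (simp only: homologous_rel_set_eq_relboundary)
qed

text \<open>A path as a singular 1-simplex, with the barycentric coordinate \<open>x 1\<close> as
  parameter. The restriction is there because singular simplices are extensional functions.\<close>

definition seg :: "(real \<Rightarrow> 'a) \<Rightarrow> ((nat \<Rightarrow> real) \<Rightarrow> 'a) \<Rightarrow>\<^sub>0 int" where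
  "seg \<gamma> = frag_of (restrict (\<lambda>x. \<gamma> (x 1)) (standard_simplex 1))"

definition vertex_chain :: "'a \<Rightarrow> ((nat \<Rightarrow> real) \<Rightarrow> 'a) \<Rightarrow>\<^sub>0 int" where
  "vertex_chain z = frag_of (restrict (\<lambda>_. z) (standard_simplex 0))"

lemma chain_boundary_seg: "chain_boundary 1 (seg \<gamma>) = vertex_chain (\<gamma> 1) - vertex_chain (\<gamma> 0)"
proof -
  have s: "simplical_face k x \<in> standard_simplex (Suc 0)" if "k \<le> Suc 0" "x \<in> standard_simplex 0" for k and x :: "nat \<Rightarrow> real"
    using simplical_face_in_standard_simplex[of "Suc 0" k x] that by simp
  have "singular_face (Suc 0) 0 (restrict (\<lambda>x. \<gamma> (x (Suc 0))) (standard_simplex (Suc 0))) = restrict (\<lambda>_. \<gamma> 1) (standard_simplex 0)"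
    unfolding singular_face_def using s[of 0]
    by (intro ext) (auto simp: restrict_def simplical_face_def standard_simplex_0)
  moreover have "singular_face (Suc 0) (Suc 0) (restrict (\<lambda>x. \<gamma> (x (Suc 0))) (standard_simplex (Suc 0))) = restrict (\<lambda>_. \<gamma> 0) (standard_simplex 0)"
    unfolding singular_face_def using s[of "Suc 0"]
    by (intro ext) (auto simp: restrict_def simplical_face_def standard_simplex_0)
  ultimately show ?thesis
    by (simp add: seg_def vertex_chain_def chain_boundary_of)
qed

lemma singular_simplex_path:
  assumes "path \<gamma>" "path_image \<gamma> \<subseteq> X"
  shows "singular_simplex 1 (top_of_set X) (restrict (\<lambda>x. \<gamma> (x 1)) (standard_simplex 1))"
proof -
  have "continuous_map (subtopology (powertop_real UNIV) (standard_simplex 1)) (top_of_set {0..1}) (\<lambda>x. x 1)"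
    by (auto simp: continuous_map_in_subtopology standard_simplex_def
        intro!: continuous_map_from_subtopology continuous_map_product_projection[of _ UNIV "\<lambda>_. euclideanreal", simplified])
  moreover have "continuous_map (top_of_set {0..1}) (top_of_set X) \<gamma>"
    using assms by (auto simp: path_def path_image_def)
  ultimately have "continuous_map (subtopology (powertop_real UNIV) (standard_simplex 1)) (top_of_set X) (\<gamma> \<circ> (\<lambda>x. x 1))"
    by (rule continuous_map_compose)
  then show ?thesis
    unfolding singular_simplex_def by (auto simp: o_def elim: continuous_map_eq)
qed

lemma singular_chain_seg: "path \<gamma> \<Longrightarrow> path_image \<gamma> \<subseteq> X \<Longrightarrow> singular_chain 1 (top_of_set X) (seg \<gamma>)"
  unfolding seg_def singular_chain_of by (rule singular_simplex_path)

lemma chain_map_seg: "chain_map 1 K (seg \<gamma>) = seg (K \<circ> \<gamma>)"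
  unfolding seg_def chain_map_of simplex_map_def
  by (intro arg_cong[where f = frag_of]) (auto simp: fun_eq_iff restrict_def)

text \<open>The three sides form a cycle in the convex parameter set, where every 1-cycle bounds;
  the chain map of \<open>K\<close> transfers this to \<open>X\<close>.\<close>

lemma seg_triangle:
  fixes K :: "'b::real_normed_vector \<Rightarrow> 'a::topological_space"
  assumes "continuous_on S K" "K ` S \<subseteq> X" "convex S"
    and "path p" "path_image p \<subseteq> S" "path q" "path_image q \<subseteq> S" "path r" "path_image r \<subseteq> S"
    and "pathstart p = pathstart r" "pathfinish p = pathstart q" "pathfinish q = pathfinish r"
  shows "singular_relboundary 1 (top_of_set X) {} (seg (K \<circ> p) + seg (K \<circ> q) - seg (K \<circ> r))"
proof -
  have "singular_relcycle 1 (top_of_set S) {} (seg p + seg q - seg r)"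
    unfolding singular_cycle
    using assms
    by (auto intro!: singular_chain_diff singular_chain_add singular_chain_seg[unfolded One_nat_def]
        simp: chain_boundary_diff chain_boundary_add chain_boundary_seg[unfolded One_nat_def] pathstart_def pathfinish_def)
  then have "singular_relboundary 1 (top_of_set S) {} (seg p + seg q - seg r)"
    by (rule contractible_cycle_boundary[OF convex_imp_contractible[OF assms(3)]])
  then have "singular_relboundary 1 (top_of_set X) {} (chain_map 1 K (seg p + seg q - seg r))"
    by (rule singular_relboundary_chain_map) (use assms in auto)
  then show ?thesis by (simp only: chain_map_diff chain_map_add chain_map_seg)
qed

text \<open>A functor from the fundamental groupoid of \<open>X\<close> to a group. The group may be
  noncommutative, so that real periods and Heisenberg holonomies are both of this kind.\<close>

definition path_functional :: "'a::topological_space set \<Rightarrow> ((real \<Rightarrow> 'a) \<Rightarrow> 'h::group_add) \<Rightarrow> bool" where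
  "path_functional X F \<longleftrightarrow>
     (\<forall>\<gamma> \<delta>. path \<gamma> \<longrightarrow> path_image \<gamma> \<subseteq> X \<longrightarrow> path \<delta> \<longrightarrow> path_image \<delta> \<subseteq> X \<longrightarrow> pathfinish \<gamma> = pathstart \<delta> \<longrightarrow>
        F (\<gamma> +++ \<delta>) = F \<gamma> + F \<delta>) \<and>
     (\<forall>\<gamma> \<delta>. homotopic_paths X \<gamma> \<delta> \<longrightarrow> F \<gamma> = F \<delta>)"

lemma path_functional_join:
  "path_functional X F \<Longrightarrow> path \<gamma> \<Longrightarrow> path_image \<gamma> \<subseteq> X \<Longrightarrow> path \<delta> \<Longrightarrow> path_image \<delta> \<subseteq> X \<Longrightarrow>
    pathfinish \<gamma> = pathstart \<delta> \<Longrightarrow> F (\<gamma> +++ \<delta>) = F \<gamma> + F \<delta>"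
  by (simp add: path_functional_def)

lemma path_functional_homotopic: "path_functional X F \<Longrightarrow> homotopic_paths X \<gamma> \<delta> \<Longrightarrow> F \<gamma> = F \<delta>"
  by (simp add: path_functional_def)

definition base_path :: "'a::topological_space set \<Rightarrow> 'a \<Rightarrow> 'a \<Rightarrow> real \<Rightarrow> 'a" where
  "base_path X p z = (SOME s. path s \<and> path_image s \<subseteq> X \<and> pathstart s = p \<and> pathfinish s = z)"

lemma base_path:
  assumes "path_connected X" "p \<in> X" "z \<in> X"
  shows "path (base_path X p z)" "path_image (base_path X p z) \<subseteq> X" "base_path X p z 0 = p" "base_path X p z 1 = z"
proof -
  have "\<exists>s. path s \<and> path_image s \<subseteq> X \<and> pathstart s = p \<and> pathfinish s = z"
    using assms by (simp add: path_connected_def)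
  from someI_ex[OF this] show "path (base_path X p z)" "path_image (base_path X p z) \<subseteq> X"
    "base_path X p z 0 = p" "base_path X p z 1 = z"
    by (auto simp: base_path_def pathstart_def pathfinish_def)
qed

text \<open>Closing up by chosen paths to the two ends allows a functional on cycles to be evaluated
  on any path. On a loop the two base paths cancel.\<close>

definition based_cycle :: "'a::topological_space set \<Rightarrow> 'a \<Rightarrow> (real \<Rightarrow> 'a) \<Rightarrow> ((nat \<Rightarrow> real) \<Rightarrow> 'a) \<Rightarrow>\<^sub>0 int" where
  "based_cycle X p \<gamma> = seg \<gamma> + seg (base_path X p (\<gamma> 0)) - seg (base_path X p (\<gamma> 1))"

lemma path_ends_in:
  assumes "path_image \<gamma> \<subseteq> X" shows "\<gamma> 0 \<in> X" "\<gamma> 1 \<in> X"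
  using assms by (auto simp: path_image_def image_subset_iff)

lemma based_cycle:
  assumes "path_connected X" "p \<in> X" "path \<gamma>" "path_image \<gamma> \<subseteq> X"
  shows "singular_relcycle 1 (top_of_set X) {} (based_cycle X p \<gamma>)"
  unfolding singular_cycle based_cycle_def
  using assms base_path[OF assms(1,2)] path_ends_in[OF assms(4)]
  by (auto intro!: singular_chain_diff singular_chain_add singular_chain_seg[unfolded One_nat_def]
        simp: chain_boundary_diff chain_boundary_add chain_boundary_seg[unfolded One_nat_def])

text \<open>A homomorphism from the first homology group to the integers, given on representing
  cycles.\<close>

locale homology_functional =
  fixes X :: "'a::topological_space set" and p :: 'a and \<xi> :: "(((nat \<Rightarrow> real) \<Rightarrow> 'a) \<Rightarrow>\<^sub>0 int) \<Rightarrow> int"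
  assumes pc: "path_connected X" and p: "p \<in> X"
    and add: "\<And>a b. singular_relcycle 1 (top_of_set X) {} a \<Longrightarrow> singular_relcycle 1 (top_of_set X) {} b \<Longrightarrow> \<xi> (a + b) = \<xi> a + \<xi> b"
    and boundary: "\<And>a. singular_relboundary 1 (top_of_set X) {} a \<Longrightarrow> \<xi> a = 0"
begin

lemma chi_diff:
  assumes "singular_relcycle 1 (top_of_set X) {} a" "singular_relcycle 1 (top_of_set X) {} b"
  shows "\<xi> (a - b) = \<xi> a - \<xi> b"
  using add[of "a - b" b] assms singular_relcycle_diff by fastforce

definition F :: "(real \<Rightarrow> 'a) \<Rightarrow> real" where
  "F \<gamma> = of_int (\<xi> (based_cycle X p \<gamma>))"

text \<open>The base paths of the three cycles cancel in pairs, and what remains bounds by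
  \<open>seg_triangle\<close>. Constant paths, joins, reversal and homotopies are all handled by
  suitable choices of \<open>K\<close> and of the triangle.\<close>

lemma F_triangle:
  fixes K :: "'b::real_normed_vector \<Rightarrow> 'a"
  assumes "continuous_on S K" "K ` S \<subseteq> X" "convex S"
    and "path q" "path_image q \<subseteq> S" "path q'" "path_image q' \<subseteq> S" "path r" "path_image r \<subseteq> S"
    and "pathstart q = pathstart r" "pathfinish q = pathstart q'" "pathfinish q' = pathfinish r"
  shows "F (K \<circ> q) + F (K \<circ> q') = F (K \<circ> r)"
proof -
  have P: "path (K \<circ> s) \<and> path_image (K \<circ> s) \<subseteq> X" if "path s" "path_image s \<subseteq> S" for s
    using that assms(1,2) by (auto simp: path_image_compose intro!: path_continuous_image intro: continuous_on_subset)
  have "based_cycle X p (K \<circ> q) + based_cycle X p (K \<circ> q') - based_cycle X p (K \<circ> r) = seg (K \<circ> q) + seg (K \<circ> q') - seg (K \<circ> r)"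
    using assms(10-12) by (simp add: based_cycle_def pathstart_def pathfinish_def)
  moreover have "\<xi> (seg (K \<circ> q) + seg (K \<circ> q') - seg (K \<circ> r)) = 0"
    by (rule boundary[OF seg_triangle[OF assms]])
  moreover have "\<xi> (based_cycle X p (K \<circ> q) + based_cycle X p (K \<circ> q') - based_cycle X p (K \<circ> r)) =
     \<xi> (based_cycle X p (K \<circ> q)) + \<xi> (based_cycle X p (K \<circ> q')) - \<xi> (based_cycle X p (K \<circ> r))"
  proof -
    have c: "singular_relcycle 1 (top_of_set X) {} (based_cycle X p (K \<circ> s))" if "path s" "path_image s \<subseteq> S" for s
      using P[OF that] based_cycle[OF pc p] by blast
    show ?thesis
      using chi_diff[OF singular_relcycle_add[OF c[OF assms(4,5)] c[OF assms(6,7)]] c[OF assms(8,9)]]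
        add[OF c[OF assms(4,5)] c[OF assms(6,7)]] by simp
  qed
  ultimately show ?thesis by (simp add: F_def)
qed

lemma F_const: "c \<in> X \<Longrightarrow> F (\<lambda>_. c) = 0"
  using F_triangle[of "UNIV :: real set" "\<lambda>_. c" "linepath 0 0" "linepath 0 0" "linepath 0 0"]
  by (auto simp: o_def)

lemma F_cong:
  assumes "\<And>t. t \<in> {0..1} \<Longrightarrow> \<gamma> t = \<delta> t" shows "F \<gamma> = F \<delta>"
proof -
  have "seg \<gamma> = seg \<delta>"
    unfolding seg_def by (intro arg_cong[where f = frag_of] restrict_ext assms) (auto simp: standard_simplex_def)
  then show ?thesis using assms[of 0] assms[of 1] by (simp add: F_def based_cycle_def)
qed

lemma F_join:
  assumes "path \<gamma>" "path_image \<gamma> \<subseteq> X" "path \<delta>" "path_image \<delta> \<subseteq> X" "pathfinish \<gamma> = pathstart \<delta>"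
  shows "F (\<gamma> +++ \<delta>) = F \<gamma> + F \<delta>"
proof -
  have c: "path (\<gamma> +++ \<delta>)" "path_image (\<gamma> +++ \<delta>) \<subseteq> X" using assms by (simp_all add: path_image_join)
  have "F ((\<gamma> +++ \<delta>) \<circ> linepath 0 (1/2)) + F ((\<gamma> +++ \<delta>) \<circ> linepath (1/2) 1) = F ((\<gamma> +++ \<delta>) \<circ> linepath 0 1)"
    by (rule F_triangle[of "{0..1}"])
      (use c in \<open>auto simp: path_def[of "\<gamma> +++ \<delta>"] path_image_def[of "\<gamma> +++ \<delta>"] closed_segment_eq_real_ivl\<close>)
  moreover have "F ((\<gamma> +++ \<delta>) \<circ> linepath 0 (1/2)) = F \<gamma>"
    by (rule F_cong) (auto simp: joinpaths_def linepath_def)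
  moreover have "F ((\<gamma> +++ \<delta>) \<circ> linepath (1/2) 1) = F \<delta>"
  proof (rule F_cong)
    fix t :: real assume t: "t \<in> {0..1}"
    have "((\<gamma> +++ \<delta>) \<circ> linepath (1/2) 1) t = (\<gamma> +++ \<delta>) ((1 + t) / 2)"
      unfolding o_def by (rule arg_cong[where f = "\<gamma> +++ \<delta>"]) (simp add: linepath_def field_simps)
    also have "\<dots> = \<delta> (2 * ((1 + t) / 2) - 1)"
      using assms(5) t by (auto simp: joinpaths_def pathfinish_def pathstart_def)
    also have "2 * ((1 + t) / 2) - 1 = t" by (simp add: field_simps)
    finally show "((\<gamma> +++ \<delta>) \<circ> linepath (1/2) 1) t = \<delta> t" .
  qed
  moreover have "(\<gamma> +++ \<delta>) \<circ> linepath 0 1 = \<gamma> +++ \<delta>" by (auto simp: linepath_def)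
  ultimately show ?thesis by simp
qed

text \<open>The square of the homotopy is cut along its diagonal into two triangles; the sides
  traced by the fixed ends are constant and contribute 0.\<close>

lemma F_homotopic:
  assumes "homotopic_paths X \<gamma> \<delta>" shows "F \<gamma> = F \<delta>"
proof -
  obtain K where K: "continuous_on ({0..1} \<times> {0..1}) K" "K \<in> {0..1} \<times> {0..1} \<rightarrow> X"
    "\<forall>x\<in>{0..1}. K (0, x) = \<gamma> x" "\<forall>x\<in>{0..1}. K (1, x) = \<delta> x"
    "\<forall>t\<in>{0..1::real}. pathstart (K \<circ> Pair t) = pathstart \<gamma>"
    "\<forall>t\<in>{0..1::real}. pathfinish (K \<circ> Pair t) = pathfinish \<gamma>"
    using assms unfolding homotopic_paths by blast
  have c: "convex ({0..1} \<times> {0..1} :: (real \<times> real) set)" by (intro convex_Times convex_real_interval)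
  have KX: "K ` ({0..1} \<times> {0..1}) \<subseteq> X" using K(2) by auto
  have g: "\<gamma> 0 \<in> X" "\<gamma> 1 \<in> X" using homotopic_paths_imp_subset[OF assms] path_ends_in by auto
  have "F (K \<circ> linepath (0, 0) (0, 1)) + F (K \<circ> linepath (0, 1) (1, 1)) = F (K \<circ> linepath (0, 0) (1, 1))"
    by (rule F_triangle[OF K(1) KX c]) (simp_all add: closed_segment_subset c)
  moreover have "F (K \<circ> linepath (0, 0) (1, 0)) + F (K \<circ> linepath (1, 0) (1, 1)) = F (K \<circ> linepath (0, 0) (1, 1))"
    by (rule F_triangle[OF K(1) KX c]) (simp_all add: closed_segment_subset c)
  moreover have "F (K \<circ> linepath (0, 0) (0, 1)) = F \<gamma>" "F (K \<circ> linepath (1, 0) (1, 1)) = F \<delta>"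
    by (rule F_cong; use K(3,4) in \<open>simp add: linepath_def\<close>)+
  moreover have "F (K \<circ> linepath (0, 1) (1, 1)) = F (\<lambda>_. \<gamma> 1)"
    by (rule F_cong) (use K(6) in \<open>simp add: linepath_def pathfinish_def\<close>)
  moreover have "F (K \<circ> linepath (0, 0) (1, 0)) = F (\<lambda>_. \<gamma> 0)"
    by (rule F_cong) (use K(5) in \<open>simp add: linepath_def pathstart_def\<close>)
  ultimately show ?thesis using F_const g by simp
qed

lemma path_functional_F: "path_functional X F"
  using F_join F_homotopic by (auto simp: path_functional_def)

lemma F_reverse:
  assumes "path \<gamma>" "path_image \<gamma> \<subseteq> X" shows "F (reversepath \<gamma>) = - F \<gamma>"
proof -
  have "F (\<gamma> \<circ> linepath 0 1) + F (\<gamma> \<circ> linepath 1 0) = F (\<gamma> \<circ> linepath 0 0)"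
    by (rule F_triangle[of "{0..1}"])
      (use assms in \<open>auto simp: path_def[of \<gamma>] path_image_def[of \<gamma>] closed_segment_eq_real_ivl\<close>)
  moreover have "F (\<gamma> \<circ> linepath 0 1) = F \<gamma>" by (rule F_cong) (simp add: linepath_def)
  moreover have "F (\<gamma> \<circ> linepath 1 0) = F (reversepath \<gamma>)" by (rule F_cong) (simp add: linepath_def reversepath_def)
  moreover have "F (\<gamma> \<circ> linepath 0 0) = F (\<lambda>_. \<gamma> 0)" by (rule F_cong) (simp add: linepath_def)
  ultimately show ?thesis using F_const path_ends_in[OF assms(2)] by simp
qed

end

text \<open>Joining the edges of a chain to the base point along fixed paths does not change it if the chain
  is a cycle; hence every cycle is homologous to a loop.\<close>

lemma cycle_homologous_to_loop:
  assumes pc: "path_connected X" and p: "p \<in> X" and z: "singular_relcycle 1 (top_of_set X) {} z"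
  shows "\<exists>\<gamma>\<in>loops_at X p. \<forall>\<xi>. homology_functional X p \<xi> \<longrightarrow> homology_functional.F X p \<xi> \<gamma> = of_int (\<xi> z)"
proof -
  \<comment> \<open>\<open>e\<close> replaces each vertex of a 0-chain by the base path to it; the
    argument of \<open>s\<close> is the only point of the standard 0-simplex.\<close>
  define e where "e = frag_extend (\<lambda>s. seg (base_path X p (s (\<lambda>j. if j = (0::nat) then 1 else (0::real)))))"
  \<comment> \<open>\<open>Q\<close> closes up every edge separately, and it is the identity on
    cycles; so the induction over chains is about \<open>Q c\<close>, which is a cycle even if
    \<open>c\<close> is not.\<close>
  define Q where "Q c = c - e (chain_boundary 1 c)" for c :: "((nat \<Rightarrow> real) \<Rightarrow> 'a) \<Rightarrow>\<^sub>0 int"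
  have e0: "e 0 = 0" and ed: "e (a - b) = e a - e b" for a b by (simp_all add: e_def frag_extend_diff)
  have ev: "e (vertex_chain w) = seg (base_path X p w)" for w
    by (simp add: e_def vertex_chain_def standard_simplex_0)
  have Qd: "Q (a - b) = Q a - Q b" for a b by (simp add: Q_def chain_boundary_diff ed)
  have Qseg: "Q (seg \<gamma>) = based_cycle X p \<gamma>" for \<gamma>
    by (simp add: Q_def chain_boundary_seg[unfolded One_nat_def] chain_boundary_seg ed ev based_cycle_def)
  let ?P = "\<lambda>c. singular_relcycle 1 (top_of_set X) {} (Q c) \<and>
     (\<exists>\<gamma>\<in>loops_at X p. \<forall>\<xi>. homology_functional X p \<xi> \<longrightarrow> homology_functional.F X p \<xi> \<gamma> = of_int (\<xi> (Q c)))"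
  have "Poly_Mapping.keys z \<subseteq> singular_simplex_set 1 (top_of_set X)"
    using z by (simp add: singular_cycle singular_chain_def)
  then have "?P z"
  proof (induction z rule: frag_induction)
    case zero
    have "(\<lambda>_. p) \<in> loops_at X p"
      using p by (auto simp: loops_at_def path_def path_image_def pathstart_def pathfinish_def)
    moreover have "homology_functional.F X p \<xi> (\<lambda>_. p) = of_int (\<xi> 0)" if "homology_functional X p \<xi>" for \<xi>
      using homology_functional.F_const[OF that p] homology_functional.boundary[OF that, of 0] by simp
    ultimately show ?case by (auto simp: Q_def e0)
  next
    case (one f)
    \<comment> \<open>The segment from vertex 0 to vertex 1 parametrises the standard 1-simplex, so
      each singular 1-simplex is \<open>seg\<close> of a path.\<close>
    define \<gamma> where "\<gamma> t = f (\<lambda>k. if k = 0 then 1 - t else if k = 1 then t else 0)" for t :: real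
    have pg: "path \<gamma>" "path_image \<gamma> \<subseteq> X"
    proof -
      have m: "continuous_map (top_of_set {0..1}) (subtopology (powertop_real UNIV) (standard_simplex 1))
         (\<lambda>t k. if k = 0 then 1 - t else if k = 1 then t else 0)"
        unfolding continuous_map_in_subtopology
      proof
        show "continuous_map (top_of_set {0..1}) (powertop_real UNIV) (\<lambda>t k. if k = (0::nat) then 1 - t else if k = 1 then t else (0::real))"
          unfolding continuous_map_componentwise_UNIV
        proof
          fix k :: nat
          show "continuous_map (top_of_set {0..1}) euclideanreal (\<lambda>t. if k = 0 then 1 - t else if k = 1 then t else 0)"
            by (cases "k = 0"; cases "k = 1") (auto intro!: continuous_intros)
        qed
        show "(\<lambda>t k. if k = (0::nat) then 1 - t else if k = 1 then t else (0::real)) \<in> topspace (top_of_set {0..1}) \<rightarrow> standard_simplex 1"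
          by (auto simp: standard_simplex_def)
      qed
      have "continuous_map (subtopology (powertop_real UNIV) (standard_simplex 1)) (top_of_set X) f"
        using one by (simp add: singular_simplex_def)
      from continuous_map_compose[OF m this] show "path \<gamma>" "path_image \<gamma> \<subseteq> X"
        by (auto simp: \<gamma>_def[abs_def] o_def path_def path_image_def)
    qed
    have "f = restrict (\<lambda>x. \<gamma> (x 1)) (standard_simplex 1)"
    proof
      fix x :: "nat \<Rightarrow> real"
      show "f x = restrict (\<lambda>x. \<gamma> (x 1)) (standard_simplex 1) x"
      proof (cases "x \<in> standard_simplex 1")
        case True
        then have "(\<lambda>k. if k = 0 then 1 - x 1 else if k = 1 then x 1 else 0) = x"
          by (auto simp: standard_simplex_def fun_eq_iff)
        then show ?thesis unfolding \<gamma>_def restrict_apply'[OF True] by (simp only:)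
      next
        case False
        then show ?thesis using one by (simp add: singular_simplex_def extensional_def)
      qed
    qed
    then have fs: "frag_of f = seg \<gamma>" by (simp add: seg_def)
    let ?s = "base_path X p (\<gamma> 0)" and ?s' = "base_path X p (\<gamma> 1)"
    have gX: "\<gamma> 0 \<in> X" "\<gamma> 1 \<in> X" using pg(2) by (auto simp: path_image_def image_subset_iff)
    note b = base_path[OF pc p gX(1)] base_path[OF pc p gX(2)]
    define \<delta> where "\<delta> = ?s +++ (\<gamma> +++ reversepath ?s')"
    have ends: "pathstart \<gamma> = \<gamma> 0" "pathfinish \<gamma> = \<gamma> 1" "pathstart ?s = p" "pathfinish ?s = \<gamma> 0"
        "pathstart ?s' = p" "pathfinish ?s' = \<gamma> 1"
      by (simp_all add: pathstart_def pathfinish_def b)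
    have d: "\<delta> \<in> loops_at X p"
      unfolding \<delta>_def loops_at_def using pg b ends by (simp add: path_image_join)
    have "homology_functional.F X p \<xi> \<delta> = of_int (\<xi> (Q (frag_of f)))" if hf: "homology_functional X p \<xi>" for \<xi>
    proof -
      interpret homology_functional X p \<xi> by (rule hf)
      have "F \<delta> = F ?s + (F \<gamma> + F (reversepath ?s'))"
        unfolding \<delta>_def using pg b ends by (simp add: F_join path_image_join)
      \<comment> \<open>A base path closed up by itself leaves only the base path of
        \<open>p\<close>, whatever its end point, so the two connecting paths contribute opposite
        values.\<close>
      moreover have "F ?s = F ?s'"
        using b by (simp add: F_def based_cycle_def)
      ultimately have "F \<delta> = F \<gamma>" using F_reverse b by simp
      then show ?thesis by (simp add: F_def fs Qseg)
    qed
    moreover have "singular_relcycle 1 (top_of_set X) {} (Q (frag_of f))"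
      unfolding fs Qseg by (rule based_cycle[OF pc p pg])
    ultimately show ?case using d by blast
  next
    case (diff a b)
    then obtain \<gamma> \<delta> where g: "\<gamma> \<in> loops_at X p" "\<delta> \<in> loops_at X p"
      and F: "\<And>\<xi>. homology_functional X p \<xi> \<Longrightarrow> homology_functional.F X p \<xi> \<gamma> = of_int (\<xi> (Q a))"
        "\<And>\<xi>. homology_functional X p \<xi> \<Longrightarrow> homology_functional.F X p \<xi> \<delta> = of_int (\<xi> (Q b))" by auto
    have "\<gamma> +++ reversepath \<delta> \<in> loops_at X p"
      using g by (simp add: loops_at_def path_image_join)
    moreover have "homology_functional.F X p \<xi> (\<gamma> +++ reversepath \<delta>) = of_int (\<xi> (Q (a - b)))"
      if hf: "homology_functional X p \<xi>" for \<xi>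
    proof -
      interpret homology_functional X p \<xi> by (rule hf)
      show ?thesis
        using g diff F[OF hf] by (simp add: loops_at_def F_join F_reverse Qd chi_diff)
    qed
    ultimately show ?case using diff by (auto simp: Qd intro: singular_relcycle_diff)
  qed
  moreover have "Q z = z" using z by (simp add: Q_def singular_cycle e0)
  ultimately show ?thesis by simp
qed

text \<open>Each coordinate of the isomorphism is a homology functional, and each basis element is
  represented by a loop; together they give loops with dual periods.\<close>

lemma homology_coordinates:
  assumes iso: "homology_group 1 (top_of_set X) \<cong> free_Abelian_group {..<n}"
    and pc: "path_connected X" and p: "p \<in> X"
  shows "\<exists>F x. (\<forall>i<n. path_functional X (F i :: (real \<Rightarrow> 'a::topological_space) \<Rightarrow> real) \<and> x i \<in> loops_at X p \<and>
     (\<forall>j<n. F i (x j) = (if i = j then 1 else 0)))"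
proof -
  let ?H = "homology_group (int 1) (top_of_set X)"
  let ?h = "homologous_rel_set 1 (top_of_set X) {}"
  let ?Z = "singular_relcycle 1 (top_of_set X) {}"
  obtain f where f: "f \<in> iso ?H (free_Abelian_group {..<n})" using iso by (auto simp: is_iso_def)
  then have fh: "f \<in> hom ?H (free_Abelian_group {..<n})" and fb: "bij_betw f (carrier ?H) (carrier (free_Abelian_group {..<n}))"
    by (auto simp: iso_def)
  define \<xi> where "\<xi> i z = Poly_Mapping.lookup (f (?h z)) i" for i z
  have car: "?h z \<in> carrier ?H" if "?Z z" for z
    unfolding carrier_relative_homology_group using that by blast
  have mult: "?h a \<otimes>\<^bsub>?H\<^esub> ?h b = ?h (a + b)" if "?Z a" "?Z b" for a b
  proof -
    have "(\<Union>r\<in>?h a. \<Union>s\<in>?h b. {r + s}) = ?h (a + b)"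
    proof (intro equalityI subsetI)
      fix x assume "x \<in> (\<Union>r\<in>?h a. \<Union>s\<in>?h b. {r + s})"
      then show "x \<in> ?h (a + b)" by (auto intro: homologous_rel_add)
    next
      fix x assume "x \<in> ?h (a + b)"
      then have "homologous_rel 1 (top_of_set X) {} b (x - a)"
        by (simp add: homologous_rel_def algebra_simps)
      then have "x - a \<in> ?h b" "a \<in> ?h a" by simp_all
      moreover have "x = a + (x - a)" by simp
      ultimately show "x \<in> (\<Union>r\<in>?h a. \<Union>s\<in>?h b. {r + s})" by blast
    qed
    then show ?thesis by (simp only: mult_relative_homology_group)
  qed
  have hf: "homology_functional X p (\<xi> i)" for i
  proof
    fix a b assume ab: "?Z a" "?Z b"
    have "f (?h (a + b)) = f (?h a) + f (?h b)"
      using hom_mult[OF fh car[OF ab(1)] car[OF ab(2)]] mult[OF ab] by simp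
    then show "\<xi> i (a + b) = \<xi> i a + \<xi> i b" by (simp add: \<xi>_def lookup_add)
  next
    fix a assume "singular_relboundary 1 (top_of_set X) {} a"
    then have "?h a = \<one>\<^bsub>?H\<^esub>" unfolding one_relative_homology_group by (simp only: homologous_rel_set_eq_relboundary)
    then have "f (?h a) = 0" using hom_one[OF fh] by simp
    then show "\<xi> i a = 0" by (simp add: \<xi>_def)
  qed (use pc p in auto)
  have "\<exists>x\<in>loops_at X p. \<forall>i<n. homology_functional.F X p (\<xi> i) x = (if i = j then 1 else 0)" if j: "j < n" for j
  proof -
    have "frag_of j \<in> f ` carrier ?H" using fb j by (auto simp: bij_betw_def)
    then obtain z where z: "?Z z" "f (?h z) = frag_of j"
      unfolding carrier_relative_homology_group by auto
    obtain x where x: "x \<in> loops_at X p" "\<forall>\<xi>. homology_functional X p \<xi> \<longrightarrow> homology_functional.F X p \<xi> x = of_int (\<xi> z)"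
      using cycle_homologous_to_loop[OF pc p z(1)] by blast
    have "homology_functional.F X p (\<xi> i) x = (if i = j then 1 else 0)" for i
    proof -
      have "\<xi> i z = (if i = j then 1 else 0)" using z(2) by (auto simp: \<xi>_def simp del: One_nat_def)
      then show ?thesis using x(2) hf[of i] by auto
    qed
    then show ?thesis using x(1) by blast
  qed
  then obtain x where x: "\<And>j. j < n \<Longrightarrow> x j \<in> loops_at X p \<and> (\<forall>i<n. homology_functional.F X p (\<xi> i) (x j) = (if i = j then 1 else 0))"
    by metis
  show ?thesis
    by (rule exI[of _ "\<lambda>i. homology_functional.F X p (\<xi> i)"], rule exI[of _ x])
      (use x homology_functional.path_functional_F[OF hf] in auto)
qed

context closed_surface
begin

text \<open>Discs in charts make the surface locally path connected, so connectedness is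
  enough.\<close>

lemma path_connected_X: "path_connected X"
  unfolding path_connected_component
proof (intro ballI)
  fix x y assume "x \<in> X" "y \<in> X"
  show "path_component X x y"
  proof (rule connected_equivalence_relation[OF connected_X \<open>x \<in> X\<close> \<open>y \<in> X\<close>])
    fix a assume a: "a \<in> X"
    obtain U \<phi> where U: "(U, \<phi>) \<in> A" "a \<in> U" using chart_ex a by blast
    obtain r where r: "r > 0" "ball (\<phi> a) r \<subseteq> \<phi> ` U"
      using chart_open[OF U(1)] U(2) by (meson imageI openE)
    let ?T = "U \<inter> \<phi> -` ball (\<phi> a) r"
    have "path_component X a w" if w: "w \<in> ?T" for w
    proof -
      have c: "closed_segment (\<phi> a) (\<phi> w) \<subseteq> ball (\<phi> a) r" using w r(1) by (intro closed_segment_subset) auto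
      have "path (inv_into U \<phi> \<circ> linepath (\<phi> a) (\<phi> w))"
        by (intro path_continuous_image continuous_on_subset[OF chart_continuous(2)[OF U(1)]]) (use c r(2) in auto)
      moreover have "path_image (inv_into U \<phi> \<circ> linepath (\<phi> a) (\<phi> w)) \<subseteq> X"
        using c r(2) chart_preimage_subset[of "closed_segment (\<phi> a) (\<phi> w)" \<phi> U] chart_subset[OF U(1)]
        by (simp add: path_image_compose) blast
      ultimately show ?thesis unfolding path_component_def
        using U w chart_inv[OF U(1)] by (intro exI[of _ "inv_into U \<phi> \<circ> linepath (\<phi> a) (\<phi> w)"])
          (auto simp: pathstart_compose pathfinish_compose)
    qed
    moreover have "openin (top_of_set X) ?T" by (rule openin_chart_preimage[OF U(1)]) simp
    ultimately show "\<exists>T. openin (top_of_set X) T \<and> a \<in> T \<and> (\<forall>x\<in>T. path_component X a x)"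
      using U r by (intro exI[of _ ?T]) auto
  qed (auto intro: path_component_sym path_component_trans)
qed

end

section \<open>Covers by squares and smooth functions on the surface\<close>

definition square :: "real^2 \<Rightarrow> real \<Rightarrow> (real^2) set" where
  "square c s = box (c - s *\<^sub>R 1) (c + s *\<^sub>R 1)"

definition csquare :: "real^2 \<Rightarrow> real \<Rightarrow> (real^2) set" where
  "csquare c s = cbox (c - s *\<^sub>R 1) (c + s *\<^sub>R 1)"

lemma mem_square: "y \<in> square c s \<longleftrightarrow> (\<forall>i. \<bar>y $ i - c $ i\<bar> < s)"
  unfolding square_def mem_box_cart by (auto simp: abs_less_iff algebra_simps)

lemma mem_csquare: "y \<in> csquare c s \<longleftrightarrow> (\<forall>i. \<bar>y $ i - c $ i\<bar> \<le> s)"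
  unfolding csquare_def mem_box_cart by (auto simp: abs_le_iff algebra_simps)

lemma open_square: "open (square c s)" by (simp add: square_def open_box)
lemma convex_square: "convex (square c s)" by (simp add: square_def)
lemma compact_csquare: "compact (csquare c s)" by (simp add: csquare_def)
lemma square_subset_csquare: "s \<le> t \<Longrightarrow> square c s \<subseteq> csquare c t"
  unfolding subset_iff mem_square mem_csquare by (meson less_imp_le order_trans)
lemma csquare_subset_square: "s < t \<Longrightarrow> csquare c s \<subseteq> square c t"
  unfolding subset_iff mem_square mem_csquare by (meson le_less_trans)
lemma square_mono: "s \<le> t \<Longrightarrow> square c s \<subseteq> square c t"
  unfolding subset_iff mem_square by (meson less_le_trans)
lemma csquare_mono: "s \<le> t \<Longrightarrow> csquare c s \<subseteq> csquare c t"
  unfolding subset_iff mem_csquare by (meson order_trans)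
lemma centre_in_square: "s > 0 \<Longrightarrow> c \<in> square c s" by (simp add: mem_square)

lemma small_csquare:
  assumes "open S" "y \<in> S"
  obtains s where "s > 0" "csquare y s \<subseteq> S"
proof -
  obtain e where e: "e > 0" "ball y e \<subseteq> S" using assms by (meson openE)
  have "csquare y (e/4) \<subseteq> ball y e"
  proof
    fix x assume "x \<in> csquare y (e/4)"
    then have "\<bar>x $ 1 - y $ 1\<bar> \<le> e/4" "\<bar>x $ 2 - y $ 2\<bar> \<le> e/4" by (auto simp: mem_csquare)
    moreover have "norm (x - y) \<le> \<bar>x $ 1 - y $ 1\<bar> + \<bar>x $ 2 - y $ 2\<bar>"
      using norm_le_l1_cart[of "x - y"] by (simp add: sum_2)
    ultimately have "norm (x - y) < e" using e(1) by linarith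
    then show "x \<in> ball y e" by (simp add: dist_norm norm_minus_commute)
  qed
  then show ?thesis using that[of "e/4"] e by auto
qed

definition square_bump :: "real^2 \<Rightarrow> real \<Rightarrow> real^2 \<Rightarrow> real" where
  "square_bump c s y = (\<Prod>i\<in>UNIV. flat 0 (s + (y $ i - c $ i)) * flat 0 (s - (y $ i - c $ i)))"

text \<open>The factor 2/s makes each \<open>plateau\<close> reach 1 at distance s/2 inside the edge
  of the square of half-side 3 s. The product is therefore 1 on half-side 5 s / 2 and 0 off
  half-side 3 s.\<close>

definition square_plateau :: "real^2 \<Rightarrow> real \<Rightarrow> real^2 \<Rightarrow> real" where
  "square_plateau c s y = (\<Prod>i\<in>UNIV. plateau ((3 * s + (y $ i - c $ i)) * (2 / s)) * plateau ((3 * s - (y $ i - c $ i)) * (2 / s)))"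

lemma smooth_square_bump: "smooth_on UNIV (square_bump c s)"
  unfolding square_bump_def
  by (intro smooth_on_prod smooth_on_mult smooth_on_flat' smooth_on_add smooth_on_diff smooth_on_const smooth_on_nth) auto

lemma smooth_square_plateau: "smooth_on UNIV (square_plateau c s)"
  unfolding square_plateau_def
  by (intro smooth_on_prod smooth_on_mult smooth_on_plateau smooth_on_add smooth_on_diff smooth_on_const smooth_on_nth) auto

lemma square_bump_nonneg: "square_bump c s y \<ge> 0"
  unfolding square_bump_def by (intro prod_nonneg ballI mult_nonneg_nonneg flat_nonneg)

lemma square_bump_pos: "square_bump c s y > 0 \<longleftrightarrow> y \<in> square c s"
proof
  assume "y \<in> square c s"
  then have "\<bar>y $ i - c $ i\<bar> < s" for i by (simp add: mem_square)
  then have "0 < s + (y $ i - c $ i)" "0 < s - (y $ i - c $ i)" for i by (smt (verit))+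
  then show "square_bump c s y > 0"
    unfolding square_bump_def by (intro prod_pos ballI mult_pos_pos) (auto simp only: flat_pos_iff)
next
  assume p: "square_bump c s y > 0"
  have "\<bar>y $ i - c $ i\<bar> < s" for i
  proof (rule ccontr)
    assume "\<not> \<bar>y $ i - c $ i\<bar> < s"
    then have "flat 0 (s + (y $ i - c $ i)) * flat 0 (s - (y $ i - c $ i)) = 0"
      by (auto simp: flat_def)
    then have "square_bump c s y = 0" unfolding square_bump_def by (auto intro!: prod_zero)
    then show False using p by simp
  qed
  then show "y \<in> square c s" by (simp add: mem_square)
qed

lemma square_bump_outside: "y \<notin> square c s \<Longrightarrow> square_bump c s y = 0"
  using square_bump_pos[of c s y] square_bump_nonneg[of c s y] by linarith

lemma square_plateau_1:
  assumes "s > 0" "y \<in> square c (5/2 * s)" shows "square_plateau c s y = 1"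
  unfolding square_plateau_def
proof (rule prod.neutral, rule ballI)
  fix i
  have "\<bar>y $ i - c $ i\<bar> < 5/2 * s" using assms(2) by (simp add: mem_square)
  then have "3 * s + (y $ i - c $ i) \<ge> s / 2" "3 * s - (y $ i - c $ i) \<ge> s / 2" by linarith+
  then have "(3 * s + (y $ i - c $ i)) * (2 / s) \<ge> s / 2 * (2 / s)" "(3 * s - (y $ i - c $ i)) * (2 / s) \<ge> s / 2 * (2 / s)"
    using assms(1) by (intro mult_right_mono; simp)+
  moreover have "s / 2 * (2 / s) = 1" using assms(1) by simp
  ultimately show "plateau ((3 * s + (y $ i - c $ i)) * (2 / s)) * plateau ((3 * s - (y $ i - c $ i)) * (2 / s)) = 1"
    by (simp only: plateau_simps(2) mult_1)
qed

lemma square_plateau_outside: assumes "s > 0" "y \<notin> csquare c (3 * s)" shows "square_plateau c s y = 0"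
proof -
  obtain i where i: "\<not> \<bar>y $ i - c $ i\<bar> \<le> 3 * s" using assms(2) by (auto simp: mem_csquare)
  then have "3 * s + (y $ i - c $ i) \<le> 0 \<or> 3 * s - (y $ i - c $ i) \<le> 0" by auto
  then have "plateau ((3 * s + (y $ i - c $ i)) * (2 / s)) * plateau ((3 * s - (y $ i - c $ i)) * (2 / s)) = 0"
    using assms(1) plateau_simps(1)[OF mult_nonpos_nonneg, of "3 * s + (y $ i - c $ i)" "2 / s"]
      plateau_simps(1)[OF mult_nonpos_nonneg, of "3 * s - (y $ i - c $ i)" "2 / s"] by auto
  then show ?thesis unfolding square_plateau_def by (auto intro!: prod_zero)
qed

text \<open>Three sizes of squares: those of half-side \<open>rad\<close> cover the surface and
  carry the partition of unity, those of twice the size carry potentials and forms, and the size 3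
  leaves room in the chart for cutoff functions.\<close>

locale square_cover = closed_surface X A for X :: "'a::topological_space set" and A +
  fixes m :: nat and U :: "nat \<Rightarrow> 'a set" and \<phi> :: "nat \<Rightarrow> 'a \<Rightarrow> real^2" and c :: "nat \<Rightarrow> real^2" and rad :: "nat \<Rightarrow> real"
  assumes charts: "\<And>k. k < m \<Longrightarrow> (U k, \<phi> k) \<in> A"
    and rad: "\<And>k. k < m \<Longrightarrow> rad k > 0"
    and csq: "\<And>k. k < m \<Longrightarrow> csquare (c k) (3 * rad k) \<subseteq> \<phi> k ` U k"
    and cover: "X \<subseteq> (\<Union>k<m. U k \<inter> \<phi> k -` square (c k) (rad k))"

lemma (in closed_surface) square_cover_exists: "\<exists>m U \<phi> c rad. square_cover X A m U \<phi> c rad"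
proof -
  define S where "S g = fst g \<inter> fst (snd g) -` square (fst (snd (snd g))) (snd (snd (snd g)))"
    for g :: "'a set \<times> ('a \<Rightarrow> real^2) \<times> (real^2) \<times> real"
  define G where "G = {g. (fst g, fst (snd g)) \<in> A \<and> snd (snd (snd g)) > 0 \<and>
    csquare (fst (snd (snd g))) (3 * snd (snd (snd g))) \<subseteq> fst (snd g) ` fst g}"
  have o: "\<forall>g\<in>G. \<exists>O'. open O' \<and> S g = X \<inter> O'"
  proof
    fix g assume "g \<in> G"
    then have "openin (top_of_set X) (S g)"
      unfolding S_def G_def by (intro openin_chart_preimage open_square) simp
    then show "\<exists>O'. open O' \<and> S g = X \<inter> O'" unfolding openin_open .
  qed
  from bchoice[OF o] obtain T where T: "\<forall>g\<in>G. open (T g) \<and> S g = X \<inter> T g" ..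
  have cov: "X \<subseteq> (\<Union>g\<in>G. T g)"
  proof
    fix x assume x: "x \<in> X"
    then obtain V \<psi> where V: "(V, \<psi>) \<in> A" "x \<in> V" using chart_ex by blast
    obtain s where s: "s > 0" "csquare (\<psi> x) s \<subseteq> \<psi> ` V" using small_csquare[OF chart_open[OF V(1)]] V(2) by blast
    have g: "(V, \<psi>, \<psi> x, s/3) \<in> G" using V s by (simp add: G_def)
    have "x \<in> S (V, \<psi>, \<psi> x, s/3)" using V s by (simp add: S_def centre_in_square)
    then have "x \<in> T (V, \<psi>, \<psi> x, s/3)" using T g by simp
    then show "x \<in> (\<Union>g\<in>G. T g)" using g by (rule UN_I[rotated])
  qed
  obtain G' where G': "G' \<subseteq> G" "finite G'" "X \<subseteq> (\<Union>g\<in>G'. T g)"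
    by (rule compactE_image[OF compact_X _ cov]) (use T in auto)
  obtain gs where gs: "set gs = G'" using finite_list[OF G'(2)] by blast
  let ?m = "length gs"
  have gsG: "gs ! k \<in> G" if "k < ?m" for k using that G'(1) gs nth_mem by blast
  have "X \<subseteq> (\<Union>k<?m. S (gs ! k))"
  proof
    fix x assume x: "x \<in> X"
    then obtain g where g: "g \<in> G'" "x \<in> T g" using G'(3) by blast
    then have "x \<in> S g" using T G'(1) x by (metis IntI subsetD)
    moreover obtain k where "k < ?m" "g = gs ! k" using g(1) gs by (metis in_set_conv_nth)
    ultimately show "x \<in> (\<Union>k<?m. S (gs ! k))" by blast
  qed
  then have "square_cover X A ?m (\<lambda>k. fst (gs ! k)) (\<lambda>k. fst (snd (gs ! k))) (\<lambda>k. fst (snd (snd (gs ! k)))) (\<lambda>k. snd (snd (snd (gs ! k))))"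
    using gsG by unfold_locales (auto simp: G_def S_def)
  then show ?thesis by blast
qed

context square_cover
begin

definition \<psi> :: "nat \<Rightarrow> real^2 \<Rightarrow> 'a" where "\<psi> k = inv_into (U k) (\<phi> k)"

definition sq :: "nat \<Rightarrow> real \<Rightarrow> 'a set" where "sq k s = U k \<inter> \<phi> k -` square (c k) (s * rad k)"

definition csq' :: "nat \<Rightarrow> real \<Rightarrow> 'a set" where "csq' k s = \<psi> k ` csquare (c k) (s * rad k)"

lemma psi_phi: "k < m \<Longrightarrow> x \<in> U k \<Longrightarrow> \<psi> k (\<phi> k x) = x"
  by (simp add: \<psi>_def chart_inv charts)

lemma phi_psi: "y \<in> \<phi> k ` U k \<Longrightarrow> \<phi> k (\<psi> k y) = y" "y \<in> \<phi> k ` U k \<Longrightarrow> \<psi> k y \<in> U k"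
  by (auto simp: \<psi>_def f_inv_into_f inv_into_into)

lemma U_sub: "k < m \<Longrightarrow> U k \<subseteq> X" using chart_subset charts by blast

lemma open_phi: "k < m \<Longrightarrow> openin (top_of_set X) W \<Longrightarrow> open (\<phi> k ` (U k \<inter> W))"
  using chart_open_image charts by blast

lemma open_phi_U: "k < m \<Longrightarrow> open (\<phi> k ` U k)" using chart_open charts by blast

lemma openin_U: "k < m \<Longrightarrow> openin (top_of_set X) (U k)" using chart_openin charts by blast

lemma openin_sq: "k < m \<Longrightarrow> openin (top_of_set X) (sq k s)"
  unfolding sq_def using openin_chart_preimage charts open_square by blast

lemma sq_cover: "x \<in> X \<Longrightarrow> s \<ge> 1 \<Longrightarrow> \<exists>k<m. x \<in> sq k s"
proof -
  assume x: "x \<in> X" and s: "s \<ge> 1"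
  then obtain k where k: "k < m" "x \<in> U k" "\<phi> k x \<in> square (c k) (rad k)" using cover by blast
  have "rad k \<le> s * rad k" using s rad[OF k(1)] by simp
  then have "\<phi> k x \<in> square (c k) (s * rad k)" using k(3) square_mono by blast
  then show ?thesis using k by (auto simp: sq_def)
qed

lemma csquare_sub: "k < m \<Longrightarrow> s \<le> 3 \<Longrightarrow> csquare (c k) (s * rad k) \<subseteq> \<phi> k ` U k"
proof -
  assume k: "k < m" and s: "s \<le> 3"
  have "s * rad k \<le> 3 * rad k" using rad[OF k] s by simp
  then have "csquare (c k) (s * rad k) \<subseteq> csquare (c k) (3 * rad k)" by (rule csquare_mono)
  then show ?thesis using csq[OF k] by blast
qed

lemma square_sub: "k < m \<Longrightarrow> s \<le> 3 \<Longrightarrow> square (c k) (s * rad k) \<subseteq> \<phi> k ` U k"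
  using csquare_sub square_subset_csquare[of "s * rad k" "s * rad k" "c k"] by fastforce

lemma csq'_mem: "k < m \<Longrightarrow> s \<le> 3 \<Longrightarrow> x \<in> csq' k s \<longleftrightarrow> x \<in> U k \<and> \<phi> k x \<in> csquare (c k) (s * rad k)"
proof
  assume k: "k < m" "s \<le> 3"
  { assume "x \<in> csq' k s"
    then obtain y where y: "y \<in> csquare (c k) (s * rad k)" "x = \<psi> k y" by (auto simp: csq'_def)
    then have "y \<in> \<phi> k ` U k" using csquare_sub[OF k] by blast
    then show "x \<in> U k \<and> \<phi> k x \<in> csquare (c k) (s * rad k)" using y phi_psi by metis }
  { assume "x \<in> U k \<and> \<phi> k x \<in> csquare (c k) (s * rad k)"
    then show "x \<in> csq' k s" unfolding csq'_def using psi_phi[OF k(1), of x] by (metis imageI) }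
qed

lemma csq'_subset_sq: "k < m \<Longrightarrow> s < t \<Longrightarrow> t \<le> 3 \<Longrightarrow> csq' k s \<subseteq> sq k t"
  using csquare_subset_square[of "s * rad k" "t * rad k" "c k"] rad[of k] csq'_mem[of k s]
  by (auto simp: sq_def)

lemma closedin_csq': "k < m \<Longrightarrow> s \<le> 3 \<Longrightarrow> closedin (top_of_set X) (csq' k s)"
  unfolding csq'_def \<psi>_def by (intro closedin_chart_preimage charts compact_csquare csquare_sub)

lemma transition_smooth:
  assumes "k < m" "l < m" shows "oriented_smooth_on (\<phi> l ` (U l \<inter> U k)) (\<lambda>y. \<phi> k (\<psi> l y))"
  unfolding \<psi>_def by (rule transition_oriented_smooth) (use assms charts in auto)

text \<open>Only the finitely many charts of the cover are tested; because transition maps are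
  smooth, any one of them around a point suffices (\<open>smooth_fnI\<close>).\<close>

definition smooth_fn :: "'a set \<Rightarrow> ('a \<Rightarrow> real) \<Rightarrow> bool" where
  "smooth_fn W u \<longleftrightarrow> (\<forall>k<m. smooth_on (\<phi> k ` (U k \<inter> W)) (\<lambda>y. u (\<psi> k y)))"

lemma smooth_fnI:
  assumes "\<And>x. x \<in> W \<Longrightarrow> \<exists>k<m. \<exists>N. openin (top_of_set X) N \<and> x \<in> U k \<inter> N \<and> smooth_on (\<phi> k ` (U k \<inter> N)) (\<lambda>y. u (\<psi> k y))"
  shows "smooth_fn W u"
  unfolding smooth_fn_def
proof (intro allI impI)
  fix l assume l: "l < m"
  show "smooth_on (\<phi> l ` (U l \<inter> W)) (\<lambda>y. u (\<psi> l y))"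
  proof (rule smooth_on_local)
    fix y assume "y \<in> \<phi> l ` (U l \<inter> W)"
    then obtain x where x: "x \<in> U l" "x \<in> W" "y = \<phi> l x" by auto
    then obtain k N where k: "k < m" "openin (top_of_set X) N" "x \<in> U k" "x \<in> N"
        "smooth_on (\<phi> k ` (U k \<inter> N)) (\<lambda>y. u (\<psi> k y))"
      using assms by blast
    let ?M = "\<phi> l ` (U l \<inter> (U k \<inter> N))"
    have oM: "open ?M" by (intro open_phi l openin_Int openin_U k)
    have "smooth_on ?M (\<lambda>y. \<phi> k (\<psi> l y))"
      using transition_smooth[OF k(1) l] by (auto simp: oriented_smooth_on_def intro: smooth_on_subset)
    then have "smooth_on ?M (\<lambda>y. u (\<psi> k (\<phi> k (\<psi> l y))))"
      by (rule smooth_on_compose[OF k(5) _ _ oM]) (auto simp: psi_phi l)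
    then have "smooth_on ?M (\<lambda>y. u (\<psi> l y))"
      by (rule smooth_on_cong[OF oM, rotated]) (auto simp: psi_phi l k)
    then show "\<exists>N. open N \<and> y \<in> N \<and> smooth_on N (\<lambda>y. u (\<psi> l y))" using oM x k by blast
  qed
qed

lemma smooth_fn_subset: "smooth_fn W u \<Longrightarrow> V \<subseteq> W \<Longrightarrow> smooth_fn V u"
  unfolding smooth_fn_def by (meson Int_mono image_mono order_refl smooth_on_subset)

lemma smooth_fn_local:
  assumes "\<And>x. x \<in> W \<Longrightarrow> \<exists>N. openin (top_of_set X) N \<and> x \<in> N \<and> smooth_fn N u"
    and "W \<subseteq> X"
  shows "smooth_fn W u"
proof (rule smooth_fnI)
  fix x assume "x \<in> W"
  moreover then obtain k where "k < m" "x \<in> sq k 1" using assms(2) sq_cover by fastforce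
  ultimately show "\<exists>k<m. \<exists>N. openin (top_of_set X) N \<and> x \<in> U k \<inter> N \<and> smooth_on (\<phi> k ` (U k \<inter> N)) (\<lambda>y. u (\<psi> k y))"
    using assms(1)[of x] unfolding smooth_fn_def sq_def by blast
qed

lemma smooth_fn_cong:
  assumes "openin (top_of_set X) W" "\<And>x. x \<in> W \<Longrightarrow> u x = v x" "smooth_fn W u"
  shows "smooth_fn W v"
  unfolding smooth_fn_def
proof (intro allI impI)
  fix k assume k: "k < m"
  show "smooth_on (\<phi> k ` (U k \<inter> W)) (\<lambda>y. v (\<psi> k y))"
    by (rule smooth_on_cong[OF open_phi[OF k assms(1)], of "\<lambda>y. u (\<psi> k y)"])
      (use assms k in \<open>auto simp: psi_phi smooth_fn_def\<close>)
qed

lemma smooth_fn_const: "openin (top_of_set X) W \<Longrightarrow> smooth_fn W (\<lambda>_. a)"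
  unfolding smooth_fn_def by (intro allI impI smooth_on_const open_phi)

lemma smooth_fn_mult: "openin (top_of_set X) W \<Longrightarrow> smooth_fn W u \<Longrightarrow> smooth_fn W v \<Longrightarrow> smooth_fn W (\<lambda>x. u x * v x)"
  unfolding smooth_fn_def by (auto intro: smooth_on_mult open_phi)

lemma smooth_fn_divide:
  "openin (top_of_set X) W \<Longrightarrow> smooth_fn W u \<Longrightarrow> smooth_fn W v \<Longrightarrow> (\<And>x. x \<in> W \<Longrightarrow> v x \<noteq> 0) \<Longrightarrow> smooth_fn W (\<lambda>x. u x / v x)"
  unfolding smooth_fn_def by (auto intro!: smooth_on_divide open_phi simp: psi_phi)

lemma smooth_fn_sum:
  "openin (top_of_set X) W \<Longrightarrow> (\<And>i. i \<in> I \<Longrightarrow> smooth_fn W (u i)) \<Longrightarrow> smooth_fn W (\<lambda>x. \<Sum>i\<in>I. u i x)"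
  unfolding smooth_fn_def by (auto intro: smooth_on_sum open_phi)

section \<open>Bump functions on the surface and a partition of unity\<close>

definition zero_ext :: "nat \<Rightarrow> (real^2 \<Rightarrow> real) \<Rightarrow> 'a \<Rightarrow> real" where
  "zero_ext k h x = (if x \<in> U k then h (\<phi> k x) else 0)"

lemma zero_ext_outside:
  "k < m \<Longrightarrow> s \<le> 3 \<Longrightarrow> (\<And>y. y \<notin> csquare (c k) (s * rad k) \<Longrightarrow> h y = 0) \<Longrightarrow> x \<notin> csq' k s \<Longrightarrow> zero_ext k h x = 0"
  using csq'_mem[of k s x] by (auto simp: zero_ext_def)

text \<open>At points outside the chart the extension vanishes on a whole neighbourhood, because the
  image of the closed square is closed in \<open>X\<close>.\<close>

lemma smooth_fn_zero_ext:
  assumes k: "k < m" and s: "s \<le> 3" and h: "smooth_on UNIV h" "\<And>y. y \<notin> csquare (c k) (s * rad k) \<Longrightarrow> h y = 0"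
  shows "smooth_fn X (zero_ext k h)"
proof (rule smooth_fn_local)
  fix x assume x: "x \<in> X"
  show "\<exists>N. openin (top_of_set X) N \<and> x \<in> N \<and> smooth_fn N (zero_ext k h)"
  proof (cases "x \<in> U k")
    case True
    have "smooth_fn (U k) (zero_ext k h)"
    proof (rule smooth_fnI)
      fix w assume w: "w \<in> U k"
      have "smooth_on (\<phi> k ` U k) (\<lambda>y. zero_ext k h (\<psi> k y))"
        by (rule smooth_on_cong[OF open_phi_U[OF k] _ smooth_on_subset[OF h(1) subset_UNIV]])
          (auto simp: zero_ext_def psi_phi k)
      then show "\<exists>l<m. \<exists>N. openin (top_of_set X) N \<and> w \<in> U l \<inter> N \<and> smooth_on (\<phi> l ` (U l \<inter> N)) (\<lambda>y. zero_ext k h (\<psi> l y))"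
        using k w openin_U[OF k] by (intro exI[of _ k] conjI exI[of _ "U k"]) auto
    qed
    then show ?thesis using True openin_U[OF k] by blast
  next
    case False
    have o: "openin (top_of_set X) (X - csq' k s)" by (intro openin_diff closedin_csq' k s) auto
    have "smooth_fn (X - csq' k s) (zero_ext k h)"
      by (rule smooth_fn_cong[OF o _ smooth_fn_const[OF o, of 0]]) (use zero_ext_outside[OF k s h(2)] in auto)
    moreover have "x \<in> X - csq' k s" using x False csq'_mem[OF k s] by blast
    ultimately show ?thesis using o by blast
  qed
qed simp

text \<open>Bumps that are positive exactly on the smallest squares, which cover; divided by their
  sum they form the partition of unity \<rho>.\<close>

definition \<beta> :: "nat \<Rightarrow> 'a \<Rightarrow> real" where "\<beta> k = zero_ext k (square_bump (c k) (rad k))"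

definition \<rho> :: "nat \<Rightarrow> 'a \<Rightarrow> real" where "\<rho> k x = \<beta> k x / (\<Sum>j<m. \<beta> j x)"

lemma beta_nonneg: "\<beta> k x \<ge> 0" by (simp add: \<beta>_def zero_ext_def square_bump_nonneg)

lemma beta_sum_pos: assumes "x \<in> X" shows "(\<Sum>j<m. \<beta> j x) > 0"
proof -
  obtain k where k: "k < m" "x \<in> sq k 1" using sq_cover[OF assms, of 1] by auto
  then have "\<beta> k x > 0" by (simp add: \<beta>_def zero_ext_def sq_def square_bump_pos)
  then show ?thesis using k(1) beta_nonneg by (intro sum_pos2[of _ k]) auto
qed

lemma smooth_rho: "k < m \<Longrightarrow> smooth_fn X (\<rho> k)"
proof -
  have b: "smooth_fn X (\<beta> j)" if j: "j < m" for j
    unfolding \<beta>_def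
  proof (rule smooth_fn_zero_ext[OF j, of 1])
    show "square_bump (c j) (rad j) y = 0" if "y \<notin> csquare (c j) (1 * rad j)" for y
      using that square_bump_outside[of y "c j" "rad j"] square_subset_csquare[of "rad j" "rad j" "c j"] by auto
  qed (auto simp: smooth_square_bump)
  have "smooth_fn X (\<lambda>x. \<Sum>j<m. \<beta> j x)" by (rule smooth_fn_sum) (use b in auto)
  then show "k < m \<Longrightarrow> smooth_fn X (\<rho> k)"
    unfolding \<rho>_def[abs_def] using b less_imp_neq[OF beta_sum_pos] by (intro smooth_fn_divide) auto
qed

lemma rho_outside: "k < m \<Longrightarrow> x \<notin> csq' k 1 \<Longrightarrow> \<rho> k x = 0"
proof -
  assume k: "k < m" and x: "x \<notin> csq' k 1"
  have "\<beta> k x = 0" unfolding \<beta>_def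
  proof (rule zero_ext_outside[OF k, of 1, OF _ _ x])
    show "square_bump (c k) (rad k) y = 0" if "y \<notin> csquare (c k) (1 * rad k)" for y
      using that square_bump_outside[of y "c k" "rad k"] square_subset_csquare[of "rad k" "rad k" "c k"] by auto
  qed auto
  then show ?thesis by (simp add: \<rho>_def)
qed

lemma rho_sum: "x \<in> X \<Longrightarrow> (\<Sum>k<m. \<rho> k x) = 1"
  using beta_sum_pos[of x] by (simp add: \<rho>_def flip: sum_divide_distrib)

section \<open>Local potentials of a path functional\<close>

text \<open>A primitive of the closed form that \<open>G\<close> stands for, normalised at the
  centre of the square and found by integrating along straight segments.\<close>

definition potential :: "((real \<Rightarrow> 'a) \<Rightarrow> real) \<Rightarrow> nat \<Rightarrow> 'a \<Rightarrow> real" where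
  "potential G k z = G (\<psi> k \<circ> linepath (c k) (\<phi> k z))"

lemma continuous_psi: "k < m \<Longrightarrow> continuous_on (square (c k) (2 * rad k)) (\<psi> k)"
  unfolding \<psi>_def by (rule continuous_on_subset[OF chart_continuous(2)[OF charts] square_sub]) auto

lemma psi_square: "k < m \<Longrightarrow> \<psi> k ` square (c k) (2 * rad k) \<subseteq> X"
  using square_sub[of k 2] phi_psi(2) U_sub by fastforce

text \<open>The segment to the start of \<gamma>, followed by \<gamma>, is homotopic to the segment
  to its end, the square being convex.\<close>

lemma potential_diff:
  assumes G: "path_functional X G" and k: "k < m" and g: "path \<gamma>" "path_image \<gamma> \<subseteq> sq k 2"
  shows "potential G k (pathfinish \<gamma>) - potential G k (pathstart \<gamma>) = G \<gamma>"
proof -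
  let ?S = "square (c k) (2 * rad k)"
  have cS: "c k \<in> ?S" using rad[OF k] by (simp add: centre_in_square)
  have gX: "path_image \<gamma> \<subseteq> X" using g(2) U_sub[OF k] by (auto simp: sq_def)
  have ends: "pathstart \<gamma> \<in> sq k 2" "pathfinish \<gamma> \<in> sq k 2" using g by auto
  have seg: "closed_segment (c k) (\<phi> k w) \<subseteq> ?S" if "w \<in> sq k 2" for w
    using that by (intro closed_segment_subset cS convex_square) (auto simp: sq_def)
  have P: "path (\<psi> k \<circ> q) \<and> path_image (\<psi> k \<circ> q) \<subseteq> X" if "path q" "path_image q \<subseteq> ?S" for q
    using that psi_square[OF k] continuous_psi[OF k]
    by (auto simp: path_image_compose intro!: path_continuous_image intro: continuous_on_subset)
  have pg: "path (\<phi> k \<circ> \<gamma>)" "path_image (\<phi> k \<circ> \<gamma>) \<subseteq> ?S"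
    using g chart_continuous(1)[OF charts[OF k]]
    by (auto simp: path_image_compose sq_def intro!: path_continuous_image intro: continuous_on_subset)
  let ?q = "linepath (c k) (\<phi> k (pathstart \<gamma>))" and ?q' = "linepath (c k) (\<phi> k (pathfinish \<gamma>))"
  have "homotopic_paths X (\<psi> k \<circ> (?q +++ (\<phi> k \<circ> \<gamma>))) (\<psi> k \<circ> ?q')"
    using seg[OF ends(1)] seg[OF ends(2)] pg
    by (intro homotopic_paths_push[OF continuous_psi[OF k] psi_square[OF k] convex_square])
      (auto simp: path_image_join pathstart_compose pathfinish_compose)
  then have "G (\<psi> k \<circ> ?q') = G (\<psi> k \<circ> (?q +++ (\<phi> k \<circ> \<gamma>)))"
    using path_functional_homotopic[OF G] by metis
  also have "\<dots> = G (\<psi> k \<circ> ?q) + G (\<psi> k \<circ> (\<phi> k \<circ> \<gamma>))"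
    unfolding path_compose_join
    by (rule path_functional_join[OF G]) (use P[of ?q] P[OF pg] seg[OF ends(1)] in \<open>auto simp: pathstart_compose pathfinish_compose\<close>)
  also have "G (\<psi> k \<circ> (\<phi> k \<circ> \<gamma>)) = G \<gamma>"
  proof (rule path_functional_homotopic[OF G], rule homotopic_paths_sym, rule homotopic_paths_eq[OF g(1) gX])
    show "\<gamma> t = (\<psi> k \<circ> (\<phi> k \<circ> \<gamma>)) t" if "t \<in> {0..1}" for t
      using g(2) that psi_phi[OF k, of "\<gamma> t"] by (auto simp: path_image_def sq_def image_subset_iff)
  qed
  finally show ?thesis unfolding potential_def by linarith
qed

definition overlap :: "((real \<Rightarrow> 'a) \<Rightarrow> real) \<Rightarrow> nat \<Rightarrow> nat \<Rightarrow> 'a \<Rightarrow> real" where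
  "overlap G k l z = potential G k z - potential G l z"

text \<open>Points of a small disc inside both squares are joined to \<open>z\<close> by a path
  inside both, along which the two potentials change by the same amount.\<close>

lemma overlap_locally_constant:
  assumes G: "path_functional X G" and k: "k < m" and l: "l < m" and z: "z \<in> sq k 2" "z \<in> sq l 2"
  shows "\<exists>N. openin (top_of_set X) N \<and> z \<in> N \<and> N \<subseteq> sq k 2 \<inter> sq l 2 \<and> (\<forall>w\<in>N. overlap G k l w = overlap G k l z)"
proof -
  have "open (\<phi> k ` (U k \<inter> (sq k 2 \<inter> sq l 2)))" by (intro open_phi k openin_Int openin_sq l)
  moreover have "\<phi> k z \<in> \<phi> k ` (U k \<inter> (sq k 2 \<inter> sq l 2))" using z by (auto simp: sq_def)
  ultimately obtain e where e: "e > 0" "ball (\<phi> k z) e \<subseteq> \<phi> k ` (U k \<inter> (sq k 2 \<inter> sq l 2))" by (meson openE)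
  have psi: "\<psi> k y \<in> sq k 2 \<inter> sq l 2" if "y \<in> ball (\<phi> k z) e" for y
    using e(2) that psi_phi[OF k] by fastforce
  let ?N = "U k \<inter> \<phi> k -` ball (\<phi> k z) e"
  have N: "?N \<subseteq> sq k 2 \<inter> sq l 2" using psi psi_phi[OF k] by force
  have "overlap G k l w = overlap G k l z" if w: "w \<in> ?N" for w
  proof -
    let ?g = "\<psi> k \<circ> linepath (\<phi> k z) (\<phi> k w)"
    have cs: "closed_segment (\<phi> k z) (\<phi> k w) \<subseteq> ball (\<phi> k z) e" using w e(1) by (intro closed_segment_subset) auto
    have im: "path_image ?g \<subseteq> sq k 2 \<inter> sq l 2" using cs psi by (auto simp: path_image_compose)
    have "ball (\<phi> k z) e \<subseteq> \<phi> k ` U k" using e(2) by blast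
    then have pg: "path ?g"
      unfolding \<psi>_def using cs
      by (intro path_continuous_image continuous_on_subset[OF chart_continuous(2)[OF charts[OF k]]]) auto
    have "pathstart ?g = z" "pathfinish ?g = w"
      using z w psi_phi[OF k] by (auto simp: pathstart_compose pathfinish_compose sq_def)
    then show ?thesis
      using potential_diff[OF G k pg] potential_diff[OF G l pg] im by (simp add: overlap_def)
  qed
  moreover have "openin (top_of_set X) ?N" using openin_chart_preimage[OF charts[OF k]] by simp
  moreover have "z \<in> ?N" using z e(1) by (auto simp: sq_def)
  ultimately show ?thesis using N by blast
qed

text \<open>The potentials themselves need not be continuous; averaging over the cover gives smooth
  functions with the same differences on overlaps.\<close>

definition smooth_potential :: "((real \<Rightarrow> 'a) \<Rightarrow> real) \<Rightarrow> nat \<Rightarrow> 'a \<Rightarrow> real" where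
  "smooth_potential G k z = (\<Sum>j<m. \<rho> j z * overlap G k j z)"

text \<open>The subtracted average does not depend on \<open>k\<close>, which is why the smoothing
  preserves all differences.\<close>

lemma smooth_potential_eq:
  "z \<in> X \<Longrightarrow> smooth_potential G k z = potential G k z - (\<Sum>j<m. \<rho> j z * potential G j z)"
  using rho_sum[of z] by (simp add: smooth_potential_def overlap_def right_diff_distrib sum_subtractf flip: sum_distrib_right)

lemma smooth_potential_diff:
  "z \<in> X \<Longrightarrow> smooth_potential G k z - smooth_potential G l z = overlap G k l z"
  by (simp add: smooth_potential_eq overlap_def)

text \<open>At points of \<open>sq j 2\<close> the overlap is locally constant; elsewhere \<rho> j
  vanishes nearby, as it lives in a smaller closed square. Hence every summand is locally
  smooth.\<close>

lemma smooth_fn_potential: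
  assumes G: "path_functional X G" and k: "k < m"
  shows "smooth_fn (sq k 2) (smooth_potential G k)"
  unfolding smooth_potential_def[abs_def]
proof (rule smooth_fn_sum[OF openin_sq[OF k]])
  fix j assume "j \<in> {..<m}"
  then have j: "j < m" by simp
  show "smooth_fn (sq k 2) (\<lambda>z. \<rho> j z * overlap G k j z)"
  proof (rule smooth_fn_local)
    fix z assume z: "z \<in> sq k 2"
    show "\<exists>N. openin (top_of_set X) N \<and> z \<in> N \<and> smooth_fn N (\<lambda>z. \<rho> j z * overlap G k j z)"
    proof (cases "z \<in> sq j 2")
      case True
      then obtain N where N: "openin (top_of_set X) N" "z \<in> N" "\<forall>w\<in>N. overlap G k j w = overlap G k j z"
        using overlap_locally_constant[OF G k j z] by blast
      have "smooth_fn N (\<lambda>w. \<rho> j w * overlap G k j z)"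
        by (rule smooth_fn_mult[OF N(1) smooth_fn_subset[OF smooth_rho[OF j] openin_imp_subset[OF N(1)]] smooth_fn_const[OF N(1)]])
      then have "smooth_fn N (\<lambda>z. \<rho> j z * overlap G k j z)"
        by (rule smooth_fn_cong[OF N(1), rotated]) (use N(3) in auto)
      then show ?thesis using N by blast
    next
      case False
      have o: "openin (top_of_set X) (X - csq' j 1)" by (intro openin_diff closedin_csq' j) auto
      have "smooth_fn (X - csq' j 1) (\<lambda>z. \<rho> j z * overlap G k j z)"
        by (rule smooth_fn_cong[OF o _ smooth_fn_const[OF o, of 0]]) (simp add: rho_outside[OF j])
      moreover have "z \<in> X - csq' j 1"
        using False csq'_subset_sq[OF j, of 1 2] z U_sub[OF k] by (auto simp: sq_def)
      ultimately show ?thesis using o by blast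
    qed
  qed (use U_sub[OF k] in \<open>auto simp: sq_def\<close>)
qed

end

section \<open>Compactly supported forms in the plane\<close>

abbreviation e1 :: "real^2" where "e1 \<equiv> axis 1 1"
abbreviation e2 :: "real^2" where "e2 \<equiv> axis 2 1"

definition vec2 :: "real \<Rightarrow> real \<Rightarrow> real^2" where "vec2 x y = x *\<^sub>R e1 + y *\<^sub>R e2"

lemma vec2_nth [simp]: "vec2 x y $ 1 = x" "vec2 x y $ 2 = y"
  by (simp_all add: vec2_def axis_def)

lemma vec2_eta [simp]: "vec2 (y $ 1) (y $ 2) = y"
  by (simp add: vec_eq_iff forall_2)

lemma smooth_on_vec2:
  "smooth_on W f \<Longrightarrow> smooth_on W g \<Longrightarrow> open W \<Longrightarrow> smooth_on W (\<lambda>x. vec2 (f x) (g x))"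
  unfolding vec2_def by (intro smooth_on_add smooth_on_scaleR smooth_on_const)

definition pd1 :: "(real^2 \<Rightarrow> real) \<Rightarrow> real^2 \<Rightarrow> real" where "pd1 f y = frechet_derivative f (at y) e1"
definition pd2 :: "(real^2 \<Rightarrow> real) \<Rightarrow> real^2 \<Rightarrow> real" where "pd2 f y = frechet_derivative f (at y) e2"

lemma directional_derivative:
  fixes f :: "'a::euclidean_space \<Rightarrow> real"
  assumes "smooth_on UNIV f"
  shows "((\<lambda>t. f (y + t *\<^sub>R v)) has_real_derivative frechet_derivative f (at y) v) (at 0)"
proof -
  have "((\<lambda>t. y + t *\<^sub>R v) has_derivative (\<lambda>t. t *\<^sub>R v)) (at 0)" by (auto intro!: derivative_eq_intros)
  from diff_chain_at[OF this, of f] smooth_on_has_derivative[OF assms, of y]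
  have "((\<lambda>t. f (y + t *\<^sub>R v)) has_derivative (\<lambda>t. frechet_derivative f (at y) (t *\<^sub>R v))) (at 0)" by (simp add: o_def)
  moreover have "(\<lambda>t. frechet_derivative f (at y) (t *\<^sub>R v)) = (*) (frechet_derivative f (at y) v)"
    using linear_cmul[OF linear_frechet_derivative[OF smooth_on_differentiable[OF assms]], of y]
    by (simp add: fun_eq_iff mult.commute)
  ultimately show ?thesis by (simp only: has_field_derivative_def)
qed

text \<open>The integral from \<open>a\<close> to \<open>x\<close>, rescaled to the unit interval so that it depends smoothly on
  parameters and makes sense for \<open>x < a\<close>.\<close>

definition prim :: "real \<Rightarrow> (real \<Rightarrow> real) \<Rightarrow> real \<Rightarrow> real" where
  "prim a q x = integral {0..1} (\<lambda>t. (x - a) * q (a + t * (x - a)))"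

text \<open>One antiderivative on an interval around all points in question treats both signs of x -
  a at once.\<close>

lemma prim_antiderivative:
  assumes q: "continuous_on UNIV q"
  obtains Q where "\<And>x. \<bar>x\<bar> < N \<Longrightarrow> (Q has_real_derivative q x) (at x)"
    "\<And>x a. \<bar>x\<bar> < N \<Longrightarrow> \<bar>a\<bar> < N \<Longrightarrow> prim a q x = Q x - Q a"
    "\<And>x a. \<bar>x\<bar> < N \<Longrightarrow> \<bar>a\<bar> < N \<Longrightarrow> a \<le> x \<Longrightarrow> integral {a..x} q = Q x - Q a"
proof -
  obtain Q where Q: "\<And>x. x \<in> {-N..N} \<Longrightarrow> (Q has_vector_derivative q x) (at x within {-N..N})"
    using antiderivative_continuous[OF continuous_on_subset[OF q subset_UNIV], of "-N" N] by blast
  have D: "(Q has_real_derivative q x) (at x)" if "\<bar>x\<bar> < N" for x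
  proof -
    have "(Q has_vector_derivative q x) (at x within {-N..N})" using that by (intro Q) auto
    then have "(Q has_vector_derivative q x) (at x)"
      using that at_within_interior[of x "{-N..N}"] by (simp add: interior_atLeastAtMost_real abs_less_iff)
    then show ?thesis by (simp add: has_real_derivative_iff_has_vector_derivative)
  qed
  have P: "prim a q x = Q x - Q a" if xa: "\<bar>x\<bar> < N" "\<bar>a\<bar> < N" for x a
  proof -
    have "((\<lambda>t. (x - a) * q (a + t * (x - a))) has_integral (Q (a + 1 * (x - a)) - Q (a + 0 * (x - a)))) {0..1}"
    proof (rule fundamental_theorem_of_calculus)
      fix t :: real assume t: "t \<in> {0..1}"
      let ?M = "max \<bar>a\<bar> \<bar>x\<bar>"
      have "\<bar>a + t * (x - a)\<bar> = \<bar>(1 - t) * a + t * x\<bar>" by (simp add: algebra_simps)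
      also have "\<dots> \<le> (1 - t) * \<bar>a\<bar> + t * \<bar>x\<bar>"
        using t abs_triangle_ineq[of "(1 - t) * a" "t * x"] by (simp add: abs_mult)
      also have "\<dots> \<le> (1 - t) * ?M + t * ?M"
        using t by (intro add_mono mult_left_mono) auto
      also have "\<dots> = ?M" by (simp add: algebra_simps)
      also have "\<dots> < N" using xa by simp
      finally have "\<bar>a + t * (x - a)\<bar> < N" .
      moreover have "((\<lambda>t. a + t * (x - a)) has_real_derivative x - a) (at t)"
        by (auto intro!: derivative_eq_intros)
      ultimately have "((\<lambda>t. Q (a + t * (x - a))) has_real_derivative (x - a) * q (a + t * (x - a))) (at t)"
        using DERIV_chain2[where f = Q and g = "\<lambda>t. a + t * (x - a)", OF D] by (simp add: mult.commute)
      then show "((\<lambda>t. Q (a + t * (x - a))) has_vector_derivative (x - a) * q (a + t * (x - a))) (at t within {0..1})"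
        by (simp add: has_real_derivative_iff_has_vector_derivative has_vector_derivative_at_within)
    qed simp
    then have "((\<lambda>t. (x - a) * q (a + t * (x - a))) has_integral (Q x - Q a)) {0..1}" by simp
    then show ?thesis unfolding prim_def by (rule integral_unique)
  qed
  have I: "integral {a..x} q = Q x - Q a" if xa: "\<bar>x\<bar> < N" "\<bar>a\<bar> < N" "a \<le> x" for x a
  proof (rule integral_unique[OF fundamental_theorem_of_calculus[OF xa(3)]])
    fix t assume "t \<in> {a..x}"
    then have "\<bar>t\<bar> < N" using xa by auto
    from D[OF this] show "(Q has_vector_derivative q t) (at t within {a..x})"
      by (simp add: has_real_derivative_iff_has_vector_derivative has_vector_derivative_at_within)
  qed
  show ?thesis using that[of Q] D P I by blast
qed

lemma prim_derivative:
  assumes "continuous_on UNIV q" shows "(prim a q has_real_derivative q x) (at x)"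
proof -
  define N where "N = \<bar>x\<bar> + \<bar>a\<bar> + 1"
  obtain Q where Q: "\<And>x. \<bar>x\<bar> < N \<Longrightarrow> (Q has_real_derivative q x) (at x)"
    "\<And>x a. \<bar>x\<bar> < N \<Longrightarrow> \<bar>a\<bar> < N \<Longrightarrow> prim a q x = Q x - Q a"
    using prim_antiderivative[OF assms] by metis
  have "((\<lambda>x. Q x - Q a) has_real_derivative q x) (at x)"
    using Q(1)[of x] by (auto simp: N_def intro!: derivative_eq_intros)
  then show ?thesis
  proof (rule has_field_derivative_transform_within_open[of _ _ _ "{-N<..<N}"])
    show "Q y - Q a = prim a q y" if "y \<in> {-N<..<N}" for y
    proof -
      have "\<bar>y\<bar> < N" "\<bar>a\<bar> < N" using that by (auto simp: N_def)
      from Q(2)[OF this] show ?thesis by simp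
    qed
  qed (auto simp: N_def)
qed

lemma prim_integral:
  assumes "continuous_on UNIV q" "a \<le> x" shows "prim a q x = integral {a..x} q"
proof -
  define N where "N = \<bar>x\<bar> + \<bar>a\<bar> + 1"
  obtain Q where "\<And>x a. \<bar>x\<bar> < N \<Longrightarrow> \<bar>a\<bar> < N \<Longrightarrow> prim a q x = Q x - Q a"
    "\<And>x a. \<bar>x\<bar> < N \<Longrightarrow> \<bar>a\<bar> < N \<Longrightarrow> a \<le> x \<Longrightarrow> integral {a..x} q = Q x - Q a"
    using prim_antiderivative[OF assms(1)] by metis
  then show ?thesis using assms(2) by (simp add: N_def)
qed

lemma prim_zero_left:
  assumes "\<And>x. x < a \<Longrightarrow> q x = 0" "x < a" shows "prim a q x = 0"
proof -
  have "integral {0..1} (\<lambda>t. (x - a) * q (a + t * (x - a))) = integral {0..1::real} (\<lambda>_. 0)"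
  proof (rule Henstock_Kurzweil_Integration.integral_spike[of "{0}"])
    fix t :: real assume "t \<in> {0..1} - {0}"
    then have "a + t * (x - a) < a" using assms(2) by (simp add: mult_pos_neg)
    then show "0 = (x - a) * q (a + t * (x - a))" using assms(1) by simp
  qed simp
  then show ?thesis by (simp add: prim_def)
qed

text \<open>The integral up to \<open>b\<close> is zero by hypothesis, and beyond \<open>b\<close>
  nothing is added.\<close>

lemma prim_zero_right:
  assumes q: "continuous_on UNIV q" "\<And>x. b < x \<Longrightarrow> q x = 0" "integral {a..b} q = 0" and ab: "a \<le> b" "b < x"
  shows "prim a q x = 0"
proof -
  have "integral {a..b} q + integral {b..x} q = integral {a..x} q"
    using ab by (intro Henstock_Kurzweil_Integration.integral_combine integrable_continuous_real continuous_on_subset[OF q(1)]) auto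
  moreover have "integral {b..x} q = integral {b..x} (\<lambda>_. 0)"
    by (rule Henstock_Kurzweil_Integration.integral_spike[of "{b}"]) (use q(2) in auto)
  ultimately show ?thesis using prim_integral[OF q(1), of a x] ab q(3) by simp
qed

definition square_integral :: "real^2 \<Rightarrow> real \<Rightarrow> (real^2 \<Rightarrow> real) \<Rightarrow> real" where
  "square_integral c s f =
     integral {c $ 2 - s..c $ 2 + s} (\<lambda>y. integral {c $ 1 - s..c $ 1 + s} (\<lambda>x. f (vec2 x y)))"

lemma smooth_inner_integral:
  assumes "smooth_on UNIV f"
  shows "smooth_on UNIV (\<lambda>y. integral {a..b} (\<lambda>x. f (vec2 x y)))"
proof -
  have "smooth_on UNIV (\<lambda>z::real \<times> real. f (vec2 (snd z) (fst z)))"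
    by (intro smooth_on_compose[OF assms] smooth_on_vec2 smooth_on_bounded_linear bounded_linear_fst bounded_linear_snd) auto
  from smooth_on_parameter_integral[OF this] show ?thesis by simp
qed

lemma continuous_line: "smooth_on UNIV f \<Longrightarrow> continuous_on UNIV (\<lambda>x. f (vec2 x y))"
  by (rule smooth_on_continuous_on, rule smooth_on_compose[of UNIV f]) (auto intro!: smooth_on_vec2 smooth_on_const smooth_on_id)

lemma square_integral_add:
  assumes "smooth_on UNIV f" "smooth_on UNIV g"
  shows "square_integral c s (\<lambda>y. f y + r * g y) = square_integral c s f + r * square_integral c s g"
proof -
  have i: "(\<lambda>x. h (vec2 x y)) integrable_on {a..b}" if "smooth_on UNIV h" for h y a b
    by (intro integrable_continuous_real continuous_on_subset[OF continuous_line[OF that]]) auto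
  have j: "(\<lambda>y. integral {a..b} (\<lambda>x. h (vec2 x y))) integrable_on {a'..b'}" if "smooth_on UNIV h" for h a b a' b'
    by (intro integrable_continuous_real continuous_on_subset[OF smooth_on_continuous_on[OF smooth_inner_integral[OF that]]]) auto
  have "integral {a..b} (\<lambda>x. f (vec2 x y) + r * g (vec2 x y)) = integral {a..b} (\<lambda>x. f (vec2 x y)) + r * integral {a..b} (\<lambda>x. g (vec2 x y))" for a b y
    using i assms by (subst Henstock_Kurzweil_Integration.integral_add) (use integrable_cmul[of "\<lambda>x. g (vec2 x y)" _ r] in auto)
  then show ?thesis
    unfolding square_integral_def using j assms
    using integrable_cmul[OF j[OF assms(2)], of r]
    by (simp only:) (subst Henstock_Kurzweil_Integration.integral_add, auto)
qed

text \<open>A nonnegative continuous function with zero integral vanishes; this is used along the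
  fibre through \<open>w\<close> and then for the fibre integrals.\<close>

lemma square_integral_pos:
  assumes f: "smooth_on UNIV f" and nn: "\<And>y. f y \<ge> 0" and w: "w \<in> csquare c s" "f w > 0" and s: "s > 0"
  shows "square_integral c s f > 0"
proof -
  let ?g = "\<lambda>y. integral {c $ 1 - s..c $ 1 + s} (\<lambda>x. f (vec2 x y))"
  have w': "w $ 1 \<in> {c $ 1 - s..c $ 1 + s}" "w $ 2 \<in> {c $ 2 - s..c $ 2 + s}"
    using w(1) by (auto simp: mem_csquare abs_le_iff algebra_simps)
  have gn: "?g y \<ge> 0" for y
    by (intro Henstock_Kurzweil_Integration.integral_nonneg integrable_continuous_real continuous_on_subset[OF continuous_line[OF f]] nn) auto
  have "?g (w $ 2) \<noteq> 0"
  proof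
    assume "?g (w $ 2) = 0"
    then have "\<forall>x\<in>{c $ 1 - s..c $ 1 + s}. f (vec2 x (w $ 2)) = 0"
      using integral_eq_0_iff[OF continuous_on_subset[OF continuous_line[OF f] subset_UNIV], of "c $ 1 - s" "c $ 1 + s" "w $ 2"] nn s by auto
    then have "f (vec2 (w $ 1) (w $ 2)) = 0" using w'(1) by blast
    then show False using w(2) by simp
  qed
  moreover have cg: "continuous_on {c $ 2 - s..c $ 2 + s} ?g"
    by (rule continuous_on_subset[OF smooth_on_continuous_on[OF smooth_inner_integral[OF f]]]) auto
  ultimately have "integral {c $ 2 - s..c $ 2 + s} ?g \<noteq> 0"
    using integral_eq_0_iff[OF cg] s gn w'(2) by auto
  moreover have "integral {c $ 2 - s..c $ 2 + s} ?g \<ge> 0"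
    by (intro Henstock_Kurzweil_Integration.integral_nonneg integrable_continuous_real cg gn)
  ultimately show ?thesis unfolding square_integral_def by linarith
qed

text \<open>Subtracting e(x) g(y), with \<open>g\<close> the integrals over horizontal lines and
  \<open>e\<close> a bump of integral 1, leaves a function whose horizontal integrals vanish, so its
  primitive in x keeps its support. The term e(x) g(y) is integrated in y instead, where the total
  integral of \<open>g\<close> is zero by assumption.\<close>

lemma compact_poincare:
  assumes f: "smooth_on UNIV f" "\<And>y. y \<notin> csquare c s \<Longrightarrow> f y = 0" and s: "s > 0" and I: "square_integral c s f = 0"
  obtains P R where "smooth_on UNIV P" "smooth_on UNIV R" "\<And>y. y \<notin> csquare c s \<Longrightarrow> P y = 0"
    "\<And>y. y \<notin> csquare c s \<Longrightarrow> R y = 0" "\<And>y. f y = pd1 P y + pd2 R y"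
proof -
  define a b a' b' where ab: "a = c $ 1 - s" "b = c $ 1 + s" "a' = c $ 2 - s" "b' = c $ 2 + s"
  have le: "a < b" "a' < b'" using s by (auto simp: ab)
  have out: "f (vec2 x y) = 0" if "x < a \<or> b < x \<or> y < a' \<or> b' < y" for x y
  proof (rule f(2))
    show "vec2 x y \<notin> csquare c s"
      using that unfolding mem_csquare forall_2 vec2_nth ab by (auto simp: abs_le_iff)
  qed
  have outI: "y \<notin> csquare c s \<Longrightarrow> y $ 1 < a \<or> b < y $ 1 \<or> y $ 2 < a' \<or> b' < y $ 2" for y
    unfolding mem_csquare forall_2 ab by (auto simp: abs_le_iff)
  define e0 where "e0 x = flat 0 (x - a) * flat 0 (b - x)" for x
  have se0: "smooth_on UNIV e0" unfolding e0_def
    by (intro smooth_on_mult smooth_on_flat' smooth_on_diff smooth_on_const smooth_on_id) auto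
  define e where "e x = e0 x / integral {a..b} e0" for x
  have ce0: "continuous_on {a..b} e0" by (rule continuous_on_subset[OF smooth_on_continuous_on[OF se0]]) auto
  have "integral {a..b} e0 \<noteq> 0"
  proof
    assume "integral {a..b} e0 = 0"
    moreover have "e0 x \<ge> 0" for x by (simp add: e0_def flat_nonneg)
    ultimately have "\<forall>x\<in>{a..b}. e0 x = 0" using integral_eq_0_iff[OF ce0 le(1)] by blast
    then have "e0 ((a + b) / 2) = 0" using le(1) by (auto dest!: bspec[of _ _ "(a + b) / 2"])
    moreover have "e0 ((a + b) / 2) > 0" unfolding e0_def using le(1) by (intro mult_pos_pos) (auto simp: flat_pos_iff)
    ultimately show False by simp
  qed
  then have Ie: "integral {a..b} e = 1"
  proof -
    have "e = (\<lambda>x. inverse (integral {a..b} e0) *\<^sub>R e0 x)"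
      by (simp add: fun_eq_iff e_def divide_inverse mult.commute)
    then have "integral {a..b} e = inverse (integral {a..b} e0) *\<^sub>R integral {a..b} e0"
      by (simp only: Henstock_Kurzweil_Integration.integral_cmul)
    then show ?thesis using \<open>integral {a..b} e0 \<noteq> 0\<close> by simp
  qed
  have se: "smooth_on UNIV e"
    unfolding e_def divide_inverse by (intro smooth_on_mult se0 smooth_on_const) auto
  have eout: "e x = 0" if "x < a \<or> b < x" for x using that by (auto simp: e_def e0_def flat_def)
  define g where "g y = integral {a..b} (\<lambda>x. f (vec2 x y))" for y
  have sg: "smooth_on UNIV g" unfolding g_def by (rule smooth_inner_integral[OF f(1)])
  have gout: "g y = 0" if "y < a' \<or> b' < y" for y
    unfolding g_def using out that by (metis (no_types, lifting) integral_0 integral_cong)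
  have Ig: "integral {a'..b'} g = 0" using I by (simp add: square_integral_def ab g_def[abs_def])
  define h where "h y = f y - e (y $ 1) * g (y $ 2)" for y :: "real^2"
  have sh: "smooth_on UNIV h" unfolding h_def
    by (intro smooth_on_diff smooth_on_mult f smooth_on_compose[OF se] smooth_on_compose[OF sg] smooth_on_nth) auto
  define P where "P y = prim a (\<lambda>x. h (vec2 x (y $ 2))) (y $ 1)" for y :: "real^2"
  define R where "R y = e (y $ 1) * prim a' g (y $ 2)" for y :: "real^2"
  have sP: "smooth_on UNIV P"
  proof -
    have n: "smooth_on UNIV (\<lambda>z::(real^2) \<times> real. fst z $ i)" for i
      by (intro smooth_on_bounded_linear bounded_linear_compose[OF bounded_linear_vec_nth bounded_linear_fst]) auto
    have "smooth_on UNIV (\<lambda>z::(real^2) \<times> real. (fst z $ 1 - a) * h (vec2 (a + snd z * (fst z $ 1 - a)) (fst z $ 2)))"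
      by (intro smooth_on_mult smooth_on_diff n smooth_on_const smooth_on_compose[OF sh] smooth_on_vec2 smooth_on_add
          smooth_on_bounded_linear[OF bounded_linear_snd]) auto
    from smooth_on_parameter_integral[OF this, of 0 1] show ?thesis
      unfolding P_def prim_def fst_conv snd_conv .
  qed
  have cg: "continuous_on UNIV g" by (rule smooth_on_continuous_on[OF sg])
  have "smooth_on UNIV (prim a' g)"
  proof (rule smooth_on_SucI[of _ _ "\<lambda>x v. g x * v"])
    show "(prim a' g has_derivative (\<lambda>v. g x * v)) (at x)" for x
      using prim_derivative[OF cg] by (simp add: has_field_derivative_def)
  qed (auto intro!: smooth_on_mult sg smooth_on_const)
  note sp = this
  have n: "smooth_on UNIV (\<lambda>y::real^2. y $ i)" for i by (rule smooth_on_nth) simp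
  have sR: "smooth_on UNIV R" unfolding R_def[abs_def]
    by (rule smooth_on_mult[OF smooth_on_compose[OF se n[of 1] subset_UNIV open_UNIV]
        smooth_on_compose[OF sp n[of 2] subset_UNIV open_UNIV] open_UNIV])
  have dP: "pd1 P y = h y" for y
  proof -
    have "((\<lambda>t. P (y + t *\<^sub>R e1)) has_real_derivative h (vec2 (y $ 1) (y $ 2))) (at 0)"
    proof -
      have "P (y + t *\<^sub>R e1) = prim a (\<lambda>x. h (vec2 x (y $ 2))) (y $ 1 + t)" for t
        by (simp add: P_def axis_def)
      moreover have "((\<lambda>t. prim a (\<lambda>x. h (vec2 x (y $ 2))) (y $ 1 + t)) has_real_derivative h (vec2 (y $ 1) (y $ 2))) (at 0)"
      proof -
        have 1: "((\<lambda>t. y $ 1 + t) has_real_derivative 1) (at 0)" by (auto intro!: derivative_eq_intros)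
        have 2: "(prim a (\<lambda>x. h (vec2 x (y $ 2))) has_real_derivative h (vec2 (y $ 1 + 0) (y $ 2))) (at (y $ 1 + 0))"
          by (rule prim_derivative[OF continuous_line[OF sh]])
        show ?thesis using DERIV_chain'[OF 1 2] by simp
      qed
      ultimately show ?thesis by simp
    qed
    moreover have "((\<lambda>t. P (y + t *\<^sub>R e1)) has_real_derivative pd1 P y) (at 0)"
      unfolding pd1_def by (rule directional_derivative[OF sP])
    ultimately have "pd1 P y = h (vec2 (y $ 1) (y $ 2))" using DERIV_unique by blast
    then show ?thesis by simp
  qed
  have dR: "pd2 R y = e (y $ 1) * g (y $ 2)" for y
  proof -
    have "((\<lambda>t. R (y + t *\<^sub>R e2)) has_real_derivative e (y $ 1) * g (y $ 2)) (at 0)"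
    proof -
      have "R (y + t *\<^sub>R e2) = e (y $ 1) * prim a' g (y $ 2 + t)" for t
        by (simp add: R_def axis_def)
      moreover have "((\<lambda>t. e (y $ 1) * prim a' g (y $ 2 + t)) has_real_derivative e (y $ 1) * g (y $ 2)) (at 0)"
      proof -
        have 1: "((\<lambda>t. y $ 2 + t) has_real_derivative 1) (at 0)" by (auto intro!: derivative_eq_intros)
        have 2: "(prim a' g has_real_derivative g (y $ 2 + 0)) (at (y $ 2 + 0))"
          by (rule prim_derivative[OF cg])
        show ?thesis using DERIV_cmult[OF DERIV_chain'[OF 1 2]] by simp
      qed
      ultimately show ?thesis by simp
    qed
    moreover have "((\<lambda>t. R (y + t *\<^sub>R e2)) has_real_derivative pd2 R y) (at 0)"
      unfolding pd2_def by (rule directional_derivative[OF sR])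
    ultimately show ?thesis using DERIV_unique by blast
  qed
  have Rout: "R y = 0" if "y \<notin> csquare c s" for y
    using outI[OF that] eout prim_zero_left[of a' g "y $ 2"] gout prim_zero_right[OF cg _ Ig, of "y $ 2"] le
    by (auto simp: R_def)
  have Pout: "P y = 0" if yo: "y \<notin> csquare c s" for y
  proof -
    let ?q = "\<lambda>x. h (vec2 x (y $ 2))"
    have cq: "continuous_on UNIV ?q" by (rule continuous_line[OF sh])
    have q0: "?q x = 0" if "x < a \<or> b < x" for x
    proof -
      have "f (vec2 x (y $ 2)) = 0" by (rule out) (use that in blast)
      then show ?thesis using eout[OF that] by (simp add: h_def)
    qed
    have "integral {a..b} ?q = integral {a..b} (\<lambda>x. f (vec2 x (y $ 2))) - integral {a..b} (\<lambda>x. e x * g (y $ 2))"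
      unfolding h_def vec2_nth
      by (intro Henstock_Kurzweil_Integration.integral_diff integrable_continuous_real continuous_on_subset[OF continuous_line[OF f(1)]]
          continuous_on_mult continuous_on_subset[OF smooth_on_continuous_on[OF se]] continuous_on_const) auto
    also have "\<dots> = 0" by (simp add: g_def Ie)
    finally have Iq: "integral {a..b} ?q = 0" .
    consider "y $ 1 < a" | "b < y $ 1" | "y $ 2 < a' \<or> b' < y $ 2" using outI[OF yo] by blast
    then show ?thesis
    proof cases
      case 1
      have "?q x = 0" if "x < a" for x using q0 that by simp
      from prim_zero_left[OF this 1] show ?thesis unfolding P_def .
    next
      case 2
      have "?q x = 0" if "b < x" for x using q0 that by simp
      from prim_zero_right[OF cq this Iq less_imp_le[OF le(1)] 2] show ?thesis unfolding P_def .
    next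
      case 3
      then have "?q = (\<lambda>_. 0)" using out gout by (auto simp: h_def)
      then show ?thesis by (simp add: P_def prim_def)
    qed
  qed
  show ?thesis
    by (rule that[OF sP sR Pout Rout]) (simp_all add: dP dR h_def)
qed

section \<open>Two-forms on the surface modulo exact forms\<close>

context square_cover
begin

section \<open>Coordinate changes, differentials and exactness\<close>

definition trans :: "nat \<Rightarrow> nat \<Rightarrow> real^2 \<Rightarrow> real^2 \<Rightarrow> real^2" where
  "trans k l y = frechet_derivative (\<lambda>y. \<phi> l (\<psi> k y)) (at y)"

definition jac :: "nat \<Rightarrow> nat \<Rightarrow> real^2 \<Rightarrow> real" where
  "jac k l y = det (matrix (trans k l y))"

lemma trans_has_derivative:
  assumes "k < m" "l < m" "z \<in> U k" "z \<in> U l"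
  shows "((\<lambda>y. \<phi> l (\<psi> k y)) has_derivative trans k l (\<phi> k z)) (at (\<phi> k z))"
  using transition_smooth[OF assms(2,1)] assms unfolding trans_def oriented_smooth_on_def
  by (intro smooth_on_has_derivative[of "\<phi> k ` (U k \<inter> U l)"]) auto

lemma linear_trans: "k < m \<Longrightarrow> l < m \<Longrightarrow> z \<in> U k \<Longrightarrow> z \<in> U l \<Longrightarrow> linear (trans k l (\<phi> k z))"
  using trans_has_derivative has_derivative_linear by blast

lemma jac_pos: "k < m \<Longrightarrow> l < m \<Longrightarrow> z \<in> U k \<Longrightarrow> z \<in> U l \<Longrightarrow> jac k l (\<phi> k z) > 0"
  using transition_smooth[of l k] by (auto simp: oriented_smooth_on_def positive_jacobian_on_def jac_def trans_def)

lemma trans_cocycle: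
  assumes "k < m" "l < m" "n < m" "z \<in> U k" "z \<in> U l" "z \<in> U n"
  shows "trans k n (\<phi> k z) v = trans l n (\<phi> l z) (trans k l (\<phi> k z) v)"
proof -
  have "((\<lambda>y. \<phi> n (\<psi> l (\<phi> l (\<psi> k y)))) has_derivative (\<lambda>v. trans l n (\<phi> l z) (trans k l (\<phi> k z) v))) (at (\<phi> k z))"
    using diff_chain_at[OF trans_has_derivative[OF assms(1,2,4,5)], of "\<lambda>y. \<phi> n (\<psi> l y)" "trans l n (\<phi> l z)"]
      trans_has_derivative[OF assms(2,3,5,6)] assms by (simp add: o_def psi_phi)
  then have "((\<lambda>y. \<phi> n (\<psi> k y)) has_derivative (\<lambda>v. trans l n (\<phi> l z) (trans k l (\<phi> k z) v))) (at (\<phi> k z))"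
    by (rule has_derivative_transform_within_open[OF _ open_phi[OF assms(1) openin_U[OF assms(2)]]])
      (use assms in \<open>auto simp: psi_phi\<close>)
  then show ?thesis using has_derivative_unique[OF trans_has_derivative[OF assms(1,3,4,6)]] by metis
qed

lemma jac_cocycle:
  assumes "k < m" "l < m" "n < m" "z \<in> U k" "z \<in> U l" "z \<in> U n"
  shows "jac k n (\<phi> k z) = jac l n (\<phi> l z) * jac k l (\<phi> k z)"
proof -
  have "trans k n (\<phi> k z) = (\<lambda>v. trans l n (\<phi> l z) (trans k l (\<phi> k z) v))"
    using trans_cocycle[OF assms] by blast
  then show ?thesis
    using det_matrix_compose[OF linear_trans[OF assms(1,2,4,5)] linear_trans[OF assms(2,3,5,6)]] by (simp add: jac_def)
qed

lemma smooth_jac: "k < m \<Longrightarrow> l < m \<Longrightarrow> smooth_on (\<phi> k ` (U k \<inter> U l)) (jac k l)"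
proof -
  assume kl: "k < m" "l < m"
  have o: "open (\<phi> k ` (U k \<inter> U l))" by (intro open_phi openin_U kl)
  have "smooth_on (\<phi> k ` (U k \<inter> U l)) (\<lambda>y. trans k l y v)" for v
    unfolding trans_def using transition_smooth[OF kl(2,1)] by (intro smooth_on_derivative) (simp add: oriented_smooth_on_def)
  then have "smooth_on (\<phi> k ` (U k \<inter> U l)) (\<lambda>y. trans k l y v $ i)" for v i
    by (rule smooth_on_compose[OF smooth_on_nth[OF open_UNIV] _ _ o]) auto
  then show ?thesis
    unfolding jac_def det_matrix_2 by (intro smooth_on_diff smooth_on_mult o)
qed

definition dd :: "nat \<Rightarrow> ('a \<Rightarrow> real) \<Rightarrow> real^2 \<Rightarrow> real^2 \<Rightarrow> real" where
  "dd k u y = frechet_derivative (\<lambda>y. u (\<psi> k y)) (at y)"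

lemma dd_has_derivative:
  assumes "smooth_fn W u" "k < m" "z \<in> U k" "z \<in> W"
  shows "((\<lambda>y. u (\<psi> k y)) has_derivative dd k u (\<phi> k z)) (at (\<phi> k z))"
  unfolding dd_def using assms by (intro smooth_on_has_derivative[of "\<phi> k ` (U k \<inter> W)"]) (auto simp: smooth_fn_def)

lemma linear_dd: "smooth_fn W u \<Longrightarrow> k < m \<Longrightarrow> z \<in> U k \<Longrightarrow> z \<in> W \<Longrightarrow> linear (dd k u (\<phi> k z))"
  using dd_has_derivative has_derivative_linear by blast

lemma dd_transition:
  assumes "smooth_fn W u" "openin (top_of_set X) W" "k < m" "l < m" "z \<in> U k" "z \<in> U l" "z \<in> W"
  shows "dd k u (\<phi> k z) v = dd l u (\<phi> l z) (trans k l (\<phi> k z) v)"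
proof -
  have "((\<lambda>y. u (\<psi> l (\<phi> l (\<psi> k y)))) has_derivative (\<lambda>v. dd l u (\<phi> l z) (trans k l (\<phi> k z) v))) (at (\<phi> k z))"
    using diff_chain_at[OF trans_has_derivative[OF assms(3-6)], of "\<lambda>y. u (\<psi> l y)" "dd l u (\<phi> l z)"]
      dd_has_derivative[OF assms(1,4,6,7)] assms by (simp add: o_def psi_phi)
  then have "((\<lambda>y. u (\<psi> k y)) has_derivative (\<lambda>v. dd l u (\<phi> l z) (trans k l (\<phi> k z) v))) (at (\<phi> k z))"
    by (rule has_derivative_transform_within_open[OF _ open_phi[OF assms(3) openin_U[OF assms(4)]]])
      (use assms in \<open>auto simp: psi_phi\<close>)
  then show ?thesis using has_derivative_unique[OF dd_has_derivative[OF assms(1,3,5,7)]] by metis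
qed

text \<open>Differentials ignore additive constants; this makes the differentials of potentials from
  different squares agree.\<close>

lemma dd_cong:
  assumes "k < m" "z \<in> U k" "openin (top_of_set X) N" "z \<in> N" "\<And>w. w \<in> N \<Longrightarrow> u w = v w + r" "smooth_fn N v"
  shows "dd k u (\<phi> k z) = dd k v (\<phi> k z)"
proof -
  have "((\<lambda>y. v (\<psi> k y) + r) has_derivative dd k v (\<phi> k z)) (at (\<phi> k z))"
    using has_derivative_add[OF dd_has_derivative[OF assms(6,1,2,4)] has_derivative_const[of r]] by simp
  then have "((\<lambda>y. u (\<psi> k y)) has_derivative dd k v (\<phi> k z)) (at (\<phi> k z))"
    by (rule has_derivative_transform_within_open[OF _ open_phi[OF assms(1,3)]]) (use assms in \<open>auto simp: psi_phi\<close>)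
  then show ?thesis unfolding dd_def using frechet_derivative_at by metis
qed

text \<open>The coefficient of du \<and> dv in the coordinates of chart \<open>k\<close>.\<close>

definition wedge :: "nat \<Rightarrow> ('a \<Rightarrow> real) \<Rightarrow> ('a \<Rightarrow> real) \<Rightarrow> 'a \<Rightarrow> real" where
  "wedge k u v z = dd k u (\<phi> k z) e1 * dd k v (\<phi> k z) e2 - dd k u (\<phi> k z) e2 * dd k v (\<phi> k z) e1"

text \<open>Expanding both covectors in the basis of chart \<open>l\<close> produces the determinant
  of the coordinate change.\<close>

lemma wedge_transition:
  assumes "smooth_fn W u" "smooth_fn W v" "openin (top_of_set X) W" "k < m" "l < m" "z \<in> U k" "z \<in> U l" "z \<in> W"
  shows "wedge k u v z = jac k l (\<phi> k z) * wedge l u v z"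
proof -
  let ?T = "trans k l (\<phi> k z)"
  have u: "dd k u (\<phi> k z) w = ?T w $ 1 * dd l u (\<phi> l z) e1 + ?T w $ 2 * dd l u (\<phi> l z) e2" for w
    using dd_transition[OF assms(1,3-8)] linear_real2[OF linear_dd[OF assms(1,5,7,8)], of "?T w"] by simp
  have v: "dd k v (\<phi> k z) w = ?T w $ 1 * dd l v (\<phi> l z) e1 + ?T w $ 2 * dd l v (\<phi> l z) e2" for w
    using dd_transition[OF assms(2,3-8)] linear_real2[OF linear_dd[OF assms(2,5,7,8)], of "?T w"] by simp
  show ?thesis unfolding wedge_def u v jac_def det_matrix_2 by (simp add: algebra_simps)
qed

text \<open>A one-form is given by its coordinate covectors in all charts; a two-form by its densities.\<close>

definition one_form :: "(nat \<Rightarrow> real^2 \<Rightarrow> real^2 \<Rightarrow> real) \<Rightarrow> bool" where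
  "one_form \<eta> \<longleftrightarrow>
     (\<forall>k<m. \<forall>v. smooth_on (\<phi> k ` U k) (\<lambda>y. \<eta> k y v)) \<and>
     (\<forall>k<m. \<forall>z\<in>U k. linear (\<eta> k (\<phi> k z))) \<and>
     (\<forall>k<m. \<forall>l<m. \<forall>z\<in>U k \<inter> U l. \<forall>v. \<eta> k (\<phi> k z) v = \<eta> l (\<phi> l z) (trans k l (\<phi> k z) v))"

lemma one_formD:
  assumes "one_form \<eta>"
  shows "k < m \<Longrightarrow> smooth_on (\<phi> k ` U k) (\<lambda>y. \<eta> k y v)"
    and "k < m \<Longrightarrow> z \<in> U k \<Longrightarrow> linear (\<eta> k (\<phi> k z))"
    and "k < m \<Longrightarrow> l < m \<Longrightarrow> z \<in> U k \<Longrightarrow> z \<in> U l \<Longrightarrow> \<eta> k (\<phi> k z) v = \<eta> l (\<phi> l z) (trans k l (\<phi> k z) v)"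
  using assms unfolding one_form_def by blast+

text \<open>The coefficient of the exterior derivative d\<eta> in chart \<open>k\<close>.\<close>

definition curl :: "(nat \<Rightarrow> real^2 \<Rightarrow> real^2 \<Rightarrow> real) \<Rightarrow> nat \<Rightarrow> 'a \<Rightarrow> real" where
  "curl \<eta> k z = frechet_derivative (\<lambda>y. \<eta> k y e2) (at (\<phi> k z)) e1 - frechet_derivative (\<lambda>y. \<eta> k y e1) (at (\<phi> k z)) e2"

definition exact :: "(nat \<Rightarrow> 'a \<Rightarrow> real) \<Rightarrow> bool" where
  "exact \<omega> \<longleftrightarrow> (\<exists>\<eta>. one_form \<eta> \<and> (\<forall>k<m. \<forall>z\<in>U k. \<omega> k z = curl \<eta> k z))"

lemma exact_cong: "exact \<omega> \<Longrightarrow> (\<And>k z. k < m \<Longrightarrow> z \<in> U k \<Longrightarrow> \<omega>' k z = \<omega> k z) \<Longrightarrow> exact \<omega>'"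
  unfolding exact_def by metis

lemma exact_lincomb:
  assumes "exact \<omega>" "exact \<omega>'"
  shows "exact (\<lambda>k z. s * \<omega> k z + t * \<omega>' k z)"
proof -
  obtain \<eta> \<eta>' where e: "one_form \<eta>" "\<And>k z. k < m \<Longrightarrow> z \<in> U k \<Longrightarrow> \<omega> k z = curl \<eta> k z"
    "one_form \<eta>'" "\<And>k z. k < m \<Longrightarrow> z \<in> U k \<Longrightarrow> \<omega>' k z = curl \<eta>' k z"
    using assms unfolding exact_def by blast
  define \<theta> where "\<theta> k y v = s * \<eta> k y v + t * \<eta>' k y v" for k y v
  have "one_form \<theta>"
    unfolding one_form_def
  proof (intro conjI allI impI ballI)
    show "smooth_on (\<phi> k ` U k) (\<lambda>y. \<theta> k y v)" if "k < m" for k v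
      unfolding \<theta>_def using e(1,3) that
      by (intro smooth_on_add smooth_on_mult smooth_on_const open_phi_U) (auto simp: one_form_def)
    show "linear (\<theta> k (\<phi> k z))" if "k < m" "z \<in> U k" for k z
    proof -
      have "linear (\<eta> k (\<phi> k z))" "linear (\<eta>' k (\<phi> k z))" using e(1,3) that by (auto simp: one_form_def)
      then show ?thesis unfolding \<theta>_def
        by (intro linearI) (auto simp: linear_add linear_cmul algebra_simps)
    qed
    show "\<theta> k (\<phi> k z) v = \<theta> l (\<phi> l z) (trans k l (\<phi> k z) v)" if "k < m" "l < m" "z \<in> U k \<inter> U l" for k l z v
    proof -
      have "\<eta> k (\<phi> k z) v = \<eta> l (\<phi> l z) (trans k l (\<phi> k z) v)" "\<eta>' k (\<phi> k z) v = \<eta>' l (\<phi> l z) (trans k l (\<phi> k z) v)"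
        using one_formD(3)[OF e(1) that(1,2)] one_formD(3)[OF e(3) that(1,2)] that(3) by blast+
      then show ?thesis by (simp only: \<theta>_def)
    qed
  qed
  moreover have "s * \<omega> k z + t * \<omega>' k z = curl \<theta> k z" if k: "k < m" "z \<in> U k" for k z
  proof -
    have d: "((\<lambda>y. \<eta> k y v) has_derivative frechet_derivative (\<lambda>y. \<eta> k y v) (at (\<phi> k z))) (at (\<phi> k z))"
      "((\<lambda>y. \<eta>' k y v) has_derivative frechet_derivative (\<lambda>y. \<eta>' k y v) (at (\<phi> k z))) (at (\<phi> k z))" for v
      using smooth_on_has_derivative[OF one_formD(1)[OF e(1) k(1)]] smooth_on_has_derivative[OF one_formD(1)[OF e(3) k(1)]] k(2)
      by blast+
    have d': "((\<lambda>y. \<theta> k y v) has_derivative (\<lambda>w. s * frechet_derivative (\<lambda>y. \<eta> k y v) (at (\<phi> k z)) w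
        + t * frechet_derivative (\<lambda>y. \<eta>' k y v) (at (\<phi> k z)) w)) (at (\<phi> k z))" for v
      unfolding \<theta>_def by (intro has_derivative_add has_derivative_mult_right d)
    have D: "frechet_derivative (\<lambda>y. \<theta> k y v) (at (\<phi> k z)) = (\<lambda>w. s * frechet_derivative (\<lambda>y. \<eta> k y v) (at (\<phi> k z)) w
        + t * frechet_derivative (\<lambda>y. \<eta>' k y v) (at (\<phi> k z)) w)" for v
      by (rule frechet_derivative_at[OF d', symmetric])
    show ?thesis unfolding e(2)[OF k] e(4)[OF k] curl_def D by (simp add: algebra_simps)
  qed
  ultimately show ?thesis unfolding exact_def by blast
qed

text \<open>du \<and> dv = d(u dv), since the second derivatives of \<open>v\<close> cancel by
  symmetry.\<close>

lemma exact_wedge: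
  assumes u: "smooth_fn X u" and v: "smooth_fn X v" shows "exact (\<lambda>k. wedge k u v)"
  unfolding exact_def
proof (intro exI conjI allI impI ballI)
  let ?\<eta> = "\<lambda>k y w. u (\<psi> k y) * dd k v y w"
  have o: "openin (top_of_set X) X" by auto
  have su: "smooth_on (\<phi> k ` U k) (\<lambda>y. u (\<psi> k y))" "smooth_on (\<phi> k ` U k) (\<lambda>y. v (\<psi> k y))" if "k < m" for k
    using u v that U_sub[OF that] by (auto simp: smooth_fn_def Int_absorb2)
  have sd: "smooth_on (\<phi> k ` U k) (\<lambda>y. dd k v y w)" if "k < m" for k w
    unfolding dd_def by (rule smooth_on_derivative[OF su(2)[OF that]])
  show "one_form ?\<eta>"
    unfolding one_form_def
  proof (intro conjI allI impI ballI)
    show "smooth_on (\<phi> k ` U k) (\<lambda>y. u (\<psi> k y) * dd k v y w)" if "k < m" for k w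
      by (intro smooth_on_mult su sd open_phi_U that)
    show "linear (\<lambda>w. u (\<psi> k (\<phi> k z)) * dd k v (\<phi> k z) w)" if "k < m" "z \<in> U k" for k z
      using linear_dd[OF v that] U_sub that by (intro linearI) (auto simp: linear_add linear_cmul algebra_simps subset_iff)
    show "u (\<psi> k (\<phi> k z)) * dd k v (\<phi> k z) w = u (\<psi> l (\<phi> l z)) * dd l v (\<phi> l z) (trans k l (\<phi> k z) w)"
      if "k < m" "l < m" "z \<in> U k \<inter> U l" for k l z w
      using dd_transition[OF v o that(1,2)] that U_sub[OF that(1)] by (auto simp: psi_phi)
  qed
  fix k z assume k: "k < m" and z: "z \<in> U k"
  have p: "\<phi> k z \<in> \<phi> k ` U k" using z by blast
  have "frechet_derivative (\<lambda>y. u (\<psi> k y) * dd k v y w) (at (\<phi> k z)) =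
     (\<lambda>x. u (\<psi> k (\<phi> k z)) * frechet_derivative (\<lambda>y. dd k v y w) (at (\<phi> k z)) x + dd k u (\<phi> k z) x * dd k v (\<phi> k z) w)" for w
    unfolding dd_def[of k u]
    by (rule frechet_derivative_at[OF has_derivative_mult[OF smooth_on_has_derivative[OF su(1)[OF k] p] smooth_on_has_derivative[OF sd[OF k] p]], symmetric])
  then show "wedge k u v z = curl ?\<eta> k z"
    using smooth_on_mixed_derivatives[OF su(2)[OF k] open_phi_U[OF k] p, of e1 e2]
    by (simp add: curl_def wedge_def dd_def algebra_simps)
qed

text \<open>The two-form with density \<open>f\<close> in chart \<open>l\<close>, extended by zero
  and read in every chart \<open>k\<close>.\<close>

definition form :: "nat \<Rightarrow> (real^2 \<Rightarrow> real) \<Rightarrow> nat \<Rightarrow> 'a \<Rightarrow> real" where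
  "form l f k z = (if z \<in> U l then jac k l (\<phi> k z) * f (\<phi> l z) else 0)"

lemma form_lincomb: "form l (\<lambda>y. s * f y + t * g y) k z = s * form l f k z + t * form l g k z"
  by (simp add: form_def algebra_simps)

text \<open>The form is dP \<and> dy_j. To have global functions as factors, \<open>P\<close> is
  extended by zero and the coordinate is cut off by a plateau equal to 1 around the support of
  \<open>P\<close>. The index \<open>j = 2\<close> gives the density \<open>pd1 P\<close>, and
  \<open>j = 1\<close> gives \<open>- pd2 P\<close>.\<close>

lemma exact_form_derivative:
  assumes l: "l < m" and P: "smooth_on UNIV P" "\<And>y. y \<notin> csquare (c l) (2 * rad l) \<Longrightarrow> P y = 0"
  shows "exact (form l (\<lambda>y. pd1 P y * e2 $ j - pd2 P y * e1 $ j))"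
proof -
  define u where "u = zero_ext l P"
  define v where "v = zero_ext l (\<lambda>y. square_plateau (c l) (rad l) y * y $ j)"
  have su: "smooth_fn X u" unfolding u_def by (rule smooth_fn_zero_ext[OF l, of 2]) (use P in auto)
  have sv: "smooth_fn X v" unfolding v_def
    by (rule smooth_fn_zero_ext[OF l, of 3])
      (use square_plateau_outside[OF rad[OF l]] in \<open>auto intro!: smooth_on_mult smooth_square_plateau smooth_on_nth\<close>)
  have o: "openin (top_of_set X) X" by auto
  have "form l (\<lambda>y. pd1 P y * e2 $ j - pd2 P y * e1 $ j) k z = wedge k u v z" if k: "k < m" "z \<in> U k" for k z
  proof (cases "z \<in> csq' l 2")
    case True
    then have z: "z \<in> U l" "\<phi> l z \<in> csquare (c l) (2 * rad l)" using csq'_mem[OF l] by auto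
    then have zX: "z \<in> X" using U_sub l by blast
    have "dd l u (\<phi> l z) = frechet_derivative P (at (\<phi> l z))"
    proof -
      have "((\<lambda>y. u (\<psi> l y)) has_derivative frechet_derivative P (at (\<phi> l z))) (at (\<phi> l z))"
        by (rule has_derivative_transform_within_open[OF smooth_on_has_derivative[OF P(1)] open_phi_U[OF l]])
          (use z in \<open>auto simp: u_def zero_ext_def psi_phi l\<close>)
      then show ?thesis unfolding dd_def using frechet_derivative_at by metis
    qed
    moreover have "dd l v (\<phi> l z) = (\<lambda>w. w $ j)"
    proof -
      have "((\<lambda>y. y $ j) has_derivative (\<lambda>w. w $ j)) (at (\<phi> l z))"
        by (intro bounded_linear_imp_has_derivative bounded_linear_vec_nth)
      then have "((\<lambda>y. v (\<psi> l y)) has_derivative (\<lambda>w. w $ j)) (at (\<phi> l z))"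
      proof (rule has_derivative_transform_within_open)
        \<comment> \<open>The factor 5/2 lies between the support bound 2 of \<open>P\<close> and
          the bound 3 of the cutoff, so the cutoff is 1 near the point.\<close>
        show "open (square (c l) (5/2 * rad l))" by (rule open_square)
        show "\<phi> l z \<in> square (c l) (5/2 * rad l)"
          using z(2) csquare_subset_square[of "2 * rad l" "5/2 * rad l"] rad[OF l] by auto
        fix y assume y: "y \<in> square (c l) (5/2 * rad l)"
        then have "y \<in> \<phi> l ` U l" using square_sub[OF l, of "5/2"] by auto
        then show "y $ j = v (\<psi> l y)"
          using square_plateau_1[OF rad[OF l] y] by (auto simp: v_def zero_ext_def phi_psi)
      qed
      then show ?thesis unfolding dd_def using frechet_derivative_at by metis
    qed
    ultimately have "wedge l u v z = pd1 P (\<phi> l z) * e2 $ j - pd2 P (\<phi> l z) * e1 $ j"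
      by (simp add: wedge_def pd1_def pd2_def)
    then show ?thesis using wedge_transition[OF su sv o k(1) l k(2) z(1) zX] z(1) by (simp add: form_def)
  next
    case False
    have oN: "openin (top_of_set X) (X - csq' l 2)" by (intro openin_diff closedin_csq' l) auto
    have zX: "z \<in> X" using U_sub k by blast
    have "dd k u (\<phi> k z) = dd k (\<lambda>_. 0) (\<phi> k z)"
      by (rule dd_cong[OF k oN _ _ smooth_fn_const[OF oN], of _ _ 0])
        (use False zX zero_ext_outside[OF l, of 2 P] P(2) in \<open>auto simp: u_def\<close>)
    also have "\<dots> = (\<lambda>_. 0)" unfolding dd_def by (rule frechet_derivative_const)
    finally have "wedge k u v z = 0" by (simp add: wedge_def)
    moreover have "form l (\<lambda>y. pd1 P y * e2 $ j - pd2 P y * e1 $ j) k z = 0"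
    proof (cases "z \<in> U l")
      case True
      then have "\<phi> l z \<notin> csquare (c l) (2 * rad l)" using False csq'_mem[OF l, of 2] by auto
      then have "frechet_derivative P (at (\<phi> l z)) = (\<lambda>_. 0)"
        by (intro frechet_derivative_outside_support[where f = P and C = "csquare (c l) (2 * rad l)"]
            compact_imp_closed compact_csquare P(2))
      then show ?thesis by (simp add: form_def pd1_def pd2_def)
    qed (simp add: form_def)
    ultimately show ?thesis by simp
  qed
  then show ?thesis using exact_cong[OF exact_wedge[OF su sv]] by blast
qed

section \<open>Forms supported in a single square and their masses\<close>

definition admissible :: "nat \<Rightarrow> (real^2 \<Rightarrow> real) \<Rightarrow> bool" where
  "admissible l f \<longleftrightarrow> smooth_on UNIV f \<and> (\<forall>y. y \<notin> csquare (c l) (2 * rad l) \<longrightarrow> f y = 0)"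

definition mass :: "nat \<Rightarrow> (real^2 \<Rightarrow> real) \<Rightarrow> real" where
  "mass l f = square_integral (c l) (2 * rad l) f"

lemma exact_form_mass_zero:
  assumes l: "l < m" and f: "admissible l f" "mass l f = 0"
  shows "exact (form l f)"
proof -
  obtain P R where PR: "smooth_on UNIV P" "smooth_on UNIV R" "\<And>y. y \<notin> csquare (c l) (2 * rad l) \<Longrightarrow> P y = 0"
    "\<And>y. y \<notin> csquare (c l) (2 * rad l) \<Longrightarrow> R y = 0" "\<And>y. f y = pd1 P y + pd2 R y"
    using compact_poincare[of f "c l" "2 * rad l"] f rad[OF l] by (auto simp: admissible_def mass_def)
  \<comment> \<open>The coefficient -1 turns the density \<open>- pd2 R\<close> belonging to index 1
    into \<open>pd2 R\<close>.\<close>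
  have "exact (\<lambda>k z. 1 * form l (\<lambda>y. pd1 P y * e2 $ 2 - pd2 P y * e1 $ 2) k z
     + (-1) * form l (\<lambda>y. pd1 R y * e2 $ 1 - pd2 R y * e1 $ 1) k z)"
    by (intro exact_lincomb exact_form_derivative l PR)
  then show ?thesis
    by (rule exact_cong) (auto simp: form_def axis_def PR(5) algebra_simps)
qed

text \<open>Subtracting the right multiple of \<open>g\<close> makes the mass vanish.\<close>

lemma exact_form_proportional:
  assumes l: "l < m" and f: "admissible l f" and g: "admissible l g" "mass l g \<noteq> 0"
  shows "exact (\<lambda>k z. form l f k z - (mass l f / mass l g) * form l g k z)"
proof -
  let ?r = "- (mass l f / mass l g)"
  have "admissible l (\<lambda>y. 1 * f y + ?r * g y)"
    using f g(1) unfolding admissible_def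
    by (intro conjI smooth_on_add smooth_on_mult smooth_on_const) auto
  moreover have "mass l (\<lambda>y. 1 * f y + ?r * g y) = 0"
    using square_integral_add[of f g "c l" "2 * rad l" ?r] f g by (simp add: admissible_def mass_def)
  ultimately have "exact (form l (\<lambda>y. 1 * f y + ?r * g y))" by (rule exact_form_mass_zero[OF l])
  then show ?thesis by (rule exact_cong) (unfold form_lincomb, simp)
qed

text \<open>One bump supported in both squares, written as \<open>f\<close> in chart
  \<open>k\<close> and as \<open>g\<close> in chart \<open>l\<close>. Both masses are positive
  because the coordinate change has positive Jacobian; here the orientation of the surface
  enters.\<close>

lemma common_bump:
  assumes k: "k < m" and l: "l < m" and z: "z \<in> sq k 2" "z \<in> sq l 2"
  obtains f g where "admissible k f" "mass k f \<noteq> 0" "admissible l g" "mass l g \<noteq> 0"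
    "\<And>n w. n < m \<Longrightarrow> w \<in> U n \<Longrightarrow> form k f n w = form l g n w"
proof -
  have zU: "z \<in> U k" "z \<in> U l" using z by (auto simp: sq_def)
  have "open (\<phi> k ` (U k \<inter> (sq k 2 \<inter> sq l 2)))" by (intro open_phi k openin_Int openin_sq l)
  moreover have "\<phi> k z \<in> \<phi> k ` (U k \<inter> (sq k 2 \<inter> sq l 2))" using z zU by blast
  ultimately obtain s where s: "s > 0" "csquare (\<phi> k z) s \<subseteq> \<phi> k ` (U k \<inter> (sq k 2 \<inter> sq l 2))"
    using small_csquare by blast
  define f where "f = square_bump (\<phi> k z) s"
  let ?C = "csquare (\<phi> k z) s"
  have fout: "f y = 0" if "y \<notin> ?C" for y
    using that square_bump_outside square_subset_csquare[of s s "\<phi> k z"] unfolding f_def by blast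
  have Cin: "\<psi> k y \<in> sq k 2 \<inter> sq l 2 \<and> y \<in> \<phi> k ` U k \<and> y = \<phi> k (\<psi> k y)" if "y \<in> ?C" for y
  proof -
    obtain w where "w \<in> U k" "w \<in> sq k 2" "w \<in> sq l 2" "y = \<phi> k w" using s(2) \<open>y \<in> ?C\<close> by blast
    then show ?thesis using psi_phi[OF k] by auto
  qed
  have fz: "f (\<phi> k z) > 0" unfolding f_def using s(1) by (simp add: square_bump_pos centre_in_square)
  have adf: "admissible k f"
    unfolding admissible_def
  proof (intro conjI allI impI)
    show "smooth_on UNIV f" unfolding f_def by (rule smooth_square_bump)
    show "f y = 0" if "y \<notin> csquare (c k) (2 * rad k)" for y
    proof (rule fout)
      show "y \<notin> ?C"
      proof
        assume "y \<in> ?C"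
        then have "y \<in> square (c k) (2 * rad k)" using Cin by (metis IntD1 IntD2 sq_def vimageE)
        then show False using that square_subset_csquare[of "2 * rad k" "2 * rad k"] by blast
      qed
    qed
  qed
  have sqc: "\<phi> n w \<in> csquare (c n) (2 * rad n)" if "w \<in> sq n 2" for n w
    using that square_subset_csquare[of "2 * rad n" "2 * rad n" "c n"] by (auto simp: sq_def)
  have mf: "mass k f > 0"
    unfolding mass_def
    by (rule square_integral_pos[where f = f and w = "\<phi> k z", OF _ _ sqc[OF z(1)] fz])
      (use adf rad[OF k] in \<open>auto simp: admissible_def f_def square_bump_nonneg\<close>)
  define g where "g y = (if y \<in> \<phi> l ` (U l \<inter> U k) then jac l k y * f (\<phi> k (\<psi> l y)) else 0)" for y
  define K where "K = \<psi> k ` ?C"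
  have KU: "K \<subseteq> sq k 2 \<inter> sq l 2" unfolding K_def using Cin by blast
  have gK: "g (\<phi> l w) = 0" if "w \<in> U l" "w \<notin> K" for w
  proof -
    have "f (\<phi> k w) = 0" if "w \<in> U k"
      using fout[of "\<phi> k w"] \<open>w \<notin> K\<close> psi_phi[OF k that] unfolding K_def by (metis imageI)
    moreover have "w \<in> U k" if "\<phi> l w \<in> \<phi> l ` (U l \<inter> U k)"
      using that psi_phi[OF l] \<open>w \<in> U l\<close> by (metis IntE imageE)
    ultimately show ?thesis using psi_phi[OF l \<open>w \<in> U l\<close>] by (auto simp: g_def)
  qed
  have gout: "g y = 0" if "y \<notin> \<phi> l ` K" for y
  proof (cases "y \<in> \<phi> l ` U l")
    case True
    then obtain w where "w \<in> U l" "y = \<phi> l w" by blast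
    then show ?thesis using gK that by blast
  next
    case False
    then have "y \<notin> \<phi> l ` (U l \<inter> U k)" by blast
    then show ?thesis by (simp add: g_def)
  qed
  have cK: "compact (\<phi> l ` K)"
  proof (rule compact_continuous_image)
    show "continuous_on K (\<phi> l)" by (rule continuous_on_subset[OF chart_continuous(1)[OF charts[OF l]]]) (use KU in \<open>auto simp: sq_def\<close>)
    show "compact K" unfolding K_def \<psi>_def
      by (rule compact_continuous_image[OF continuous_on_subset[OF chart_continuous(2)[OF charts[OF k]]] compact_csquare]) (use Cin in blast)
  qed
  have o: "open (\<phi> l ` (U l \<inter> U k))" by (intro open_phi l openin_U k)
  have sg: "smooth_on UNIV g"
  proof (rule smooth_on_local)
    fix y :: "real^2"
    show "\<exists>N. open N \<and> y \<in> N \<and> smooth_on N g"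
    proof (cases "y \<in> \<phi> l ` K")
      case True
      have "smooth_on (\<phi> l ` (U l \<inter> U k)) (\<lambda>y. \<phi> k (\<psi> l y))" "smooth_on UNIV f"
        using transition_smooth[OF k l] adf by (simp_all add: oriented_smooth_on_def admissible_def)
      from smooth_on_mult[OF smooth_jac[OF l k] smooth_on_compose[OF this(2,1) subset_UNIV o] o]
      have "smooth_on (\<phi> l ` (U l \<inter> U k)) g"
        by (rule smooth_on_cong[OF o, rotated]) (simp add: g_def)
      moreover have "y \<in> \<phi> l ` (U l \<inter> U k)" using True KU by (auto simp: sq_def)
      ultimately show ?thesis using o by blast
    next
      case False
      have op: "open (- (\<phi> l ` K))" using compact_imp_closed[OF cK] by auto
      have "smooth_on (- (\<phi> l ` K)) g"
        by (rule smooth_on_cong[OF op _ smooth_on_const[OF op, of 0]]) (use gout in auto)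
      then show ?thesis using op False by blast
    qed
  qed
  have adg: "admissible l g"
    unfolding admissible_def
  proof (intro conjI allI impI sg gout)
    fix y assume "y \<notin> csquare (c l) (2 * rad l)"
    then show "y \<notin> \<phi> l ` K" using KU sqc[of _ l] by blast
  qed
  have gz: "g (\<phi> l z) > 0"
  proof -
    have "\<phi> l z \<in> \<phi> l ` (U l \<inter> U k)" using zU by blast
    then show ?thesis using jac_pos[OF l k zU(2,1)] fz by (simp add: g_def psi_phi[OF l zU(2)])
  qed
  have gnn: "g y \<ge> 0" for y
    unfolding g_def using jac_pos[OF l k] square_bump_nonneg by (auto simp: f_def intro!: mult_nonneg_nonneg intro: less_imp_le)
  have mg: "mass l g > 0"
    unfolding mass_def
    by (rule square_integral_pos[where f = g and w = "\<phi> l z", OF sg gnn sqc[OF z(2)] gz]) (use rad[OF l] in auto)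
  have "form k f n w = form l g n w" if n: "n < m" "w \<in> U n" for n w
  proof (cases "w \<in> U k \<and> w \<in> U l")
    case True
    then have "\<phi> l w \<in> \<phi> l ` (U l \<inter> U k)" by blast
    then show ?thesis using True jac_cocycle[OF n(1) l k n(2)] by (simp add: form_def g_def psi_phi l)
  next
    case False
    have "form k f n w = 0"
    proof (cases "w \<in> U k")
      case True
      then have "w \<notin> K" using False KU by (auto simp: sq_def)
      then have "\<phi> k w \<notin> ?C" using psi_phi[OF k True] unfolding K_def by (metis imageI)
      then show ?thesis using fout by (simp add: form_def)
    qed (simp add: form_def)
    moreover have "form l g n w = 0"
    proof (cases "w \<in> U l")
      case True
      then have "w \<notin> K" using False KU by (auto simp: sq_def)
      then show ?thesis using gK[OF True] by (simp add: form_def)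
    qed (simp add: form_def)
    ultimately show ?thesis by simp
  qed
  then show ?thesis using that[of f g] adf adg mf mg by simp
qed

text \<open>Connectedness of the surface makes the second de Rham cohomology at most one-dimensional.\<close>

lemma forms_one_dimensional:
  assumes "X \<noteq> {}"
  obtains \<Omega> where "\<And>l f. l < m \<Longrightarrow> admissible l f \<Longrightarrow> \<exists>r. exact (\<lambda>k z. form l f k z - r * \<Omega> k z)"
proof -
  obtain l0 where l0: "l0 < m" using assms sq_cover[of _ 1] by fastforce
  have ne: "\<psi> l (c l) \<in> sq l 2" if "l < m" for l
  proof -
    have "c l \<in> square (c l) (2 * rad l)" using rad[OF that] by (simp add: centre_in_square)
    moreover then have "c l \<in> \<phi> l ` U l" using square_sub[OF that, of 2] by auto
    ultimately show ?thesis by (simp add: sq_def phi_psi)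
  qed
  obtain f0 g0 where f0: "admissible l0 f0" "mass l0 f0 \<noteq> 0"
    using common_bump[OF l0 l0 ne[OF l0] ne[OF l0]] by metis
  define \<Omega> where "\<Omega> = form l0 f0"
  define good where "good l \<longleftrightarrow> (\<forall>f. admissible l f \<longrightarrow> (\<exists>r. exact (\<lambda>k z. form l f k z - r * \<Omega> k z)))" for l
  have g0: "good l0" unfolding good_def \<Omega>_def using exact_form_proportional[OF l0 _ f0] by blast
  \<comment> \<open>A shared bump links the two squares: modulo exact forms \<open>h\<close> is a
    multiple of \<open>g\<close>, which is the same form as \<open>f\<close>, and that one is a
    multiple of \<Omega>.\<close>
  have step: "good l" if k: "k < m" "good k" and l: "l < m" and z: "z \<in> sq k 2" "z \<in> sq l 2" for k l z
    unfolding good_def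
  proof (intro allI impI)
    fix h assume h: "admissible l h"
    obtain f g where fg: "admissible k f" "admissible l g" "mass l g \<noteq> 0"
      "\<And>n w. n < m \<Longrightarrow> w \<in> U n \<Longrightarrow> form k f n w = form l g n w"
      using common_bump[OF k(1) l z] by metis
    obtain r where r: "exact (\<lambda>k' z. form k f k' z - r * \<Omega> k' z)" using k(2) fg(1) by (auto simp: good_def)
    let ?q = "mass l h / mass l g"
    have "exact (\<lambda>k' z. 1 * (form l h k' z - ?q * form l g k' z) + ?q * (form k f k' z - r * \<Omega> k' z))"
      by (intro exact_lincomb exact_form_proportional l h fg r)
    then have "exact (\<lambda>k' z. form l h k' z - (?q * r) * \<Omega> k' z)"
      by (rule exact_cong) (simp add: fg(4) right_diff_distrib mult.assoc)
    then show "\<exists>r. exact (\<lambda>k z. form l h k z - r * \<Omega> k z)" by blast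
  qed
  have all: "good l" if l: "l < m" for l
  proof (rule ccontr)
    assume nl: "\<not> good l"
    \<comment> \<open>The squares with and without the property would split the surface into two
      disjoint nonempty open sets.\<close>
    let ?V = "\<Union>k\<in>{k. k < m \<and> good k}. sq k 2" and ?V' = "\<Union>k\<in>{k. k < m \<and> \<not> good k}. sq k 2"
    have "openin (top_of_set X) ?V" "openin (top_of_set X) ?V'" by (auto intro!: openin_Union openin_sq)
    moreover have "X \<subseteq> ?V \<union> ?V'" using sq_cover[of _ 2] by fastforce
    moreover have "?V \<inter> ?V' = {}" using step by blast
    moreover have "?V \<noteq> {}" "?V' \<noteq> {}" using ne[OF l0] ne[OF l] l0 g0 l nl by blast+
    ultimately show False using connected_X unfolding connected_openin by blast
  qed
  show ?thesis by (rule that[of \<Omega>]) (use all in \<open>auto simp: good_def\<close>)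
qed

end

section \<open>Holonomy of locally constant cocycles\<close>

text \<open>A holonomy map is assembled from the differences of local sections \<open>S k\<close> with values in a
  (not necessarily commutative) group whose quotients on overlaps are locally constant.\<close>

locale local_system =
  fixes X :: "'a::topological_space set" and m :: nat and B :: "nat \<Rightarrow> 'a set" and S :: "nat \<Rightarrow> 'a \<Rightarrow> 'h::group_add"
  assumes openB: "\<And>k. k < m \<Longrightarrow> openin (top_of_set X) (B k)"
    and coverB: "X \<subseteq> (\<Union>k<m. B k)"
    and cocycle: "\<And>k l z. k < m \<Longrightarrow> l < m \<Longrightarrow> z \<in> B k \<Longrightarrow> z \<in> B l \<Longrightarrow>
      \<exists>N g. openin (top_of_set X) N \<and> z \<in> N \<and> (\<forall>w\<in>N. S k w = g + S l w)"
begin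

lemma local_in_B:
  assumes "continuous_on {0..1} \<gamma>" "\<gamma> ` {0..1::real} \<subseteq> X" "t \<in> {0..1}" "openin (top_of_set X) N" "\<gamma> t \<in> N"
  shows "\<exists>d>0. \<forall>s\<in>{0..1}. dist s t < d \<longrightarrow> \<gamma> s \<in> N"
proof -
  have "openin (top_of_set {0..1}) ({0..1} \<inter> \<gamma> -` N)"
    by (rule continuous_openin_preimage[OF assms(1) _ assms(4)]) (use assms(2) in blast)
  moreover have "t \<in> {0..1} \<inter> \<gamma> -` N" using assms by blast
  ultimately show ?thesis unfolding openin_euclidean_subtopology_iff by blast
qed

text \<open>A left quotient, so that the left translation \<open>g\<close> in \<open>cocycle\<close>
  cancels.\<close>

definition step :: "nat \<Rightarrow> 'a \<Rightarrow> 'a \<Rightarrow> 'h" where "step k x y = - S k x + S k y"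

lemma step_add: "step k x y + step k y z = step k x z"
proof -
  have "step k x y + step k y z = - S k x + (S k y + - S k y) + S k z"
    unfolding step_def by (simp only: add.assoc)
  then show ?thesis by (simp add: step_def)
qed

text \<open>Bisection over [a, b]: near each time the two sections differ by one left
  translation.\<close>

lemma step_independent:
  assumes k: "k < m" and l: "l < m" and \<gamma>: "continuous_on {0..1} \<gamma>" "\<gamma> ` {0..1::real} \<subseteq> X"
    and ab: "0 \<le> a" "a \<le> b" "b \<le> 1" and kl: "\<gamma> ` {a..b} \<subseteq> B k" "\<gamma> ` {a..b} \<subseteq> B l"
  shows "step k (\<gamma> a) (\<gamma> b) = step l (\<gamma> a) (\<gamma> b)"
proof -
  define P where "P s t \<longleftrightarrow> (a \<le> s \<longrightarrow> t \<le> b \<longrightarrow> s \<le> t \<longrightarrow> step k (\<gamma> s) (\<gamma> t) = step l (\<gamma> s) (\<gamma> t))" for s t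
  from ab(2) have "P a b"
  proof (induction rule: Bolzano)
    case (trans x y z)
    show ?case unfolding P_def
    proof (intro impI)
      assume "a \<le> x" "z \<le> b"
      then have "step k (\<gamma> x) (\<gamma> y) = step l (\<gamma> x) (\<gamma> y)" "step k (\<gamma> y) (\<gamma> z) = step l (\<gamma> y) (\<gamma> z)"
        using trans unfolding P_def by auto
      then show "step k (\<gamma> x) (\<gamma> z) = step l (\<gamma> x) (\<gamma> z)" by (metis step_add)
    qed
  next
    case (local t)
    then have "\<gamma> t \<in> B k" "\<gamma> t \<in> B l" using kl by auto
    then obtain N g where N: "openin (top_of_set X) N" "\<gamma> t \<in> N" "\<forall>w\<in>N. S k w = g + S l w"
      using cocycle[OF k l] by blast
    obtain d where d: "d > 0" "\<forall>s\<in>{0..1}. dist s t < d \<longrightarrow> \<gamma> s \<in> N"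
      using local_in_B[OF \<gamma> _ N(1,2)] local ab by auto
    have "P x y" if "x \<le> t \<and> t \<le> y \<and> y - x < d" for x y
      unfolding P_def
    proof (intro impI)
      assume "a \<le> x" "y \<le> b"
      then have "\<gamma> x \<in> N" "\<gamma> y \<in> N" using that d ab by (auto simp: dist_real_def)
      then show "step k (\<gamma> x) (\<gamma> y) = step l (\<gamma> x) (\<gamma> y)"
        using N(3) by (simp add: step_def minus_add add.assoc[symmetric])
    qed
    then show ?case using d(1) by blast
  qed
  then show ?thesis using ab by (simp add: P_def)
qed

text \<open>The ordered sum over any subdivision into pieces that lie in single sets
  \<open>B k\<close>. As a relation it leaves the subdivision open; that the value is unique is
  \<open>transport_ex1\<close>.\<close>

inductive transport :: "(real \<Rightarrow> 'a) \<Rightarrow> real \<Rightarrow> real \<Rightarrow> 'h \<Rightarrow> bool" for \<gamma> where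
  base: "k < m \<Longrightarrow> a \<le> b \<Longrightarrow> \<gamma> ` {a..b} \<subseteq> B k \<Longrightarrow> transport \<gamma> a b (step k (\<gamma> a) (\<gamma> b))"
| join: "transport \<gamma> a b h \<Longrightarrow> transport \<gamma> b c h' \<Longrightarrow> transport \<gamma> a c (h + h')"

lemma transport_le: "transport \<gamma> a b h \<Longrightarrow> a \<le> b"
  by (induction rule: transport.induct) auto

text \<open>A derivation may use other sections on the way, but inside \<open>B k\<close> each of
  its steps agrees with that of section \<open>k\<close>.\<close>

lemma transport_in:
  assumes "transport \<gamma> a b h" "k < m" "continuous_on {0..1} \<gamma>" "\<gamma> ` {0..1} \<subseteq> X" "0 \<le> a" "b \<le> 1" "\<gamma> ` {a..b} \<subseteq> B k"
  shows "h = step k (\<gamma> a) (\<gamma> b)"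
  using assms
proof (induction rule: transport.induct)
  case (base l a b)
  then show ?case using step_independent[of l k \<gamma> a b] by blast
next
  case (join a b h c h')
  have le: "a \<le> b" "b \<le> c" using join.hyps transport_le by auto
  have "h = step k (\<gamma> a) (\<gamma> b)" by (rule join.IH(1)) (use join.prems le in \<open>auto simp: image_subset_iff\<close>)
  moreover have "h' = step k (\<gamma> b) (\<gamma> c)" by (rule join.IH(2)) (use join.prems le in \<open>auto simp: image_subset_iff\<close>)
  ultimately show ?case by (simp add: step_add)
qed

text \<open>Cutting a derivation at a prescribed time lets any two derivations be compared piece by
  piece, which yields uniqueness.\<close>

lemma transport_split:
  assumes "transport \<gamma> a c h" "a \<le> b" "b \<le> c"
  shows "\<exists>h1 h2. transport \<gamma> a b h1 \<and> transport \<gamma> b c h2 \<and> h = h1 + h2"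
  using assms
proof (induction arbitrary: b rule: transport.induct)
  case (base k a c)
  have "transport \<gamma> a b (step k (\<gamma> a) (\<gamma> b))" "transport \<gamma> b c (step k (\<gamma> b) (\<gamma> c))"
    using base by (auto intro!: transport.base simp: image_subset_iff)
  then show ?case by (metis step_add)
next
  case (join a x h c h')
  show ?case
  proof (cases "b \<le> x")
    case True
    then obtain h1 h2 where "transport \<gamma> a b h1" "transport \<gamma> b x h2" "h = h1 + h2" using join.IH(1) join.prems by blast
    moreover then have "transport \<gamma> b c (h2 + h')" using join.hyps(2) transport.join by blast
    ultimately show ?thesis by (metis add.assoc)
  next
    case False
    then obtain h1 h2 where "transport \<gamma> x b h1" "transport \<gamma> b c h2" "h' = h1 + h2" using join.IH(2)[of b] join.prems by auto
    moreover then have "transport \<gamma> a b (h + h1)" using join.hyps(1) transport.join by blast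
    ultimately show ?thesis by (metis add.assoc)
  qed
qed

lemma transport_ex1:
  assumes \<gamma>: "continuous_on {0..1} \<gamma>" "\<gamma> ` {0..1} \<subseteq> X" and ab: "0 \<le> a" "a \<le> b" "b \<le> 1"
  shows "\<exists>!h. transport \<gamma> a b h"
proof -
  define P where "P s t \<longleftrightarrow> (0 \<le> s \<longrightarrow> s \<le> t \<longrightarrow> t \<le> 1 \<longrightarrow> (\<exists>!h. transport \<gamma> s t h))" for s t
  from ab(2) have "P a b"
  proof (induction rule: Bolzano)
    case (trans x y z)
    show ?case unfolding P_def
    proof (intro impI)
      assume "0 \<le> x" "z \<le> 1"
      then have ex: "\<exists>!h. transport \<gamma> x y h" "\<exists>!h. transport \<gamma> y z h"
        using trans unfolding P_def by auto
      obtain h where h1: "transport \<gamma> x y h" "\<And>g. transport \<gamma> x y g \<Longrightarrow> g = h" using ex(1) by blast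
      obtain h' where h2: "transport \<gamma> y z h'" "\<And>g. transport \<gamma> y z g \<Longrightarrow> g = h'" using ex(2) by blast
      note h = h1 h2
      have "g = h + h'" if "transport \<gamma> x z g" for g
        using transport_split[OF that trans(3,4)] h by blast
      then show "\<exists>!h. transport \<gamma> x z h" using transport.join[OF h(1,3)] by blast
    qed
  next
    case (local t)
    then have t: "t \<in> {0..1}" "\<gamma> t \<in> X" using \<gamma>(2) ab by (auto simp: image_subset_iff)
    then obtain k where k: "k < m" "\<gamma> t \<in> B k" using coverB by blast
    obtain d where d: "d > 0" "\<forall>s\<in>{0..1}. dist s t < d \<longrightarrow> \<gamma> s \<in> B k"
      using local_in_B[OF \<gamma> t(1) openB[OF k(1)] k(2)] by blast
    have "P x y" if "x \<le> t \<and> t \<le> y \<and> y - x < d" for x y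
      unfolding P_def
    proof (intro impI)
      assume xy: "0 \<le> x" "x \<le> y" "y \<le> 1"
      have im: "\<gamma> ` {x..y} \<subseteq> B k" using d(2) that xy by (auto simp: dist_real_def)
      show "\<exists>!h. transport \<gamma> x y h"
        using transport.base[OF k(1) xy(2) im] transport_in[OF _ k(1) \<gamma> xy(1,3) im] by blast
    qed
    then show ?case using d(1) by blast
  qed
  then show ?thesis using ab by (simp add: P_def)
qed

definition holonomy :: "(real \<Rightarrow> 'a) \<Rightarrow> 'h" where "holonomy \<gamma> = (THE h. transport \<gamma> 0 1 h)"

lemma holonomy:
  assumes "path \<gamma>" "path_image \<gamma> \<subseteq> X"
  shows "transport \<gamma> 0 1 h \<longleftrightarrow> h = holonomy \<gamma>"
proof -
  have "\<exists>!h. transport \<gamma> 0 1 h" using assms by (intro transport_ex1) (auto simp: path_def path_image_def)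
  from theI'[OF this] this show ?thesis unfolding holonomy_def by blast
qed

lemma holonomy_in:
  assumes "path \<gamma>" "k < m" "path_image \<gamma> \<subseteq> B k"
  shows "holonomy \<gamma> = - S k (pathstart \<gamma>) + S k (pathfinish \<gamma>)"
proof -
  have "path_image \<gamma> \<subseteq> X" using assms openin_imp_subset[OF openB] by blast
  then show ?thesis
    using holonomy[OF assms(1)] transport.base[OF assms(2), of 0 1 \<gamma>] assms(3)
    by (auto simp: step_def path_image_def pathstart_def pathfinish_def)
qed

lemma transport_affine:
  assumes "transport \<gamma> a b h" "p > 0" "\<And>t. a \<le> t \<Longrightarrow> t \<le> b \<Longrightarrow> \<delta> (p * t + q) = \<gamma> t"
  shows "transport \<delta> (p * a + q) (p * b + q) h"
  using assms
proof (induction rule: transport.induct)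
  case (base k a b)
  have "\<delta> ` {p * a + q..p * b + q} \<subseteq> B k"
  proof (rule image_subsetI)
    fix s assume s: "s \<in> {p * a + q..p * b + q}"
    define t where "t = (s - q) / p"
    have t: "s = p * t + q" using base.prems(1) by (simp add: t_def)
    then have "p * a \<le> p * t" "p * t \<le> p * b" using s by auto
    then have "a \<le> t" "t \<le> b" using base.prems(1) by (simp_all only: mult_le_cancel_left_pos)
    then show "\<delta> s \<in> B k" using base t by (auto simp: image_subset_iff)
  qed
  then have "transport \<delta> (p * a + q) (p * b + q) (step k (\<delta> (p * a + q)) (\<delta> (p * b + q)))"
    using base by (intro transport.base) auto
  then show ?case using base.prems(2)[of a] base.prems(2)[of b] base.hyps by simp
next
  case (join a b h c h')
  have le: "a \<le> b" "b \<le> c" using join.hyps transport_le by auto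
  have "transport \<delta> (p * a + q) (p * b + q) h" by (rule join.IH(1)[OF join.prems(1)]) (use join.prems le in auto)
  moreover have "transport \<delta> (p * b + q) (p * c + q) h'" by (rule join.IH(2)[OF join.prems(1)]) (use join.prems le in auto)
  ultimately show ?case by (rule transport.join)
qed

lemma holonomy_join:
  assumes "path \<gamma>" "path_image \<gamma> \<subseteq> X" "path \<delta>" "path_image \<delta> \<subseteq> X" "pathfinish \<gamma> = pathstart \<delta>"
  shows "holonomy (\<gamma> +++ \<delta>) = holonomy \<gamma> + holonomy \<delta>"
proof -
  have "transport (\<gamma> +++ \<delta>) (1/2 * 0 + 0) (1/2 * 1 + 0) (holonomy \<gamma>)"
    by (rule transport_affine[of \<gamma>]) (use holonomy[OF assms(1,2)] in \<open>auto simp: joinpaths_def\<close>)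
  moreover have "transport (\<gamma> +++ \<delta>) (1/2 * 0 + 1/2) (1/2 * 1 + 1/2) (holonomy \<delta>)"
  proof (rule transport_affine[of \<delta>])
    fix t :: real assume t: "0 \<le> t" "t \<le> 1"
    have "2 * (1/2 * t + 1/2) = t + 1" by simp
    then show "(\<gamma> +++ \<delta>) (1/2 * t + 1/2) = \<delta> t"
      using t assms(5) unfolding joinpaths_def by (cases "t = 0") (auto simp: pathstart_def pathfinish_def)
  qed (use holonomy[OF assms(3,4)] in auto)
  ultimately have "transport (\<gamma> +++ \<delta>) 0 1 (holonomy \<gamma> + holonomy \<delta>)"
    using transport.join by force
  then show ?thesis using holonomy[of "\<gamma> +++ \<delta>"] assms by (simp add: path_image_join)
qed

text \<open>On small rectangles of the homotopy the two ways round agree because one section covers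
  the image. The relations of adjacent rectangles combine in both directions, and the order of the
  terms is respected throughout, so commutativity does not enter.\<close>

lemma holonomy_homotopic:
  assumes hp: "homotopic_paths X \<gamma> \<delta>"
  shows "holonomy \<gamma> = holonomy \<delta>"
proof -
  obtain K where K: "continuous_on ({0..1} \<times> {0..1}) K" "K \<in> {0..1} \<times> {0..1} \<rightarrow> X"
    "\<forall>x\<in>{0..1}. K (0, x) = \<gamma> x" "\<forall>x\<in>{0..1}. K (1, x) = \<delta> x"
    "\<forall>t\<in>{0..1::real}. pathstart (K \<circ> Pair t) = pathstart \<gamma>"
    "\<forall>t\<in>{0..1::real}. pathfinish (K \<circ> Pair t) = pathfinish \<gamma>"
    using hp unfolding homotopic_paths by blast
  define r where "r t = (\<lambda>s. K (t, s))" for t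
  define u where "u s = (\<lambda>t. K (t, s))" for s
  have r: "continuous_on {0..1} (r t)" "r t ` {0..1} \<subseteq> X" if "t \<in> {0..1}" for t
    unfolding r_def using that K(2) by (auto intro!: continuous_on_compose2[OF K(1)] continuous_intros)
  have u: "continuous_on {0..1} (u s)" "u s ` {0..1} \<subseteq> X" if "s \<in> {0..1}" for s
    unfolding u_def using that K(2) by (auto intro!: continuous_on_compose2[OF K(1)] continuous_intros)
  \<comment> \<open>\<open>r\<close> gives the rows of the homotopy and \<open>u\<close> its
    columns; the relation equates the two ways from the corner (c, a) to the corner (d, b).\<close>
  define rect where "rect a b c d \<longleftrightarrow> (\<forall>h h' v w. transport (r c) a b h \<longrightarrow> transport (r d) a b h' \<longrightarrow>
     transport (u a) c d v \<longrightarrow> transport (u b) c d w \<longrightarrow> v + h' = h + w)" for a b c d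
  \<comment> \<open>Bisection in the path parameter. The admissible height \<open>e\<close> depends
    on the interval, and joining two intervals takes the minimum.\<close>
  have strip: "\<exists>e>0. \<forall>c d. 0 \<le> c \<longrightarrow> c \<le> t \<longrightarrow> t \<le> d \<longrightarrow> d \<le> 1 \<longrightarrow> d - c < e \<longrightarrow> rect 0 1 c d" if t: "t \<in> {0..1}" for t
  proof -
    define P where "P a b \<longleftrightarrow> (0 \<le> a \<longrightarrow> a \<le> b \<longrightarrow> b \<le> 1 \<longrightarrow>
      (\<exists>e>0. \<forall>c d. 0 \<le> c \<longrightarrow> c \<le> t \<longrightarrow> t \<le> d \<longrightarrow> d \<le> 1 \<longrightarrow> d - c < e \<longrightarrow> rect a b c d))" for a b
    have "(0::real) \<le> 1" by simp
    then have "P 0 1"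
    proof (induction rule: Bolzano)
      case (trans a x b)
      show ?case unfolding P_def
      proof (intro impI)
        assume ab: "0 \<le> a" "a \<le> b" "b \<le> 1"
        have "a \<le> x" "x \<le> b" "0 \<le> x" "x \<le> 1" using trans(3,4) ab by auto
        then have "\<exists>e>0. (\<forall>c d. 0 \<le> c \<longrightarrow> c \<le> t \<longrightarrow> t \<le> d \<longrightarrow> d \<le> 1 \<longrightarrow> d - c < e \<longrightarrow> rect a x c d)" "\<exists>e>0. (\<forall>c d. 0 \<le> c \<longrightarrow> c \<le> t \<longrightarrow> t \<le> d \<longrightarrow> d \<le> 1 \<longrightarrow> d - c < e \<longrightarrow> rect x b c d)"
          using trans(1,2) ab unfolding P_def by simp_all
        then obtain e e' where e: "e > 0" "e' > 0" "(\<forall>c d. 0 \<le> c \<longrightarrow> c \<le> t \<longrightarrow> t \<le> d \<longrightarrow> d \<le> 1 \<longrightarrow> d - c < e \<longrightarrow> rect a x c d)" "(\<forall>c d. 0 \<le> c \<longrightarrow> c \<le> t \<longrightarrow> t \<le> d \<longrightarrow> d \<le> 1 \<longrightarrow> d - c < e' \<longrightarrow> rect x b c d)"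
          by (elim exE conjE)
        have "rect a b c d" if cd: "0 \<le> c" "c \<le> t" "t \<le> d" "d \<le> 1" "d - c < min e e'" for c d
          unfolding rect_def
        proof (intro allI impI)
          fix h h' v w assume tr: "transport (r c) a b h" "transport (r d) a b h'" "transport (u a) c d v" "transport (u b) c d w"
          obtain h1 h2 where h: "transport (r c) a x h1" "transport (r c) x b h2" "h = h1 + h2"
            using transport_split[OF tr(1) trans(3,4)] by blast
          obtain h1' h2' where h': "transport (r d) a x h1'" "transport (r d) x b h2'" "h' = h1' + h2'"
            using transport_split[OF tr(2) trans(3,4)] by blast
          have "x \<in> {0..1}" using ab trans(3,4) by auto
          then obtain y where y: "transport (u x) c d y"
            using transport_ex1[OF u, of x c d] cd by auto
          have "rect a x c d" "rect x b c d"
            using e(3,4) cd by simp_all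
          then have "v + h1' = h1 + y" "y + h2' = h2 + w"
            unfolding rect_def using h(1,2) h'(1,2) tr(3,4) y by blast+
          then show "v + h' = h + w" unfolding h(3) h'(3) by (metis add.assoc)
        qed
        then show "\<exists>e>0. \<forall>c d. 0 \<le> c \<longrightarrow> c \<le> t \<longrightarrow> t \<le> d \<longrightarrow> d \<le> 1 \<longrightarrow> d - c < e \<longrightarrow> rect a b c d"
          using e(1,2) by (intro exI[of _ "min e e'"]) auto
      qed
    next
      case (local s)
      then have s: "s \<in> {0..1}" by simp
      then have "K (t, s) \<in> X" using K(2) t by auto
      then obtain k where k: "k < m" "K (t, s) \<in> B k" using coverB by blast
      have "openin (top_of_set ({0..1} \<times> {0..1})) (({0..1} \<times> {0..1}) \<inter> K -` B k)"
        by (rule continuous_openin_preimage[OF K(1) _ openB[OF k(1)]]) (use K(2) in auto)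
      moreover have "(t, s) \<in> ({0..1} \<times> {0..1}) \<inter> K -` B k" using s t k by simp
      ultimately obtain e where "e > 0"
        "\<forall>z\<in>{0..1} \<times> {0..1}. dist z (t, s) < e \<longrightarrow> z \<in> ({0..1} \<times> {0..1}) \<inter> K -` B k"
        unfolding openin_euclidean_subtopology_iff by (elim conjE) (drule bspec, assumption, elim exE conjE, rule that)
      then have e: "e > 0" "\<And>z. z \<in> {0..1} \<times> {0..1} \<Longrightarrow> dist z (t, s) < e \<Longrightarrow> K z \<in> B k"
        by blast+
      have inB: "K (t', s') \<in> B k" if "t' \<in> {0..1}" "s' \<in> {0..1}" "\<bar>t' - t\<bar> < e/2" "\<bar>s' - s\<bar> < e/2" for t' s'
      proof (rule e(2))
        have "dist (t', s') (t, s) \<le> \<bar>t' - t\<bar> + \<bar>s' - s\<bar>"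
          unfolding dist_Pair_Pair dist_real_def using sqrt_sum_squares_le_sum_abs[of "\<bar>t' - t\<bar>" "\<bar>s' - s\<bar>"] by simp
        then show "dist (t', s') (t, s) < e" using that by linarith
      qed (use that in auto)
      have "P a b" if "a \<le> s \<and> s \<le> b \<and> b - a < e/2" for a b
        unfolding P_def
      proof (intro impI exI[of _ "e/2"] conjI allI)
        fix c d assume ab: "0 \<le> a" "a \<le> b" "b \<le> 1" and cd: "0 \<le> c" "c \<le> t" "t \<le> d" "d \<le> 1" "d - c < e/2"
        have I: "r c ` {a..b} \<subseteq> B k" "r d ` {a..b} \<subseteq> B k" "u a ` {c..d} \<subseteq> B k" "u b ` {c..d} \<subseteq> B k"
          unfolding r_def u_def using ab cd that by (auto simp: abs_if intro!: inB)
        show "rect a b c d"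
          unfolding rect_def
        proof (intro allI impI)
          fix h h' v w assume tr: "transport (r c) a b h" "transport (r d) a b h'" "transport (u a) c d v" "transport (u b) c d w"
          have m: "c \<in> {0..1}" "d \<in> {0..1}" "a \<in> {0..1}" "b \<in> {0..1}" using ab cd t by auto
          have "h = step k (K (c, a)) (K (c, b))" using transport_in[OF tr(1) k(1) r[OF m(1)] ab(1,3) I(1)] by (simp add: r_def)
          moreover have "h' = step k (K (d, a)) (K (d, b))" using transport_in[OF tr(2) k(1) r[OF m(2)] ab(1,3) I(2)] by (simp add: r_def)
          moreover have "v = step k (K (c, a)) (K (d, a))" using transport_in[OF tr(3) k(1) u[OF m(3)] cd(1,4) I(3)] by (simp add: u_def)
          moreover have "w = step k (K (c, b)) (K (d, b))" using transport_in[OF tr(4) k(1) u[OF m(4)] cd(1,4) I(4)] by (simp add: u_def)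
          ultimately show "v + h' = h + w" by (simp add: step_add)
        qed
      qed (use e(1) in auto)
      then show ?case using e(1) by (intro exI[of _ "e/2"]) auto
    qed
    then show ?thesis by (simp add: P_def)
  qed
  \<comment> \<open>A second bisection, now in the homotopy parameter, stacks the strips.\<close>
  define Q where "Q c d \<longleftrightarrow> (0 \<le> c \<longrightarrow> c \<le> d \<longrightarrow> d \<le> 1 \<longrightarrow> rect 0 1 c d)" for c d
  have "(0::real) \<le> 1" by simp
  then have "Q 0 1"
  proof (induction rule: Bolzano)
    case (trans c x d)
    show ?case unfolding Q_def rect_def
    proof (intro impI allI)
      fix h h' v w assume cd: "0 \<le> c" "c \<le> d" "d \<le> 1"
        and tr: "transport (r c) 0 1 h" "transport (r d) 0 1 h'" "transport (u 0) c d v" "transport (u 1) c d w"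
      obtain v1 v2 where v: "transport (u 0) c x v1" "transport (u 0) x d v2" "v = v1 + v2"
        using transport_split[OF tr(3) trans(3,4)] by blast
      obtain w1 w2 where w: "transport (u 1) c x w1" "transport (u 1) x d w2" "w = w1 + w2"
        using transport_split[OF tr(4) trans(3,4)] by blast
      have "x \<in> {0..1}" using cd trans(3,4) by auto
      then obtain y where y: "transport (r x) 0 1 y" using transport_ex1[OF r, of x 0 1] by auto
      have "rect 0 1 c x" "rect 0 1 x d" using trans cd unfolding Q_def by auto
      then have "v1 + y = h + w1" "v2 + h' = y + w2" using tr v w y unfolding rect_def by blast+
      then show "v + h' = h + w" unfolding v(3) w(3) by (metis add.assoc)
    qed
  next
    case (local t)
    then obtain e where "e > 0" "\<And>c d. 0 \<le> c \<Longrightarrow> c \<le> t \<Longrightarrow> t \<le> d \<Longrightarrow> d \<le> 1 \<Longrightarrow> d - c < e \<Longrightarrow> rect 0 1 c d"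
      using strip[of t] by auto
    then show ?case unfolding Q_def by blast
  qed
  then have R: "rect 0 1 0 1" by (simp add: Q_def)
  have gd: "path \<gamma>" "path_image \<gamma> \<subseteq> X" "path \<delta>" "path_image \<delta> \<subseteq> X"
    using homotopic_paths_imp_path[OF hp] homotopic_paths_imp_subset[OF hp] by auto
  have "transport (r 0) 0 1 (holonomy \<gamma>)"
    using transport_affine[of \<gamma> 0 1 "holonomy \<gamma>" 1 "r 0" 0] holonomy[OF gd(1,2)] K(3) by (simp add: r_def)
  moreover have "transport (r 1) 0 1 (holonomy \<delta>)"
    using transport_affine[of \<delta> 0 1 "holonomy \<delta>" 1 "r 1" 0] holonomy[OF gd(3,4)] K(4) by (simp add: r_def)
  \<comment> \<open>The ends stay fixed during the homotopy, so the outer columns are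
    constant.\<close>
  moreover have "transport (u s) 0 1 0" if "s = 0 \<or> s = 1" for s
  proof -
    have c: "u s t = \<gamma> s" if "t \<in> {0..1}" for t
      using K(5,6) that \<open>s = 0 \<or> s = 1\<close> by (auto simp: u_def pathstart_def pathfinish_def)
    have "\<gamma> s \<in> X" using gd(2) that by (auto simp: path_image_def)
    then obtain k where k: "k < m" "\<gamma> s \<in> B k" using coverB by blast
    have "transport (u s) 0 1 (step k (u s 0) (u s 1))"
      by (rule transport.base[OF k(1)]) (use c k(2) in auto)
    then show ?thesis using c by (simp add: step_def)
  qed
  ultimately show ?thesis using R unfolding rect_def by (metis add_0 add_0_right)
qed

lemma path_functional_holonomy: "path_functional X holonomy"
  unfolding path_functional_def using holonomy_join holonomy_homotopic by blast

end

section \<open>Homomorphisms to the Heisenberg group\<close>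

text \<open>The primitive integrates \<theta> along the segment from \<open>a\<close> to
  \<open>y\<close>. By closedness, the derivative of the integrand in direction \<open>v\<close> is
  the t-derivative of t times \<theta> applied to \<open>v\<close> at the point of parameter t, so
  it integrates to \<open>\<theta> y v\<close>.\<close>

lemma closed_form_primitive:
  fixes \<theta> :: "real^2 \<Rightarrow> real^2 \<Rightarrow> real"
  assumes Q: "open Q" "convex Q" "a \<in> Q" and sm: "\<And>v. smooth_on Q (\<lambda>y. \<theta> y v)"
    and lin: "\<And>y. y \<in> Q \<Longrightarrow> linear (\<theta> y)"
    and closed: "\<And>y. y \<in> Q \<Longrightarrow> frechet_derivative (\<lambda>y. \<theta> y e2) (at y) e1 = frechet_derivative (\<lambda>y. \<theta> y e1) (at y) e2"
  shows "\<exists>E. \<forall>y\<in>Q. (E has_derivative \<theta> y) (at y)"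
proof -
  define D where "D v y w = frechet_derivative (\<lambda>y. \<theta> y v) (at y) w" for v y w
  have D: "((\<lambda>y. \<theta> y v) has_derivative D v y) (at y)" if "y \<in> Q" for v y
    unfolding D_def[abs_def] by (rule smooth_on_has_derivative[OF sm that])
  have Dl: "linear (D v y)" if "y \<in> Q" for v y using has_derivative_linear[OF D[OF that]] .
  have Dv: "D v y w = v $ 1 * D e1 y w + v $ 2 * D e2 y w" if y: "y \<in> Q" for v y w
  proof -
    have "((\<lambda>y. v $ 1 * \<theta> y e1 + v $ 2 * \<theta> y e2) has_derivative (\<lambda>w. v $ 1 * D e1 y w + v $ 2 * D e2 y w)) (at y)"
      by (intro has_derivative_add has_derivative_mult_right D y)
    then have "((\<lambda>y. \<theta> y v) has_derivative (\<lambda>w. v $ 1 * D e1 y w + v $ 2 * D e2 y w)) (at y)"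
    proof (rule has_derivative_transform_within_open[OF _ Q(1) y])
      show "v $ 1 * \<theta> x e1 + v $ 2 * \<theta> x e2 = \<theta> x v" if "x \<in> Q" for x
        using linear_real2[OF lin[OF that], of v] by simp
    qed
    from fun_cong[OF has_derivative_unique[OF D[OF y] this]] show ?thesis .
  qed
  \<comment> \<open>Closedness is given for the basis vectors; bilinearity extends it to all pairs
    of directions.\<close>
  have sym: "D v y w = D w y v" if y: "y \<in> Q" for v w y
  proof -
    have c: "D e2 y e1 = D e1 y e2" using closed[OF y] by (simp add: D_def)
    have l: "D e y w = w $ 1 * D e y e1 + w $ 2 * D e y e2" for e w
      using linear_real2[OF Dl[OF y, of e], of w] by simp
    show ?thesis
      unfolding Dv[OF y, of v w] Dv[OF y, of w v] l[of e1 v] l[of e2 v] l[of e1 w] l[of e2 w] c by (simp add: algebra_simps)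
  qed
  define G where "G z = a + snd z *\<^sub>R (fst z - a)" for z :: "(real^2) \<times> real"
  define W where "W = G -` Q"
  have cG: "continuous_on UNIV G" unfolding G_def by (intro continuous_intros)
  have W: "open W" unfolding W_def using cG Q(1) by (simp add: open_vimage continuous_on_open_vimage)
  have QW: "Q \<times> {0..1} \<subseteq> W"
  proof
    fix z assume "z \<in> Q \<times> {0..1::real}"
    then have "(1 - snd z) *\<^sub>R a + snd z *\<^sub>R fst z \<in> Q" using convexD_alt[OF Q(2,3), of "fst z" "snd z"] by auto
    moreover have "(1 - snd z) *\<^sub>R a + snd z *\<^sub>R fst z = G z" by (simp add: G_def algebra_simps)
    ultimately show "z \<in> W" by (simp add: W_def)
  qed
  define f where "f z = (fst z - a) $ 1 * \<theta> (G z) e1 + (fst z - a) $ 2 * \<theta> (G z) e2" for z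
  have sG: "smooth_on W G"
    unfolding G_def[abs_def] by (intro smooth_on_add smooth_on_scaleR smooth_on_diff smooth_on_const smooth_on_bounded_linear[OF bounded_linear_fst]
        smooth_on_bounded_linear[OF bounded_linear_snd] W)
  have s1: "smooth_on W (\<lambda>z. (fst z - a) $ i)" for i
  proof -
    have "smooth_on W (\<lambda>z. fst z - a)" by (intro smooth_on_diff smooth_on_const smooth_on_bounded_linear[OF bounded_linear_fst] W)
    from smooth_on_compose[OF smooth_on_nth[OF open_UNIV] this subset_UNIV W] show ?thesis .
  qed
  have s2: "smooth_on W (\<lambda>z. \<theta> (G z) v)" for v
    by (rule smooth_on_compose[OF sm sG _ W]) (auto simp: W_def)
  have sf: "smooth_on W f" unfolding f_def[abs_def]
    by (rule smooth_on_add[OF smooth_on_mult[OF s1 s2 W] smooth_on_mult[OF s1 s2 W] W])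
  have fd: "frechet_derivative f (at (y, t)) (v, 0) = \<theta> (G (y, t)) v + t * D v (G (y, t)) (y - a)"
    if yt: "(y, t) \<in> W" for y t v
  proof -
    have gQ: "G (y, t) \<in> Q" using yt by (simp add: W_def)
    have dG: "(G has_derivative (\<lambda>w. snd w *\<^sub>R (y - a) + t *\<^sub>R fst w)) (at (y, t))"
      unfolding G_def[abs_def] by (auto intro!: derivative_eq_intros simp: algebra_simps)
    have dt: "((\<lambda>z. \<theta> (G z) e) has_derivative (\<lambda>w. D e (G (y, t)) (snd w *\<^sub>R (y - a) + t *\<^sub>R fst w))) (at (y, t))" for e
      using diff_chain_at[OF dG D[OF gQ, of e]] by (simp add: o_def)
    have dn: "((\<lambda>z. (fst z - a) $ i) has_derivative (\<lambda>w. fst w $ i)) (at (y, t))" for i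
      by (rule bounded_linear.has_derivative[OF bounded_linear_vec_nth, of "\<lambda>z. fst z - a" fst "at (y, t)"])
        (auto intro!: derivative_eq_intros)
    have "frechet_derivative f (at (y, t)) = (\<lambda>w. ((fst (y, t) - a) $ 1 * D e1 (G (y, t)) (snd w *\<^sub>R (y - a) + t *\<^sub>R fst w) + fst w $ 1 * \<theta> (G (y, t)) e1)
       + ((fst (y, t) - a) $ 2 * D e2 (G (y, t)) (snd w *\<^sub>R (y - a) + t *\<^sub>R fst w) + fst w $ 2 * \<theta> (G (y, t)) e2))"
      unfolding f_def[abs_def]
      by (rule frechet_derivative_at[OF has_derivative_add[OF has_derivative_mult[OF dn dt] has_derivative_mult[OF dn dt]], symmetric])
    then have "frechet_derivative f (at (y, t)) (v, 0) = t * ((y - a) $ 1 * D e1 (G (y, t)) v + (y - a) $ 2 * D e2 (G (y, t)) v)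
      + (v $ 1 * \<theta> (G (y, t)) e1 + v $ 2 * \<theta> (G (y, t)) e2)"
      using linear_cmul[OF Dl[OF gQ]] by (simp add: algebra_simps)
    also have "\<dots> = t * D (y - a) (G (y, t)) v + \<theta> (G (y, t)) v"
      using Dv[OF gQ, of "y - a" v] linear_real2[OF lin[OF gQ], of v] by simp
    finally show ?thesis using sym[OF gQ, of "y - a" v] by simp
  qed
  have "((\<lambda>y. integral {0..1} (\<lambda>t. f (y, t))) has_derivative \<theta> y) (at y)" if y: "y \<in> Q" for y
  proof -
    have "((\<lambda>y. integral {0..1} (\<lambda>t. f (y, t))) has_derivative (\<lambda>v. integral {0..1} (\<lambda>t. frechet_derivative f (at (y, t)) (v, 0)))) (at y)"
      by (rule parameter_integral_has_derivative[OF Q(2,1) y W QW]) (use sf in \<open>simp only: smooth_on_def\<close>)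
    moreover have "integral {0..1} (\<lambda>t. frechet_derivative f (at (y, t)) (v, 0)) = \<theta> y v" for v
    proof -
      have "((\<lambda>t. frechet_derivative f (at (y, t)) (v, 0)) has_integral (1 * \<theta> (G (y, 1)) v - 0 * \<theta> (G (y, 0)) v)) {0..1}"
      proof (rule fundamental_theorem_of_calculus)
        fix t :: real assume t: "t \<in> {0..1}"
        then have yt: "(y, t) \<in> W" using QW y by blast
        then have gQ: "G (y, t) \<in> Q" by (simp add: W_def)
        have "((\<lambda>t. G (y, t)) has_derivative (\<lambda>h. h *\<^sub>R (y - a))) (at t)"
          unfolding G_def by (auto intro!: derivative_eq_intros)
        from diff_chain_at[OF this D[OF gQ, of v]]
        have "((\<lambda>t. \<theta> (G (y, t)) v) has_derivative (\<lambda>h. D v (G (y, t)) (h *\<^sub>R (y - a)))) (at t)" by (simp add: o_def)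
        then have "((\<lambda>t. \<theta> (G (y, t)) v) has_real_derivative D v (G (y, t)) (y - a)) (at t)"
          unfolding has_field_derivative_def linear_cmul[OF Dl[OF gQ]]
          by (simp add: mult.commute[of _ "D v (G (y, t)) (y - a)"])
        from DERIV_mult[OF DERIV_ident this]
        have "((\<lambda>t. t * \<theta> (G (y, t)) v) has_real_derivative \<theta> (G (y, t)) v + t * D v (G (y, t)) (y - a)) (at t)"
          by (simp add: algebra_simps)
        then show "((\<lambda>t. t * \<theta> (G (y, t)) v) has_vector_derivative frechet_derivative f (at (y, t)) (v, 0)) (at t within {0..1})"
          unfolding fd[OF yt] by (simp add: has_real_derivative_iff_has_vector_derivative has_vector_derivative_at_within)
      qed simp
      moreover have "G (y, 1) = y" by (simp add: G_def)
      ultimately show ?thesis by (simp add: integral_unique)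
    qed
    ultimately show ?thesis by simp
  qed
  then show ?thesis by blast
qed

text \<open>Unitriangular real 3 by 3 matrices with superdiagonal entries \<open>hx\<close>,
  \<open>hy\<close> and corner entry \<open>hz\<close>. Addition stands for the matrix product; the
  class \<open>group_add\<close> allows noncommutative groups.\<close>

datatype heis = Heis (hx: real) (hy: real) (hz: real)

instantiation heis :: group_add
begin
definition "0 = Heis 0 0 0"
definition "g + h = Heis (hx g + hx h) (hy g + hy h) (hz g + hz h + hx g * hy h)"
definition "- g = Heis (- hx g) (- hy g) (- hz g + hx g * hy g)"
definition "g - h = g + - (h :: heis)"
instance
  by standard (auto simp: zero_heis_def plus_heis_def uminus_heis_def minus_heis_def heis.expand algebra_simps)
end

lemma heis_plus [simp]: "hx (g + h) = hx g + hx h" "hy (g + h) = hy g + hy h" "hz (g + h) = hz g + hz h + hx g * hy h"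
  by (simp_all add: plus_heis_def)

lemma heis_uminus [simp]: "hx (- g) = - hx g" "hy (- g) = - hy g" "hz (- g) = - hz g + hx g * hy g"
  by (simp_all add: uminus_heis_def)

lemma path_functional_lincomb:
  fixes G H :: "(real \<Rightarrow> 'a::topological_space) \<Rightarrow> real"
  assumes "path_functional X G" "path_functional X H"
  shows "path_functional X (\<lambda>\<gamma>. s * G \<gamma> + t * H \<gamma>)"
  using assms unfolding path_functional_def by (auto simp: algebra_simps)

context square_cover
begin

text \<open>Bisection along the path. The use is on loops: functionals that differ locally by the
  increments of one global function have equal periods.\<close>

lemma path_functional_determined:
  fixes F F' :: "(real \<Rightarrow> 'a) \<Rightarrow> real"
  assumes F: "path_functional X F" "path_functional X F'"
    and loc: "\<And>k \<gamma>. k < m \<Longrightarrow> path \<gamma> \<Longrightarrow> path_image \<gamma> \<subseteq> sq k 2 \<Longrightarrow> F \<gamma> - F' \<gamma> = u (pathfinish \<gamma>) - u (pathstart \<gamma>)"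
    and g: "path \<gamma>" "path_image \<gamma> \<subseteq> X"
  shows "F \<gamma> - F' \<gamma> = u (pathfinish \<gamma>) - u (pathstart \<gamma>)"
proof -
  define P where "P a b \<longleftrightarrow> (0 \<le> a \<longrightarrow> a \<le> b \<longrightarrow> b \<le> 1 \<longrightarrow> F (piece a b \<gamma>) - F' (piece a b \<gamma>) = u (\<gamma> b) - u (\<gamma> a))" for a b
  have im: "path (piece a b \<gamma>)" "path_image (piece a b \<gamma>) \<subseteq> X" if "0 \<le> a" "a \<le> b" "b \<le> 1" for a b
    using path_piece[OF g(1)] path_image_piece[OF that(2), of \<gamma>] g(2) that by (auto simp: path_image_def image_subset_iff)
  have "(0::real) \<le> 1" by simp
  then have "P 0 1"
  proof (induction rule: Bolzano)
    case (trans a b c)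
    show ?case unfolding P_def
    proof (intro impI)
      assume ac: "0 \<le> a" "a \<le> c" "c \<le> 1"
      have J: "K (piece a c \<gamma>) = K (piece a b \<gamma>) + K (piece b c \<gamma>)" if K: "path_functional X K" for K :: "(real \<Rightarrow> 'a) \<Rightarrow> real"
        using path_functional_homotopic[OF K homotopic_paths_join_pieces[OF g, of a b c]]
          path_functional_join[OF K im[of a b] im[of b c]] trans(3,4) ac by simp
      show "F (piece a c \<gamma>) - F' (piece a c \<gamma>) = u (\<gamma> c) - u (\<gamma> a)"
        using trans ac unfolding P_def by (simp add: J[OF F(1)] J[OF F(2)])
    qed
  next
    case (local t)
    then have t: "t \<in> {0..1}" by simp
    then have "\<gamma> t \<in> X" using g(2) by (auto simp: path_image_def)
    then obtain k where k: "k < m" "\<gamma> t \<in> sq k 2" using sq_cover[of _ 2] by fastforce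
    have "openin (top_of_set {0..1}) ({0..1} \<inter> \<gamma> -` sq k 2)"
      by (rule continuous_openin_preimage[OF _ _ openin_sq[OF k(1)]]) (use g in \<open>auto simp: path_def path_image_def\<close>)
    moreover have "t \<in> {0..1} \<inter> \<gamma> -` sq k 2" using t k by simp
    ultimately obtain d where d: "d > 0" "\<And>s. s \<in> {0..1} \<Longrightarrow> dist s t < d \<Longrightarrow> \<gamma> s \<in> sq k 2"
      unfolding openin_euclidean_subtopology_iff by blast
    have "P a b" if ab: "a \<le> t \<and> t \<le> b \<and> b - a < d" for a b
      unfolding P_def
    proof (intro impI)
      assume 01: "0 \<le> a" "a \<le> b" "b \<le> 1"
      have "\<gamma> ` {a..b} \<subseteq> sq k 2" using d(2) ab 01 by (auto simp: dist_real_def)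
      then show "F (piece a b \<gamma>) - F' (piece a b \<gamma>) = u (\<gamma> b) - u (\<gamma> a)"
        using loc[OF k(1) im(1)[OF 01]] path_image_piece[OF 01(2), of \<gamma>] by simp
    qed
    then show ?case using d(1) by blast
  qed
  then show ?thesis by (simp add: P_def piece_01 pathstart_def pathfinish_def)
qed

lemma sq_subset_X: "k < m \<Longrightarrow> sq k s \<subseteq> X"
  using U_sub by (auto simp: sq_def)

lemma dd_potential:
  assumes G: "path_functional X G" and "j < m" "l < m" "k < m" "z \<in> sq j 2" "z \<in> sq l 2" "z \<in> U k"
  shows "dd k (smooth_potential G j) (\<phi> k z) = dd k (smooth_potential G l) (\<phi> k z)"
proof -
  obtain N where N: "openin (top_of_set X) N" "z \<in> N" "N \<subseteq> sq j 2 \<inter> sq l 2" "\<forall>w\<in>N. overlap G j l w = overlap G j l z"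
    using overlap_locally_constant[OF G assms(2,3,5,6)] by (elim exE conjE) (rule that)
  have "smooth_potential G j w = smooth_potential G l w + overlap G j l z" if "w \<in> N" for w
  proof -
    have "w \<in> X" using openin_imp_subset[OF N(1)] that by blast
    moreover have "overlap G j l w = overlap G j l z" using N(4) that by blast
    ultimately show ?thesis using smooth_potential_diff[of w G j l] by linarith
  qed
  moreover have "smooth_fn N (smooth_potential G l)"
    using smooth_fn_subset[OF smooth_fn_potential[OF G assms(3)]] N(3) by blast
  ultimately show ?thesis
    by (rule dd_cong[OF assms(4,7) N(1,2)])
qed

text \<open>The product of the closed one-forms of \<open>G\<close> and \<open>H\<close>, written
  with the potentials of some square around \<open>z\<close>; the choice does not matter
  (\<open>potential_form_eq\<close>).\<close>

definition potential_form :: "((real \<Rightarrow> 'a) \<Rightarrow> real) \<Rightarrow> ((real \<Rightarrow> 'a) \<Rightarrow> real) \<Rightarrow> nat \<Rightarrow> 'a \<Rightarrow> real" where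
  "potential_form G H k z =
     (let j = SOME j. j < m \<and> z \<in> sq j 2 in wedge k (smooth_potential G j) (smooth_potential H j) z)"

lemma potential_form_eq:
  assumes G: "path_functional X G" and H: "path_functional X H" and k: "k < m" "z \<in> U k" and l: "l < m" "z \<in> sq l 2"
  shows "potential_form G H k z = wedge k (smooth_potential G l) (smooth_potential H l) z"
proof -
  define j where "j = (SOME j. j < m \<and> z \<in> sq j 2)"
  have j: "j < m" "z \<in> sq j 2" unfolding j_def using someI[of "\<lambda>j. j < m \<and> z \<in> sq j 2" l] l by auto
  show ?thesis
    unfolding potential_form_def Let_def j_def[symmetric] wedge_def
      dd_potential[OF G j(1) l(1) k(1) j(2) l(2) k(2)] dd_potential[OF H j(1) l(1) k(1) j(2) l(2) k(2)] ..
qed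

lemma potential_form_lincomb:
  assumes G: "path_functional X G" and H: "path_functional X H" "path_functional X H'" and k: "k < m" "z \<in> U k"
  shows "potential_form G (\<lambda>\<gamma>. s * H \<gamma> + t * H' \<gamma>) k z = s * potential_form G H k z + t * potential_form G H' k z"
proof -
  have "z \<in> X" using U_sub k by blast
  then obtain l where l: "l < m" "z \<in> sq l 2" using sq_cover[of _ 2] by fastforce
  let ?K = "\<lambda>\<gamma>. s * H \<gamma> + t * H' \<gamma>"
  have e: "smooth_potential ?K l = (\<lambda>z. s * smooth_potential H l z + t * smooth_potential H' l z)"
    by (simp add: smooth_potential_def overlap_def potential_def fun_eq_iff sum_distrib_left sum.distrib[symmetric] algebra_simps)
  have "((\<lambda>y. s * smooth_potential H l (\<psi> k y) + t * smooth_potential H' l (\<psi> k y)) has_derivative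
     (\<lambda>v. s * dd k (smooth_potential H l) (\<phi> k z) v + t * dd k (smooth_potential H' l) (\<phi> k z) v)) (at (\<phi> k z))"
    by (intro has_derivative_add has_derivative_mult_right dd_has_derivative[OF smooth_fn_potential] H l k)
  then have d: "dd k (smooth_potential ?K l) (\<phi> k z) = (\<lambda>v. s * dd k (smooth_potential H l) (\<phi> k z) v + t * dd k (smooth_potential H' l) (\<phi> k z) v)"
    unfolding e dd_def[of k "\<lambda>z. s * smooth_potential H l z + t * smooth_potential H' l z"]
    by (rule frechet_derivative_at[symmetric])
  show ?thesis
    unfolding potential_form_eq[OF G path_functional_lincomb[OF H] k l] potential_form_eq[OF G H(1) k l] potential_form_eq[OF G H(2) k l]
      wedge_def d by (simp add: algebra_simps)
qed

text \<open>The partition of unity splits the form into pieces supported in single squares, each a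
  multiple of \<Omega> modulo exact forms.\<close>

lemma potential_form_exact_mod:
  assumes G: "path_functional X G" and H: "path_functional X H"
    and Om: "\<And>l f. l < m \<Longrightarrow> admissible l f \<Longrightarrow> \<exists>r. exact (\<lambda>k z. form l f k z - r * \<Omega> k z)"
  shows "\<exists>r. exact (\<lambda>k z. potential_form G H k z - r * \<Omega> k z)"
proof -
  \<comment> \<open>The extension by zero from the square of size 2 is smooth because \<rho> l
    already vanishes off the closed square of size 1.\<close>
  define f where "f l y = (if y \<in> square (c l) (2 * rad l) then \<rho> l (\<psi> l y) * wedge l (smooth_potential G l) (smooth_potential H l) (\<psi> l y) else 0)" for l y
  have adm: "admissible l (f l)" if l: "l < m" for l
    unfolding admissible_def
  proof (intro conjI allI impI)
    show "f l y = 0" if "y \<notin> csquare (c l) (2 * rad l)" for y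
      using that square_subset_csquare[of "2 * rad l" "2 * rad l" "c l"] by (auto simp: f_def)
    let ?S = "square (c l) (2 * rad l)"
    have SU: "?S \<subseteq> \<phi> l ` U l" using square_sub[OF l, of 2] by simp
    have SS: "?S \<subseteq> \<phi> l ` (U l \<inter> sq l 2)"
    proof
      fix y assume y: "y \<in> ?S"
      then have "y \<in> \<phi> l ` U l" using SU by blast
      then have "\<phi> l (\<psi> l y) = y" "\<psi> l y \<in> U l" by (auto simp: phi_psi)
      moreover from this have "\<psi> l y \<in> sq l 2" using y by (simp add: sq_def)
      ultimately show "y \<in> \<phi> l ` (U l \<inter> sq l 2)" by (metis IntI imageI)
    qed
    have sd: "smooth_on ?S (\<lambda>y. dd l (smooth_potential K l) y v)" if "path_functional X K" for K v
      unfolding dd_def using smooth_fn_potential[OF that l] l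
      by (intro smooth_on_derivative smooth_on_subset[OF _ SS]) (simp add: smooth_fn_def)
    have sr: "smooth_on ?S (\<lambda>y. \<rho> l (\<psi> l y))"
    proof -
      have "smooth_on (\<phi> l ` (U l \<inter> X)) (\<lambda>y. \<rho> l (\<psi> l y))"
        using smooth_rho[OF l] l unfolding smooth_fn_def by blast
      then show ?thesis using U_sub[OF l] SU by (simp add: Int_absorb2 smooth_on_subset)
    qed
    have "smooth_on ?S (\<lambda>y. \<rho> l (\<psi> l y) * (dd l (smooth_potential G l) y e1 * dd l (smooth_potential H l) y e2
        - dd l (smooth_potential G l) y e2 * dd l (smooth_potential H l) y e1))"
      by (intro smooth_on_mult smooth_on_diff sd sr G H open_square)
    then have sS: "smooth_on ?S (f l)"
      by (rule smooth_on_cong[OF open_square, rotated]) (use SU in \<open>auto simp: f_def wedge_def phi_psi\<close>)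
    have oC: "open (- csquare (c l) (1 * rad l))" using compact_imp_closed[OF compact_csquare] by auto
    have f0: "f l y = 0" if "y \<in> - csquare (c l) (1 * rad l)" for y
    proof (cases "y \<in> ?S")
      case True
      then have "y \<in> \<phi> l ` U l" using SU by blast
      then have "\<psi> l y \<notin> csq' l 1" using that csq'_mem[OF l, of 1] by (auto simp: phi_psi)
      then show ?thesis using rho_outside[OF l] by (simp add: f_def)
    qed (simp add: f_def)
    have sC: "smooth_on (- csquare (c l) (1 * rad l)) (f l)"
      by (rule smooth_on_cong[OF oC _ smooth_on_const[OF oC, of 0]]) (use f0 in auto)
    show "smooth_on UNIV (f l)"
    proof (rule smooth_on_local)
      fix y :: "real^2"
      have "y \<in> ?S \<or> y \<in> - csquare (c l) (1 * rad l)"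
        using csquare_subset_square[of "1 * rad l" "2 * rad l" "c l"] rad[OF l] by auto
      then show "\<exists>N. open N \<and> y \<in> N \<and> smooth_on N (f l)" using sS sC open_square oC by blast
    qed
  qed
  have piece: "form l (f l) k z = \<rho> l z * potential_form G H k z" if l: "l < m" and k: "k < m" "z \<in> U k" for l k z
  proof (cases "z \<in> sq l 2")
    case True
    then have z: "z \<in> U l" "\<phi> l z \<in> square (c l) (2 * rad l)" by (auto simp: sq_def)
    have "wedge k (smooth_potential G l) (smooth_potential H l) z = jac k l (\<phi> k z) * wedge l (smooth_potential G l) (smooth_potential H l) z"
      by (rule wedge_transition[OF smooth_fn_potential[OF G l] smooth_fn_potential[OF H l] openin_sq[OF l] k(1) l k(2) z(1) True])
    then show ?thesis
      using z potential_form_eq[OF G H k l True] by (simp add: form_def f_def psi_phi l)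
  next
    case False
    then have "z \<notin> csq' l 1" using csq'_subset_sq[OF l, of 1 2] by auto
    then show ?thesis using False rho_outside[OF l] by (auto simp: form_def f_def sq_def)
  qed
  have "\<exists>r. exact (\<lambda>k z. (\<Sum>l<n. form l (f l) k z) - r * \<Omega> k z)" if "n \<le> m" for n
    using that
  proof (induction n)
    case 0
    have "smooth_fn X (\<lambda>_. 0)" by (rule smooth_fn_const) auto
    from exact_lincomb[OF exact_wedge[OF this this] exact_wedge[OF this this], of 0 0]
    have "exact (\<lambda>k z. 0)" by simp
    then show ?case by (intro exI[of _ 0]) simp
  next
    case (Suc n)
    then obtain r where r: "exact (\<lambda>k z. (\<Sum>l<n. form l (f l) k z) - r * \<Omega> k z)" by auto
    obtain r' where r': "exact (\<lambda>k z. form n (f n) k z - r' * \<Omega> k z)" using Om[of n] adm[of n] Suc by auto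
    have "exact (\<lambda>k z. (\<Sum>l<Suc n. form l (f l) k z) - (r + r') * \<Omega> k z)"
      by (rule exact_cong[OF exact_lincomb[OF r r', of 1 1]]) (simp add: algebra_simps)
    then show ?case by blast
  qed
  then obtain r where r: "exact (\<lambda>k z. (\<Sum>l<m. form l (f l) k z) - r * \<Omega> k z)" by blast
  have "exact (\<lambda>k z. potential_form G H k z - r * \<Omega> k z)"
  proof (rule exact_cong[OF r])
    fix k z assume k: "k < m" "z \<in> U k"
    have "(\<Sum>l<m. form l (f l) k z) = (\<Sum>l<m. \<rho> l z) * potential_form G H k z"
      unfolding sum_distrib_right by (rule sum.cong) (use piece k in auto)
    then show "potential_form G H k z - r * \<Omega> k z = (\<Sum>l<m. form l (f l) k z) - r * \<Omega> k z"
      using rho_sum[of z] U_sub k by auto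
  qed
  then show ?thesis by blast
qed

text \<open>If \<open>dF \<and> dH = d\<eta>\<close> then \<open>F dH - \<eta>\<close> has local primitives \<open>E\<close>, and \<open>(F, H, E)\<close> are local sections
  whose quotients in the Heisenberg group are locally constant.\<close>

lemma heisenberg_holonomy:
  assumes G: "path_functional X G" and H: "path_functional X H" and ex: "exact (potential_form G H)"
  shows "\<exists>T :: (real \<Rightarrow> 'a) \<Rightarrow> heis. path_functional X T \<and>
    (\<forall>\<gamma>. path \<gamma> \<longrightarrow> path_image \<gamma> \<subseteq> X \<longrightarrow> pathfinish \<gamma> = pathstart \<gamma> \<longrightarrow> hx (T \<gamma>) = G \<gamma> \<and> hy (T \<gamma>) = H \<gamma>)"
proof -
  let ?F = "smooth_potential G" and ?H = "smooth_potential H"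
  obtain \<eta> where \<eta>: "one_form \<eta>" "\<And>k z. k < m \<Longrightarrow> z \<in> U k \<Longrightarrow> potential_form G H k z = curl \<eta> k z"
    using ex unfolding exact_def by blast
  have "\<exists>E. \<forall>y\<in>square (c k) (2 * rad k). (E has_derivative (\<lambda>v. ?F k (\<psi> k y) * dd k (?H k) y v - \<eta> k y v)) (at y)" if k: "k < m" for k
  proof (rule closed_form_primitive)
    let ?S = "square (c k) (2 * rad k)"
    have SU: "?S \<subseteq> \<phi> k ` U k" using square_sub[OF k, of 2] by simp
    have Spt: "\<exists>z. z \<in> sq k 2 \<and> z \<in> U k \<and> y = \<phi> k z" if "y \<in> ?S" for y
      using that SU phi_psi[of y k] by (intro exI[of _ "\<psi> k y"]) (auto simp: sq_def)
    have SS: "?S \<subseteq> \<phi> k ` (U k \<inter> sq k 2)" using Spt by blast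
    show "open ?S" "convex ?S" "c k \<in> ?S" using rad[OF k] by (simp_all add: open_square convex_square centre_in_square)
    have sp: "smooth_on ?S (\<lambda>y. smooth_potential K k (\<psi> k y))" if "path_functional X K" for K
      using smooth_fn_potential[OF that k] k by (intro smooth_on_subset[OF _ SS]) (simp add: smooth_fn_def)
    have sd: "smooth_on ?S (\<lambda>y. dd k (?H k) y v)" for v
      unfolding dd_def by (rule smooth_on_derivative[OF sp[OF H]])
    have se: "smooth_on ?S (\<lambda>y. \<eta> k y v)" for v by (rule smooth_on_subset[OF one_formD(1)[OF \<eta>(1) k] SU])
    show "smooth_on ?S (\<lambda>y. ?F k (\<psi> k y) * dd k (?H k) y v - \<eta> k y v)" for v
      by (intro smooth_on_diff smooth_on_mult sp G sd se open_square)
    show "linear (\<lambda>v. ?F k (\<psi> k y) * dd k (?H k) y v - \<eta> k y v)" if y: "y \<in> ?S" for y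
    proof -
      obtain z where z: "z \<in> sq k 2" "z \<in> U k" "y = \<phi> k z" using Spt[OF y] by blast
      have "linear (dd k (?H k) y)" unfolding z(3) by (rule linear_dd[OF smooth_fn_potential[OF H k] k z(2,1)])
      moreover have "linear (\<eta> k y)" unfolding z(3) by (rule one_formD(2)[OF \<eta>(1) k z(2)])
      ultimately show ?thesis by (intro linearI) (simp_all add: linear_add linear_cmul algebra_simps)
    qed
    fix y assume y: "y \<in> ?S"
    obtain z where z: "z \<in> sq k 2" "z \<in> U k" "y = \<phi> k z" using Spt[OF y] by blast
    have "frechet_derivative (\<lambda>y. ?F k (\<psi> k y) * dd k (?H k) y v - \<eta> k y v) (at y) =
      (\<lambda>w. (?F k (\<psi> k y) * frechet_derivative (\<lambda>y. dd k (?H k) y v) (at y) w + dd k (?F k) y w * dd k (?H k) y v)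
         - frechet_derivative (\<lambda>y. \<eta> k y v) (at y) w)" for v
      unfolding dd_def[of k "?F k"]
      by (rule frechet_derivative_at[OF has_derivative_diff[OF has_derivative_mult[OF smooth_on_has_derivative[OF sp[OF G] y]
          smooth_on_has_derivative[OF sd y]] smooth_on_has_derivative[OF se y]], symmetric])
    moreover have "frechet_derivative (\<lambda>y. dd k (?H k) y e2) (at y) e1 = frechet_derivative (\<lambda>y. dd k (?H k) y e1) (at y) e2"
      unfolding dd_def by (rule smooth_on_mixed_derivatives[OF sp[OF H] open_square y])
    moreover have "dd k (?F k) y e1 * dd k (?H k) y e2 - dd k (?F k) y e2 * dd k (?H k) y e1 =
       frechet_derivative (\<lambda>y. \<eta> k y e2) (at y) e1 - frechet_derivative (\<lambda>y. \<eta> k y e1) (at y) e2"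
      using \<eta>(2)[OF k z(2)] potential_form_eq[OF G H k z(2) k z(1)] by (simp add: curl_def wedge_def z(3))
    ultimately show "frechet_derivative (\<lambda>y. ?F k (\<psi> k y) * dd k (?H k) y e2 - \<eta> k y e2) (at y) e1
        = frechet_derivative (\<lambda>y. ?F k (\<psi> k y) * dd k (?H k) y e1 - \<eta> k y e1) (at y) e2"
      by simp
  qed
  then have "\<forall>k\<in>{..<m}. \<exists>E. \<forall>y\<in>square (c k) (2 * rad k). (E has_derivative (\<lambda>v. ?F k (\<psi> k y) * dd k (?H k) y v - \<eta> k y v)) (at y)" by simp
  from bchoice[OF this] obtain E
    where "\<forall>k\<in>{..<m}. \<forall>y\<in>square (c k) (2 * rad k). (E k has_derivative (\<lambda>v. ?F k (\<psi> k y) * dd k (?H k) y v - \<eta> k y v)) (at y)" by (elim exE) (rule that)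
  then have E: "(E k has_derivative (\<lambda>v. ?F k (\<psi> k y) * dd k (?H k) y v - \<eta> k y v)) (at y)" if "k < m" "y \<in> square (c k) (2 * rad k)" for k y
    using that by simp
  define S where "S k z = Heis (?F k z) (?H k z) (E k (\<phi> k z))" for k z
  interpret local_system X m "\<lambda>k. sq k 2" S
  proof
    show "openin (top_of_set X) (sq k 2)" if "k < m" for k by (rule openin_sq[OF that])
    show "X \<subseteq> (\<Union>k<m. sq k 2)" using sq_cover[of _ 2] by fastforce
    fix k l z assume k: "k < m" and l: "l < m" and z: "z \<in> sq k 2" "z \<in> sq l 2"
    obtain N1 where N1: "openin (top_of_set X) N1" "z \<in> N1" "N1 \<subseteq> sq k 2 \<inter> sq l 2" "\<forall>w\<in>N1. overlap G k l w = overlap G k l z"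
      using overlap_locally_constant[OF G k l z] by blast
    obtain N2 where N2: "openin (top_of_set X) N2" "z \<in> N2" "\<forall>w\<in>N2. overlap H k l w = overlap H k l z"
      using overlap_locally_constant[OF H k l z] by blast
    define N where "N = N1 \<inter> N2"
    have N: "openin (top_of_set X) N" "z \<in> N" unfolding N_def using N1 N2 by auto
    define a where "a = overlap G k l z"
    define b where "b = overlap H k l z"
    have NX: "w \<in> X" "w \<in> sq k 2" "w \<in> sq l 2" "w \<in> U k" "w \<in> U l" if "w \<in> N" for w
      using that N1(3) openin_imp_subset[OF N(1)] by (auto simp: N_def sq_def)
    have Fa: "?F k w = a + ?F l w" and Hb: "?H k w = b + ?H l w" if "w \<in> N" for w
      using smooth_potential_diff[OF NX(1)[OF that], of G k l] smooth_potential_diff[OF NX(1)[OF that], of H k l] N1(4) N2(3) that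
      by (auto simp: N_def a_def b_def)
    have "open (\<phi> k ` (U k \<inter> N))" by (rule open_phi[OF k N(1)])
    moreover have "\<phi> k z \<in> \<phi> k ` (U k \<inter> N)" using N(2) NX(4)[OF N(2)] by blast
    ultimately obtain e where e: "e > 0" "ball (\<phi> k z) e \<subseteq> \<phi> k ` (U k \<inter> N)" by (meson openE)
    let ?B = "ball (\<phi> k z) e"
    \<comment> \<open>For \<open>S k = Heis a b r + S l\<close> the third coordinates force r = E k
      - E l - a H l, so this expression has to be locally constant. Its derivative vanishes because
      F k = a + F l.\<close>
    define q where "q y = E k y - E l (\<phi> l (\<psi> k y)) - a * ?H l (\<psi> k y)" for y
    have "\<exists>r. \<forall>y\<in>?B. q y = r"
    proof (rule has_derivative_zero_constant[OF convex_ball])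
      fix y assume "y \<in> ?B"
      then obtain w where w: "w \<in> U k" "w \<in> N" "y = \<phi> k w" using e(2) by blast
      have wl: "w \<in> U l" "w \<in> sq l 2" "w \<in> sq k 2" using NX w by auto
      have 1: "(E k has_derivative (\<lambda>v. ?F k w * dd k (?H k) y v - \<eta> k y v)) (at y)"
        using E[OF k, of y] wl(3) by (simp add: sq_def w psi_phi k)
      have "(E l has_derivative (\<lambda>v. ?F l w * dd l (?H l) (\<phi> l w) v - \<eta> l (\<phi> l w) v)) (at (\<phi> l w))"
        using E[OF l, of "\<phi> l w"] wl(2) by (simp add: sq_def psi_phi l)
      then have "(E l has_derivative (\<lambda>v. ?F l w * dd l (?H l) (\<phi> l w) v - \<eta> l (\<phi> l w) v)) (at (\<phi> l (\<psi> k y)))"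
        by (simp add: w psi_phi k)
      from diff_chain_at[OF trans_has_derivative[OF k l w(1) wl(1)] this[unfolded w(3)]]
      have "((\<lambda>y. E l (\<phi> l (\<psi> k y))) has_derivative
         (\<lambda>v. ?F l w * dd l (?H l) (\<phi> l w) (trans k l y v) - \<eta> l (\<phi> l w) (trans k l y v))) (at y)"
        by (simp add: o_def w(3))
      moreover have "dd l (?H l) (\<phi> l w) (trans k l y v) = dd k (?H k) y v" for v
        using dd_transition[OF smooth_fn_potential[OF H l] openin_sq[OF l] k l w(1) wl(1,2), of v] dd_potential[OF H k l k wl(3,2) w(1)]
        by (simp add: w(3))
      moreover have "\<eta> l (\<phi> l w) (trans k l y v) = \<eta> k y v" for v
        using one_formD(3)[OF \<eta>(1) k l w(1) wl(1), of v] by (simp add: w(3))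
      ultimately have 2: "((\<lambda>y. E l (\<phi> l (\<psi> k y))) has_derivative (\<lambda>v. ?F l w * dd k (?H k) y v - \<eta> k y v)) (at y)" by simp
      have 3: "((\<lambda>y. ?H l (\<psi> k y)) has_derivative dd k (?H k) y) (at y)"
        using dd_has_derivative[OF smooth_fn_potential[OF H l] k w(1) wl(2)] dd_potential[OF H k l k wl(3,2) w(1)] by (simp add: w(3))
      have "(q has_derivative (\<lambda>v. (?F k w * dd k (?H k) y v - \<eta> k y v) - (?F l w * dd k (?H k) y v - \<eta> k y v) - a * dd k (?H k) y v)) (at y)"
        unfolding q_def by (intro has_derivative_diff has_derivative_mult_right 1 2 3)
      moreover have "(\<lambda>v. (?F k w * dd k (?H k) y v - \<eta> k y v) - (?F l w * dd k (?H k) y v - \<eta> k y v) - a * dd k (?H k) y v) = (\<lambda>v. 0)"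
        using Fa[OF w(2)] by (simp add: fun_eq_iff algebra_simps)
      ultimately show "(q has_derivative (\<lambda>v. 0)) (at y within ?B)" by (simp add: has_derivative_at_withinI)
    qed
    then obtain r where r: "\<And>y. y \<in> ?B \<Longrightarrow> q y = r" by blast
    let ?N = "N \<inter> (U k \<inter> \<phi> k -` ?B)"
    have "openin (top_of_set X) ?N" by (intro openin_Int N openin_chart_preimage[OF charts[OF k]]) simp
    moreover have "z \<in> ?N" using N NX(4)[OF N(2)] e(1) by simp
    moreover have "S k w = Heis a b r + S l w" if w: "w \<in> ?N" for w
      using r[of "\<phi> k w"] w Fa[of w] Hb[of w] by (simp add: S_def plus_heis_def q_def psi_phi k)
    ultimately show "\<exists>N g. openin (top_of_set X) N \<and> z \<in> N \<and> (\<forall>w\<in>N. S k w = g + S l w)" by blast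
  qed
  have T: "path_functional X holonomy" by (rule path_functional_holonomy)
  have co: "hx (holonomy \<gamma>) = G \<gamma> \<and> hy (holonomy \<gamma>) = H \<gamma>"
    if g: "path \<gamma>" "path_image \<gamma> \<subseteq> X" "pathfinish \<gamma> = pathstart \<gamma>" for \<gamma>
  proof -
    have px: "path_functional X (\<lambda>\<gamma>. hx (holonomy \<gamma>))" and py: "path_functional X (\<lambda>\<gamma>. hy (holonomy \<gamma>))"
      using T unfolding path_functional_def by auto
    \<comment> \<open>Smoothing subtracts the same averaged potential in all squares, so locally the
      holonomy coordinate and \<open>K\<close> differ by the increment of one global
      function.\<close>
    have L: "smooth_potential K k (pathfinish \<gamma>) - smooth_potential K k (pathstart \<gamma>) - K \<gamma> =
        - (\<Sum>j<m. \<rho> j (pathfinish \<gamma>) * potential K j (pathfinish \<gamma>)) - - (\<Sum>j<m. \<rho> j (pathstart \<gamma>) * potential K j (pathstart \<gamma>))"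
      if K: "path_functional X K" and k: "k < m" and \<gamma>: "path \<gamma>" "path_image \<gamma> \<subseteq> sq k 2" for K k \<gamma>
    proof -
      have "pathstart \<gamma> \<in> X" "pathfinish \<gamma> \<in> X" using \<gamma> sq_subset_X[OF k] pathstart_in_path_image pathfinish_in_path_image by blast+
      then show ?thesis using potential_diff[OF K k \<gamma>] by (simp add: smooth_potential_eq)
    qed
    have "hx (holonomy \<gamma>) - G \<gamma> = - (\<Sum>j<m. \<rho> j (pathfinish \<gamma>) * potential G j (pathfinish \<gamma>)) - - (\<Sum>j<m. \<rho> j (pathstart \<gamma>) * potential G j (pathstart \<gamma>))"
      by (rule path_functional_determined[OF px G _ g(1,2)]) (use L[OF G] holonomy_in in \<open>simp add: S_def\<close>)
    moreover have "hy (holonomy \<gamma>) - H \<gamma> = - (\<Sum>j<m. \<rho> j (pathfinish \<gamma>) * potential H j (pathfinish \<gamma>)) - - (\<Sum>j<m. \<rho> j (pathstart \<gamma>) * potential H j (pathstart \<gamma>))"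
      by (rule path_functional_determined[OF py H _ g(1,2)]) (use L[OF H] holonomy_in in \<open>simp add: S_def\<close>)
    ultimately show ?thesis using g(3) by simp
  qed
  show ?thesis using T co by blast
qed

lemma heisenberg_from_three:
  assumes F: "\<And>i. i < 3 \<Longrightarrow> path_functional X (F i)" and ne: "X \<noteq> {}"
  shows "\<exists>s t (T :: (real \<Rightarrow> 'a) \<Rightarrow> heis). (s, t) \<noteq> (0, 0) \<and> path_functional X T \<and>
    (\<forall>\<gamma>. path \<gamma> \<longrightarrow> path_image \<gamma> \<subseteq> X \<longrightarrow> pathfinish \<gamma> = pathstart \<gamma> \<longrightarrow>
       hx (T \<gamma>) = F 0 \<gamma> \<and> hy (T \<gamma>) = s * F 1 \<gamma> + t * F (2::nat) \<gamma>)"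
proof -
  obtain \<Omega> where Om: "\<And>l f. l < m \<Longrightarrow> admissible l f \<Longrightarrow> \<exists>r. exact (\<lambda>k z. form l f k z - r * \<Omega> k z)"
    using forms_one_dimensional[OF ne] by blast
  have P: "path_functional X (F 0)" "path_functional X (F 1)" "path_functional X (F 2)" by (auto intro: F)
  obtain r1 where r1: "exact (\<lambda>k z. potential_form (F 0) (F 1) k z - r1 * \<Omega> k z)"
    using potential_form_exact_mod[OF P(1,2) Om] by blast
  obtain r2 where r2: "exact (\<lambda>k z. potential_form (F 0) (F 2) k z - r2 * \<Omega> k z)"
    using potential_form_exact_mod[OF P(1,3) Om] by blast
  \<comment> \<open>A nonzero vector orthogonal to (r1, r2).\<close>
  obtain s t :: real where st: "(s, t) \<noteq> (0, 0)" "s * r1 + t * r2 = 0"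
  proof (cases "r1 = 0")
    case True then show ?thesis using that[of 1 0] by simp
  next
    case False then show ?thesis using that[of r2 "- r1"] by simp
  qed
  have "exact (potential_form (F 0) (\<lambda>\<gamma>. s * F 1 \<gamma> + t * F 2 \<gamma>))"
  proof (rule exact_cong[OF exact_lincomb[OF r1 r2, of s t]])
    fix k z assume k: "k < m" "z \<in> U k"
    have "s * (x - r1 * w) + t * (y - r2 * w) = s * x + t * y - (s * r1 + t * r2) * w" for x y w :: real
      by (simp add: algebra_simps)
    then show "potential_form (F 0) (\<lambda>\<gamma>. s * F 1 \<gamma> + t * F 2 \<gamma>) k z =
       s * (potential_form (F 0) (F 1) k z - r1 * \<Omega> k z) + t * (potential_form (F 0) (F 2) k z - r2 * \<Omega> k z)"
      unfolding potential_form_lincomb[OF P k] using st(2) by simp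
  qed
  from heisenberg_holonomy[OF P(1) path_functional_lincomb[OF P(2,3)] this]
  obtain T :: "(real \<Rightarrow> 'a) \<Rightarrow> heis" where T: "path_functional X T"
    "\<forall>\<gamma>. path \<gamma> \<longrightarrow> path_image \<gamma> \<subseteq> X \<longrightarrow> pathfinish \<gamma> = pathstart \<gamma> \<longrightarrow>
       hx (T \<gamma>) = F 0 \<gamma> \<and> hy (T \<gamma>) = s * F 1 \<gamma> + t * F 2 \<gamma>"
    by (elim exE conjE) (rule that)
  show ?thesis by (rule exI[of _ s], rule exI[of _ t], rule exI[of _ T], intro conjI st(1) T)
qed

end

section \<open>Point pushing along a loop and the homological action\<close>

text \<open>Pigeonhole on the cosets of the powers of \<open>x\<close>: two of them coincide, and
  the quotient of these powers lies in \<open>K\<close>.\<close>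

lemma (in group) finite_index_power:
  assumes K: "subgroup K G" "finite (rcosets K)" and x: "x \<in> carrier G"
  shows "\<exists>N>0. x [^] (N::nat) \<in> K"
proof -
  have "range (\<lambda>i::nat. K #> (x [^] i)) \<subseteq> rcosets K"
    using x K(1) by (auto simp: RCOSETS_def)
  then have "finite (range (\<lambda>i::nat. K #> (x [^] i)))" using K(2) finite_subset by blast
  then have "\<not> inj (\<lambda>i::nat. K #> (x [^] i))" using finite_imageD infinite_UNIV_nat by blast
  then obtain i j where ij: "i < j" "K #> (x [^] i) = K #> (x [^] (j::nat))"
    by (metis (mono_tags, lifting) injI linorder_neqE_nat)
  have "x [^] j \<in> K #> (x [^] i)" unfolding ij(2) using rcos_self[OF _ K(1)] x by simp
  then obtain k where k: "k \<in> K" "x [^] j = k \<otimes> x [^] i" by (auto simp: r_coset_def)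
  have kc: "k \<in> carrier G" using k(1) subgroup.subset[OF K(1)] by blast
  have "x [^] (j - i) \<otimes> x [^] i = k \<otimes> x [^] i"
    using ij(1) x k(2) by (simp add: nat_pow_mult)
  then have "x [^] (j - i) = k" using x kc by simp
  then show ?thesis using ij(1) k(1) by (intro exI[of _ "j - i"]) simp
qed

text \<open>Conjugating \<open>c\<close> by \<open>b\<close> multiplies it by the commutator of
  \<open>b\<close> and \<open>c\<close>, so every coset of the derived subgroup is mapped into
  itself; it is mapped onto itself because the inverse conjugation has the same property.\<close>

lemma H1_map_inner:
  fixes G (structure)
  assumes "group G" and k: "k \<in> carrier G"
    and \<alpha>: "\<And>a. a \<in> carrier G \<Longrightarrow> \<alpha> a = inv k \<otimes> a \<otimes> k"
  shows "H1_map G \<alpha> = (\<lambda>C\<in>carrier (H1 G). C)"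
  unfolding H1_map_def
proof (rule restrict_ext)
  interpret group G by fact
  let ?D = "derived G (carrier G)"
  have D: "subgroup ?D G" by (rule derived_is_subgroup) simp
  have comm: "b \<otimes> c \<otimes> inv b \<otimes> inv c \<in> ?D" if "b \<in> carrier G" "c \<in> carrier G" for b c
    unfolding derived_def by (rule generate.incl) (use that in blast)
  fix C assume "C \<in> carrier (H1 G)"
  then obtain a where a: "a \<in> carrier G" "C = ?D #> a"
    by (auto simp: H1_def FactGroup_def RCOSETS_def)
  have Cc: "c \<in> carrier G" "C = ?D #> c" if "c \<in> C" for c
    using that a repr_independence[OF _ a(1) D] subgroup.subset[OF D] r_coset_subset_G by blast+
  have cong: "b \<otimes> c \<otimes> inv b \<in> C" if "c \<in> C" "b \<in> carrier G" for b c
  proof -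
    have "b \<otimes> c \<otimes> inv b = (b \<otimes> c \<otimes> inv b \<otimes> inv c) \<otimes> c" using that Cc(1)[OF that(1)] by (simp add: m_assoc)
    then show ?thesis using comm[OF that(2) Cc(1)[OF that(1)]] Cc(2)[OF that(1)] by (auto simp: r_coset_def)
  qed
  show "\<alpha> ` C = C"
  proof (intro equalityI subsetI)
    fix c assume "c \<in> \<alpha> ` C"
    then obtain b where b: "b \<in> C" "c = \<alpha> b" by blast
    show "c \<in> C" using cong[OF b(1) inv_closed[OF k]] Cc(1)[OF b(1)] k b \<alpha> by simp
  next
    fix c assume c: "c \<in> C"
    have "c = \<alpha> (k \<otimes> c \<otimes> inv k)"
      using Cc(1)[OF c] k \<alpha>[of "k \<otimes> c \<otimes> inv k"] by (simp add: m_assoc flip: m_assoc[of "inv k" k c])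
    then show "c \<in> \<alpha> ` C" using cong[OF c k] by blast
  qed
qed

lemma carrier_fundamental_group: "carrier (fundamental_group X p) = path_class X ` loops_at X p"
  by (simp add: fundamental_group_def)

lemma fundamental_group_map_class:
  assumes f: "continuous_on X f" "f ` X \<subseteq> X" and \<gamma>: "\<gamma> \<in> loops_at X p"
  shows "fundamental_group_map X p f (path_class X \<gamma>) = path_class X (f \<circ> \<gamma>)"
proof -
  have "path_class X (f \<circ> \<delta>) = path_class X (f \<circ> \<gamma>)" if "\<delta> \<in> path_class X \<gamma>" for \<delta>
  proof -
    have "homotopic_paths X \<gamma> \<delta>" using that by (simp add: path_class_def)
    then have "homotopic_paths X (f \<circ> \<gamma>) (f \<circ> \<delta>)"
      by (rule homotopic_paths_continuous_image) (use f in auto)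
    then show ?thesis by (rule path_class_eq[symmetric])
  qed
  moreover have "\<gamma> \<in> path_class X \<gamma>" using \<gamma> by (simp add: path_class_def loops_at_def)
  ultimately have "(\<Union>\<delta>\<in>path_class X \<gamma>. path_class X (f \<circ> \<delta>)) = path_class X (f \<circ> \<gamma>)" by blast
  then show ?thesis using \<gamma> by (simp add: fundamental_group_map_def carrier_fundamental_group)
qed

text \<open>That \<open>k\<close> lies in \<open>K\<close> is decisive: the restricted conjugation
  is then inner in \<open>K\<close> and so trivial on its abelianization.\<close>

lemma homological_action_inner:
  assumes p: "p \<in> X" and K: "subgroup K (fundamental_group X p)" and k: "k \<in> K"
    and f: "\<And>a. a \<in> carrier (fundamental_group X p) \<Longrightarrow>
      fundamental_group_map X p f a = inv\<^bsub>fundamental_group X p\<^esub> k \<otimes>\<^bsub>fundamental_group X p\<^esub> a \<otimes>\<^bsub>fundamental_group X p\<^esub> k"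
  shows "homological_action X p K f = (\<lambda>C\<in>carrier (H1 (fundamental_group X p \<lparr>carrier := K\<rparr>)). C)"
proof -
  interpret group "fundamental_group X p" by (rule group_fundamental_group[OF p])
  show ?thesis
    unfolding homological_action_def
    by (rule H1_map_inner[of _ k])
      (use subgroup_imp_group[OF K] k f subgroup.subset[OF K] m_inv_consistent[OF K k] in auto)
qed

context closed_surface
begin

text \<open>The relation in \<open>pushes\<close>, read in the fundamental group and solved for the
  image class.\<close>

lemma push_conjugation:
  assumes f: "pushes \<gamma> f" and \<gamma>: "\<gamma> \<in> loops_at X p" and a: "a \<in> carrier (fundamental_group X p)"
  defines "c \<equiv> path_class X \<gamma>"
  shows "fundamental_group_map X p f a = inv\<^bsub>fundamental_group X p\<^esub> c \<otimes>\<^bsub>fundamental_group X p\<^esub> a \<otimes>\<^bsub>fundamental_group X p\<^esub> c"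
proof -
  have ends: "pathstart \<gamma> = p" "pathfinish \<gamma> = p" using \<gamma> by (auto simp: loops_at_def)
  have p: "p \<in> X" using \<gamma> by (auto simp: loops_at_def pathstart_in_path_image)
  interpret group "fundamental_group X p" by (rule group_fundamental_group[OF p])
  have od: "f \<in> oriented_diffeos" and fp: "f p = p" using f ends by (auto simp: pushes_def)
  obtain \<delta> where d: "\<delta> \<in> loops_at X p" "a = path_class X \<delta>" using a by (auto simp: carrier_fundamental_group)
  have fd: "f \<circ> \<delta> \<in> loops_at X p" using loops_at_image[OF od d(1)] fp by simp
  have "homotopic_paths X (\<delta> +++ \<gamma>) (\<gamma> +++ (f \<circ> \<delta>))" using f d(1) ends by (simp add: pushes_def)
  then have "a \<otimes>\<^bsub>fundamental_group X p\<^esub> c = c \<otimes>\<^bsub>fundamental_group X p\<^esub> path_class X (f \<circ> \<delta>)"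
    using path_class_eq mult_class[OF d(1) \<gamma>] mult_class[OF \<gamma> fd] by (simp add: c_def d(2))
  moreover have "c \<in> carrier (fundamental_group X p)" "path_class X (f \<circ> \<delta>) \<in> carrier (fundamental_group X p)"
    using \<gamma> fd by (auto simp: carrier_fundamental_group c_def)
  ultimately have "path_class X (f \<circ> \<delta>) = inv\<^bsub>fundamental_group X p\<^esub> c \<otimes>\<^bsub>fundamental_group X p\<^esub> a \<otimes>\<^bsub>fundamental_group X p\<^esub> c"
    using a by (simp add: inv_solve_left m_assoc)
  then show ?thesis using fundamental_group_map_class[OF _ _ d(1), of f] oriented_diffeos_continuous[OF od] d(2) by simp
qed

lemma heisenberg_loops:
  fixes n :: nat
  assumes iso: "homology_group 1 (top_of_set X) \<cong> free_Abelian_group {..<n}" and n: "n \<ge> 3" and p: "p \<in> X"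
  shows "\<exists>(T :: (real \<Rightarrow> 'a) \<Rightarrow> heis) x y. path_functional X T \<and> x \<in> loops_at X p \<and> y \<in> loops_at X p \<and>
    hx (T x) = 1 \<and> hy (T x) = 0 \<and> hy (T y) \<noteq> 0"
proof -
  obtain F :: "nat \<Rightarrow> (real \<Rightarrow> 'a) \<Rightarrow> real" and x where F: "\<And>i. i < n \<Longrightarrow> path_functional X (F i)" "\<And>i. i < n \<Longrightarrow> x i \<in> loops_at X p"
    "\<And>i j. i < n \<Longrightarrow> j < n \<Longrightarrow> F i (x j) = (if i = j then 1 else 0)"
    using homology_coordinates[OF iso path_connected_X p] by (elim exE) (rule that, auto)
  obtain m U \<phi> c rad where "square_cover X A m U \<phi> c rad" using square_cover_exists by (elim exE) (rule that)
  then interpret square_cover X A m U \<phi> c rad .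
  have F3: "path_functional X (F i)" if "i < 3" for i using F(1) n that by simp
  have "\<exists>s t (T :: (real \<Rightarrow> 'a) \<Rightarrow> heis). (s, t) \<noteq> (0, 0) \<and> path_functional X T \<and>
    (\<forall>\<gamma>. path \<gamma> \<longrightarrow> path_image \<gamma> \<subseteq> X \<longrightarrow> pathfinish \<gamma> = pathstart \<gamma> \<longrightarrow>
       hx (T \<gamma>) = F 0 \<gamma> \<and> hy (T \<gamma>) = s * F 1 \<gamma> + t * F (2::nat) \<gamma>)"
    by (rule heisenberg_from_three) (use F3 p in auto)
  then obtain s t and T :: "(real \<Rightarrow> 'a) \<Rightarrow> heis" where st: "(s, t) \<noteq> (0, 0)" and T: "path_functional X T"
    and T': "\<forall>\<gamma>. path \<gamma> \<longrightarrow> path_image \<gamma> \<subseteq> X \<longrightarrow> pathfinish \<gamma> = pathstart \<gamma> \<longrightarrow>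
       hx (T \<gamma>) = F 0 \<gamma> \<and> hy (T \<gamma>) = s * F 1 \<gamma> + t * F 2 \<gamma>"
    by (elim exE conjE) (rule that)
  have l: "hx (T \<gamma>) = F 0 \<gamma>" "hy (T \<gamma>) = s * F 1 \<gamma> + t * F 2 \<gamma>" if "\<gamma> \<in> loops_at X p" for \<gamma>
    using T' that by (simp_all add: loops_at_def)
  \<comment> \<open>The value of \<open>hy\<close> is s on \<open>x 1\<close> and t on
    \<open>x 2\<close>, and s and t are not both zero.\<close>
  define y where "y = (if s \<noteq> 0 then x 1 else x 2)"
  have "x 0 \<in> loops_at X p" "y \<in> loops_at X p" using F(2) n by (auto simp: y_def)
  moreover have "hx (T (x 0)) = 1" "hy (T (x 0)) = 0" using l F n by auto
  moreover have "hy (T y) \<noteq> 0" using l F n st by (auto simp: y_def)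
  ultimately show ?thesis using T by blast
qed

lemma power_not_commuting:
  fixes n :: nat
  assumes iso: "homology_group 1 (top_of_set X) \<cong> free_Abelian_group {..<n}" and n: "n \<ge> 3" and p: "p \<in> X"
  obtains x y where "x \<in> carrier (fundamental_group X p)" "y \<in> carrier (fundamental_group X p)"
    "\<And>N::nat. N > 0 \<Longrightarrow> x [^]\<^bsub>fundamental_group X p\<^esub> N \<otimes>\<^bsub>fundamental_group X p\<^esub> y \<noteq> y \<otimes>\<^bsub>fundamental_group X p\<^esub> x [^]\<^bsub>fundamental_group X p\<^esub> N"
proof -
  interpret group "fundamental_group X p" by (rule group_fundamental_group[OF p])
  obtain T :: "(real \<Rightarrow> 'a) \<Rightarrow> heis" and \<xi> \<upsilon> where T: "path_functional X T" and l: "\<xi> \<in> loops_at X p" "\<upsilon> \<in> loops_at X p"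
    and h: "hx (T \<xi>) = 1" "hy (T \<xi>) = 0" "hy (T \<upsilon>) \<noteq> 0"
    using heisenberg_loops[OF assms] by (elim exE conjE) (rule that)
  \<comment> \<open>\<open>T\<close> is constant on homotopy classes, so any representative of a
    class will do.\<close>
  define V where "V a = T (SOME \<gamma>. \<gamma> \<in> a)" for a
  have V: "V (path_class X \<gamma>) = T \<gamma>" if "\<gamma> \<in> loops_at X p" for \<gamma>
  proof -
    have "\<gamma> \<in> path_class X \<gamma>" using that by (simp add: path_class_def loops_at_def)
    then have "(SOME \<delta>. \<delta> \<in> path_class X \<gamma>) \<in> path_class X \<gamma>" by (rule someI[of "\<lambda>\<delta>. \<delta> \<in> path_class X \<gamma>"])
    then have "homotopic_paths X \<gamma> (SOME \<delta>. \<delta> \<in> path_class X \<gamma>)" unfolding path_class_def mem_Collect_eq .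
    from path_functional_homotopic[OF T this] show ?thesis by (simp add: V_def)
  qed
  have Vm: "V (a \<otimes>\<^bsub>fundamental_group X p\<^esub> b) = V a + V b"
    if ab: "a \<in> carrier (fundamental_group X p)" "b \<in> carrier (fundamental_group X p)" for a b
  proof -
    obtain \<gamma> \<delta> where g: "\<gamma> \<in> loops_at X p" "\<delta> \<in> loops_at X p" "a = path_class X \<gamma>" "b = path_class X \<delta>"
      using ab by (auto simp: carrier_fundamental_group)
    have "\<gamma> +++ \<delta> \<in> loops_at X p" using g(1,2) by (auto simp: loops_at_def path_image_join)
    moreover have "T (\<gamma> +++ \<delta>) = T \<gamma> + T \<delta>"
      by (rule path_functional_join[OF T]) (use g in \<open>auto simp: loops_at_def\<close>)
    ultimately show ?thesis using g mult_class[OF g(1,2)] by (simp add: V)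
  qed
  define x where "x = path_class X \<xi>"
  define y where "y = path_class X \<upsilon>"
  have xy: "x \<in> carrier (fundamental_group X p)" "y \<in> carrier (fundamental_group X p)"
    using l by (auto simp: carrier_fundamental_group x_def y_def)
  have hV: "hx (V x) = 1" "hy (V x) = 0" "hy (V y) \<noteq> 0" using h l by (auto simp: V x_def y_def)
  have V1: "V \<one>\<^bsub>fundamental_group X p\<^esub> = 0"
    using Vm[of "\<one>\<^bsub>fundamental_group X p\<^esub>" "\<one>\<^bsub>fundamental_group X p\<^esub>"]
    by simp (metis add_0_right add_left_imp_eq)
  have pow: "hx (V (x [^]\<^bsub>fundamental_group X p\<^esub> N)) = N \<and> hy (V (x [^]\<^bsub>fundamental_group X p\<^esub> N)) = 0" for N :: nat
    by (induction N) (use V1 Vm hV xy in \<open>auto simp: zero_heis_def\<close>)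
  have "x [^]\<^bsub>fundamental_group X p\<^esub> N \<otimes>\<^bsub>fundamental_group X p\<^esub> y \<noteq> y \<otimes>\<^bsub>fundamental_group X p\<^esub> x [^]\<^bsub>fundamental_group X p\<^esub> N"
    if N: "N > 0" for N :: nat
  proof
    let ?g = "V (x [^]\<^bsub>fundamental_group X p\<^esub> N)"
    assume "x [^]\<^bsub>fundamental_group X p\<^esub> N \<otimes>\<^bsub>fundamental_group X p\<^esub> y = y \<otimes>\<^bsub>fundamental_group X p\<^esub> x [^]\<^bsub>fundamental_group X p\<^esub> N"
    then have "?g + V y = V y + ?g" using Vm xy nat_pow_closed by metis
    \<comment> \<open>The corner entries of the two products differ by N times
      \<open>hy (V y)\<close>, because \<open>hx ?g = N\<close> and
      \<open>hy ?g = 0\<close>.\<close>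
    then have "hz (?g + V y) = hz (V y + ?g)" by (rule arg_cong)
    then show False using pow[of N] hV N by simp
  qed
  with xy show ?thesis by (rule that)
qed

lemma homological_representation_not_inj:
  fixes n :: nat
  assumes iso: "homology_group 1 (top_of_set X) \<cong> free_Abelian_group {..<n}" and n: "n \<ge> 3" and p: "p \<in> X"
    and K: "finite_index_characteristic K (fundamental_group X p)"
  shows "\<not> inj_on (homological_representation X A p K) (carrier (mapping_class_group X A p))"
proof
  assume inj: "inj_on (homological_representation X A p K) (carrier (mapping_class_group X A p))"
  let ?\<pi> = "fundamental_group X p"
  let ?id = "\<lambda>x\<in>X. x"
  let ?N = "{f \<in> diffeos X A p. isotopic X A p ?id f}"
  interpret group ?\<pi> by (rule group_fundamental_group[OF p])
  have A: "oriented_atlas X A" using surface by (simp add: closed_oriented_surface_def)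
  have Ks: "subgroup K ?\<pi>" "finite (rcosets\<^bsub>?\<pi>\<^esub> K)" using K by (auto simp: finite_index_characteristic_def)
  obtain x y where xy: "x \<in> carrier ?\<pi>" "y \<in> carrier ?\<pi>"
    "\<And>N::nat. N > 0 \<Longrightarrow> x [^]\<^bsub>?\<pi>\<^esub> N \<otimes>\<^bsub>?\<pi>\<^esub> y \<noteq> y \<otimes>\<^bsub>?\<pi>\<^esub> x [^]\<^bsub>?\<pi>\<^esub> N"
    by (rule power_not_commuting[OF iso n p]) blast
  obtain N :: nat where N: "N > 0" "x [^]\<^bsub>?\<pi>\<^esub> N \<in> K" using finite_index_power[OF Ks xy(1)] by blast
  define k where "k = x [^]\<^bsub>?\<pi>\<^esub> N"
  have kK: "k \<in> K" and kc: "k \<in> carrier ?\<pi>" using N xy(1) by (auto simp: k_def)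
  obtain \<gamma> where g: "\<gamma> \<in> loops_at X p" "k = path_class X \<gamma>" using kc by (auto simp: carrier_fundamental_group)
  obtain f where f: "pushes \<gamma> f" using push_exists g(1) by (auto simp: loops_at_def)
  have fd: "f \<in> diffeos X A p"
    by (rule oriented_diffeos_imp_diffeos) (use f g(1) in \<open>auto simp: pushes_def loops_at_def\<close>)
  have fconj: "fundamental_group_map X p f a = inv\<^bsub>?\<pi>\<^esub> k \<otimes>\<^bsub>?\<pi>\<^esub> a \<otimes>\<^bsub>?\<pi>\<^esub> k" if "a \<in> carrier ?\<pi>" for a
    using push_conjugation[OF f g(1) that] by (simp add: g(2))
  have idd: "?id \<in> diffeos X A p" "?id \<in> ?N" using isotopic_id[OF A p] unfolding isotopic_def by (auto; metis)+
  have idmap: "fundamental_group_map X p ?id a = a" if a: "a \<in> carrier ?\<pi>" for a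
  proof -
    obtain \<delta> where d: "\<delta> \<in> loops_at X p" "a = path_class X \<delta>" using a by (auto simp: carrier_fundamental_group)
    have "homotopic_paths X \<delta> (?id \<circ> \<delta>)"
      by (rule homotopic_paths_eq) (use d(1) in \<open>auto simp: loops_at_def path_image_def image_subset_iff\<close>)
    moreover have "continuous_on X ?id" "?id ` X \<subseteq> X" by (auto cong: continuous_on_cong)
    ultimately show ?thesis
      using fundamental_group_map_class[OF _ _ d(1), of ?id] path_class_eq d(2) by metis
  qed
  \<comment> \<open>The identity is treated as conjugation by the neutral element, so both actions
    are the identity of \<open>H1\<close>.\<close>
  have "homological_action X p K f = homological_action X p K ?id"
    using homological_action_inner[OF p Ks(1) kK fconj]
      homological_action_inner[OF p Ks(1) subgroup.one_closed[OF Ks(1)], of ?id] idmap by simp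
  then have "homological_representation X A p K (?N #>\<^bsub>diffeo_group X A p\<^esub> f)
     = homological_representation X A p K (?N #>\<^bsub>diffeo_group X A p\<^esub> ?id)"
    by (simp only: homological_representation_class[OF A p fd] homological_representation_class[OF A p idd(1)])
  moreover have "?N #>\<^bsub>diffeo_group X A p\<^esub> h \<in> carrier (mapping_class_group X A p)" if "h \<in> diffeos X A p" for h
    using that by (auto simp: mapping_class_group_def FactGroup_def RCOSETS_def diffeo_group_def)
  ultimately have eq: "?N #>\<^bsub>diffeo_group X A p\<^esub> f = ?N #>\<^bsub>diffeo_group X A p\<^esub> ?id"
    using inj_onD[OF inj] fd idd(1) by blast
  have coset: "?N #>\<^bsub>diffeo_group X A p\<^esub> h = (\<lambda>u. compose X u h) ` ?N" if "h \<in> diffeos X A p" for h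
    using that by (auto simp: r_coset_def diffeo_group_def BijGroup_def diffeos_def)
  \<comment> \<open>Equal cosets put \<open>f\<close> into the coset of the identity, so it is
    isotopic to the identity on \<open>X\<close> and fixes \<open>y\<close>. But \<open>f\<close>
    acts as conjugation by \<open>k\<close>, which does not commute with \<open>y\<close>.\<close>
  have "f = compose X ?id f"
    using fd by (auto simp: diffeos_def Bij_def bij_betw_def compose_def extensional_def fun_eq_iff)
  then have "f \<in> (\<lambda>u. compose X u ?id) ` ?N"
    using eq idd(2) unfolding coset[OF fd] coset[OF idd(1)] by blast
  then obtain h where h: "isotopic X A p ?id h" "f = compose X h ?id" by blast
  have "fundamental_group_map X p f y = y"
    using isotopic_fundamental_group_map[OF h(1) idd(1)] idmap[OF xy(2)] h(2) by simp
  then have "y = inv\<^bsub>?\<pi>\<^esub> k \<otimes>\<^bsub>?\<pi>\<^esub> (y \<otimes>\<^bsub>?\<pi>\<^esub> k)" using fconj[OF xy(2)] kc xy(2) by (simp add: m_assoc)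
  then have "k \<otimes>\<^bsub>?\<pi>\<^esub> y = y \<otimes>\<^bsub>?\<pi>\<^esub> k" using kc xy(2) by (metis inv_solve_left m_closed)
  then show False using xy(3)[OF N(1)] by (simp add: k_def)
qed

end

theorem theorem1p6:
  fixes X :: "'a::topological_space set" and A :: "'a chart set" and p :: 'a and g :: nat
  assumes "closed_oriented_surface X A"
    and "has_genus X g" and "g \<ge> 2"
    and "p \<in> X"
    and "\<rho> \<in> homological_representations X A p"
  shows "\<not> inj_on \<rho> (carrier (mapping_class_group X A p))"
proof -
  interpret closed_surface X A by standard fact
  obtain K where "finite_index_characteristic K (fundamental_group X p)" "\<rho> = homological_representation X A p K"
    using assms(5) by (auto simp: homological_representations_def)
  \<comment> \<open>Genus at least 2 gives rank 2g \<ge> 4, which leaves room for the three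
    independent classes.\<close>
  then show ?thesis
    using homological_representation_not_inj[of "2 * g" p K] assms by (simp add: has_genus_def)
qed

end
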